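(* Let $\mathbb K$ be a field, let $t,d\in\mathbb K$ with $2t=0$ such that $X^2+tX+d$ is irreducible over $\mathbb K$, and let $\mathbb L$, $P_{\mathbb L}$, $P_{\mathbb L}^\perp$, $P^0_{\mathbb L}:=P_{\mathbb L}\oplus\langle s_{01}\rangle$, $\xi$, $\Xi$, $i$, $E_2$ be as defined in the context. Then conjugation by $\xi$ induces the (possibly trivial) generator of $\mathrm{Gal}(\mathbb L/\mathbb K)$ on $\mathbb L$, and $$\mathrm{GL}_4(\mathbb K)_{P_{\mathbb L}}=\mathrm{GL}_2(\mathbb L)\langle\Xi\rangle=\mathrm{GL}_4(\mathbb K)_{P_{\mathbb L}^\perp},\quad\text{where } \mathrm{GL}_2(\mathbb L)=\left\{\begin{pmatrix} A & B \\ C & D \end{pmatrix}\ \middle|\ A,B,C,D\in\mathbb L,\ AD-BC\ne0\right\},$$ $$\mathrm{GL}_4(\mathbb K)_{P_{\mathbb L}^0}=\left\{\begin{pmatrix} A & B \\ 0 & D \end{pmatrix}\ \middle|\ A,D\in\mathbb L^\times,\ B\in\mathbb K^{2\times2}\right\}\langle\Xi\rangle.$$ The group $\mathrm{GL}_4(\mathbb K)_{P_{\mathbb L}}$ acts with $2$ orbits on $\mathbb K^4$, represented by $0$ and $b_0$, and with $2$ orbits on $\Lambda/P_{\mathbb L}^\perp$, represented by $P_{\mathbb L}^\perp$ and any other coset of $P_{\mathbb L}^\perp$. The orbits on $\Lambda/P_{\mathbb L}$ and those of $\mathrm{GL}_4(\mathbb K)_{P_{\mathbb L}^0}$ are as follows.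 (1) If $\mathbb L/\mathbb K$ is separable (in particular, if $\mathrm{char}\,\mathbb K\neq2$) then the action of $\mathrm{GL}_2(\mathbb L)$ on $\Lambda/P_{\mathbb L}$ is equivalent to the action $(g,M)\mapsto gMg^*$ on the $\mathbb K$-space of hermitian $2\times2$ matrices over $\mathbb L$. Here $\Xi$ acts as $-\mathrm{id}$ on the set of diagonal matrices, and an orbit under $\mathrm{GL}_2(\mathbb L)\langle\Xi\rangle$ is the union of two different $\mathrm{GL}_2(\mathbb L)$-orbits if, and only if, the norm group of the corresponding quaternion field does not contain $-1$. (2) Assume $\mathbb L/\mathbb K$ is inseparable. Then the action of $\mathrm{GL}_2(\mathbb L)$ on $P_{\mathbb L}^\perp/P_{\mathbb L}$ is equivalent to the action of $\mathrm{GL}_2(\mathbb L^{\square})\le\mathrm{GL}_2(\mathbb K)$ on $\mathbb K^2$ (where a matrix in $\mathrm{GL}_2(\mathbb L)$ acts by the matrix of the squares of its entries). The orbits under that action are represented by the elements of $\{(r,0)'\mid r\in R\}\cup R^{(2)}$. The $\mathrm{GL}_2(\mathbb L)$-orbits on $(\Lambda/P_{\mathbb L})\setminus(P_{\mathbb L}^\perp/P_{\mathbb L})$ are represented by the elements of $\{\rho_z+P_{\mathbb L}\mid z\in R_\#\}$, where $\rho_z:=\begin{pmatrix} z_1i & E_2 \\ E_2 & z_2i \end{pmatrix}$ for $z=(z_1,z_2)'\in\mathbb K^2$ and $R_\#$ is a set of representatives for the orbits under the action $$\#\colon\mathrm{SL}_2(\mathbb L)\times\mathbb K^2\to\mathbb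 K^2\colon\left(\begin{pmatrix} A & B \\ C & D \end{pmatrix},\begin{pmatrix} x_1 \\ x_2 \end{pmatrix}\right)\mapsto\begin{pmatrix} A^2x_1+B^2x_2+(AB+(AB)')i \\ C^2x_1+D^2x_2+(CD+(CD)')i \end{pmatrix}.$$ No point is fixed under this action of $\mathrm{SL}_2(\mathbb L)$ by affine transformations of $\mathbb K^2$ (viewed as an affine space over $\mathbb L^{\square}\le\mathbb K$). (3) In any case (separable or not) the orbits of $\mathrm{GL}_4(\mathbb K)_{P_{\mathbb L}^0}$ on $\mathbb K^4$ are represented by $0$, $b_0$, $b_2$. (4) Let $R_N\subseteq\mathbb K^\times$ be a set of representatives for the cosets modulo $N_{\mathbb L/\mathbb K}(\mathbb L^\times)\langle-1\rangle$. Then, again irrespective of separability, the orbits of $\mathrm{GL}_4(\mathbb K)_{P_{\mathbb L}^0}$ on $\Lambda/P_{\mathbb L}^0$ are represented by the elements of $\{P_{\mathbb L}^0,\ (s_{02}+s_{13})+P_{\mathbb L}^0\}\cup\{cs_{23}+P_{\mathbb L}^0\mid c\in R_N\}$.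
   Context: $X'$ denotes the transpose of a matrix $X$ over $\mathbb K$; $b_0,\dots,b_3$ is the standard basis of $\mathbb K^4$. $\Lambda=\mathbb K^4\wedge\mathbb K^4$ is the space of skew-symmetric $4\times4$ matrices over $\mathbb K$ with zero diagonal, $s_{jk}:=b_jb_k'-b_kb_j'$. $\mathrm{GL}_4(\mathbb K)$ acts on $\Lambda$ by $M.X:=MXM'$; $\mathrm{GL}_4(\mathbb K)_U$ denotes the stabilizer of $U\le\Lambda$. Orthogonality $\perp$ in $\Lambda$ is with respect to the polar form of the Pfaffian quadratic form $\mathrm{pf}\bigl(\sum_{j<k}x_{jk}s_{jk}\bigr)=x_{01}x_{23}-x_{02}x_{13}+x_{03}x_{12}$. "Orbits are represented by" the elements of a set means that the set is a system of representatives for the orbits. Actions on vector spaces over $\mathbb K$ are equivalent if there is a $\mathbb K$-linear bijection intertwining them. $E_2$ is the $2\times2$ identity matrix, $i:=\begin{pmatrix} 0 & 1 \\ -1 & 0 \end{pmatrix}$, $\delta:=\begin{pmatrix} d & 0 \\ 0 & -1 \end{pmatrix}$, $\xi:=\begin{pmatrix} 1 & t \\ 0 & -1 \end{pmatrix}$, $\Xi:=\begin{pmatrix} \xi & 0 \\ 0 & \xi \end{pmatrix}$. $\mathbb L:=\left\{\begin{pmatrix} x & -yd \\ y & x+yt \end{pmatrix}\ \middle|\ x,y\in\mathbb K\right\}\subseteq\mathbb K^{2\times2}$, a field isomorphic to $\mathbb K[X]/(X^2+tX+d)$; $\mathbb K$ is identified with the scalar matrices in $\mathbb L$, and $\mathbb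 L^{2\times2}$ is regarded as a set of $2\times 2$ block matrices in $\mathbb K^{4\times4}$. $\overline{X}:=\xi X\xi^{-1}$ for $X\in\mathbb L$; $N_{\mathbb L/\mathbb K}(X)=\overline XX$. $P_{\mathbb L}:=\left\{\begin{pmatrix} 0 & X\delta \\ -X\delta & 0 \end{pmatrix}\ \middle|\ X\in\mathbb L\right\}\le\Lambda$; its orthogonal space is $P_{\mathbb L}^\perp=\left\{\begin{pmatrix} xi & Yi \\ -(Yi)' & zi \end{pmatrix}\ \middle|\ x,z\in\mathbb K,Y\in\mathbb L\right\}$. In (1): for $g=\begin{pmatrix} A & B \\ C & D \end{pmatrix}\in\mathbb L^{2\times2}$ put $g^*:=\begin{pmatrix} \overline A & \overline C \\ \overline B & \overline D \end{pmatrix}$; hermitian matrices are those of the form $\begin{pmatrix} a & X \\ \overline X & c \end{pmatrix}$ with $a,c\in\mathbb K$, $X\in\mathbb L$, and they are the Gram matrices $M_h$ of hermitian forms $h$ on $\mathbb L^2$. The quaternion field corresponding to an anisotropic hermitian form $h$ is $\mathbb H^h=\{A\in\mathbb L^{2\times2}\mid A^*M_hA=M_h\det_{\mathbb L}A\}$, with norm $A\mapsto\det_{\mathbb L}A$ and norm group $\{\det_{\mathbb L} A\mid A\in\mathbb H^h\setminus\{0\}\}$. The action of $\Xi$ on hermitian matrices is the one transported from $\Lambda/P_{\mathbb L}$ via $\begin{pmatrix} a & X \\ \overline X & c \end{pmatrix}\leftrightarrow\begin{pmatrix} ai & Xi \\ \overline Xi & ci \end{pmatrix}+P_{\mathbb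 L}$. In (2) (so $\mathrm{char}\,\mathbb K=2$, $t=0$): $\mathbb L^{\square}:=\{x^2\mid x\in\mathbb L\}$, a subfield of $\mathbb K$; $R$ is a set of representatives for the orbits of the multiplicative group $\mathbb L^{\square}\setminus\{0\}$ acting on $\mathbb K$ by multiplication (so $0\in R$); $R^{(2)}\subseteq\mathbb K^2$ contains precisely one ordered $\mathbb L^{\square}$-basis $(x,z)'$ for each $2$-dimensional $\mathbb L^{\square}$-subspace of $\mathbb K$. The matrices $A^2$, $(AB+(AB)')i$ etc. in the definition of $\#$ are scalar matrices and are identified with elements of $\mathbb K$; $\mathrm{SL}_2(\mathbb L)$ consists of the block matrices with $AD-BC=1$.
   Formalization: In (4) the printed representatives are kept for d ≠ −1; for d = −1 (e.g. K = F_2, t = d = 1) s_02+s_13 lies in P_L, so its coset is trivial and the claim fails, and s_02 replaces s_02+s_13 there. *)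

theory Defs
  imports
    "HOL-Computational_Algebra.Polynomial"
    "HOL-Analysis.Determinants"
    "HOL-Library.Set_Algebras"
    "HOL-Algebra.Group_Action"
    "HOL-Algebra.Generated_Groups"
    "HOL-Algebra.Module"
begin

text \<open>
  On \<^typ>\<open>'k^'n\<close> the type-class operations \<open>*\<close>, \<open>1\<close> and \<open>^\<close> are componentwise, so matrix products are
  always written \<open>**\<close> and identity and scalar matrices as \<^term>\<open>mat c\<close>. Cosets \<open>X + U\<close> and sums of
  sets are those of \<^theory>\<open>HOL-Library.Set_Algebras\<close>.
\<close>

type_synonym 'k mat2 = "'k^2^2"
type_synonym 'k mat4 = "'k^4^4"

section \<open>Matrices\<close>

text \<open>Vectors and matrices of size 2 are indexed by \<open>1, 2\<close>; those of size 4 by \<open>0, 1, 2, 3\<close>,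
  in accordance with the names \<open>b\<^sub>0, \<dots>, b\<^sub>3\<close> and \<open>s\<^sub>j\<^sub>k\<close>.\<close>

definition mat22 :: "'k::field \<Rightarrow> 'k \<Rightarrow> 'k \<Rightarrow> 'k \<Rightarrow> 'k mat2" where
  "mat22 a b c d = vector [vector [a, b], vector [c, d]]"

definition upper_half :: "4 \<Rightarrow> bool" where
  "upper_half p \<longleftrightarrow> p = 0 \<or> p = 1"

definition in_half :: "4 \<Rightarrow> 2" where
  "in_half p = (if p = 0 \<or> p = 2 then 1 else 2)"

definition block :: "'k mat2 \<Rightarrow> 'k mat2 \<Rightarrow> 'k mat2 \<Rightarrow> 'k mat2 \<Rightarrow> 'k::field mat4" where
  "block A B C D = (\<chi> p q.
     (if upper_half p then (if upper_half q then A else B)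
      else (if upper_half q then C else D)) $ in_half p $ in_half q)"

definition blk11 :: "'k::field mat4 \<Rightarrow> 'k mat2" where
  "blk11 g = mat22 (g$0$0) (g$0$1) (g$1$0) (g$1$1)"
definition blk12 :: "'k::field mat4 \<Rightarrow> 'k mat2" where
  "blk12 g = mat22 (g$0$2) (g$0$3) (g$1$2) (g$1$3)"
definition blk21 :: "'k::field mat4 \<Rightarrow> 'k mat2" where
  "blk21 g = mat22 (g$2$0) (g$2$1) (g$3$0) (g$3$1)"
definition blk22 :: "'k::field mat4 \<Rightarrow> 'k mat2" where
  "blk22 g = mat22 (g$2$2) (g$2$3) (g$3$2) (g$3$3)"

definition mscale :: "'k::field \<Rightarrow> 'k^'n^'m \<Rightarrow> 'k^'n^'m" where
  "mscale c X = (\<chi> p q. c * X $ p $ q)"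

text \<open>The element of the field identified with a given scalar matrix.\<close>

definition scalar_of :: "'k::field mat2 \<Rightarrow> 'k" where
  "scalar_of X = (THE c. X = mat c)"

definition bvec :: "4 \<Rightarrow> 'k::field^4" where
  "bvec j = axis j 1"

section \<open>Groups, orbits and actions\<close>

definition GL :: "('k::field^'n^'n) monoid" where
  "GL = \<lparr>carrier = {M. invertible M}, mult = (**), one = mat 1\<rparr>"

definition units_of_field :: "'k::field monoid" where
  "units_of_field = \<lparr>carrier = {c. c \<noteq> 0}, mult = (*), one = 1\<rparr>"

definition system_of_reps :: "'a set \<Rightarrow> 'a set set \<Rightarrow> bool" where
  "system_of_reps R \<C> \<longleftrightarrow> R \<subseteq> \<Union>\<C> \<and> (\<forall>C\<in>\<C>. \<exists>!r. r \<in> R \<inter> C)"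

text \<open>A vector space over \<open>'k\<close> in the record format of \<^theory>\<open>HOL-Algebra.Module\<close>;
  the fields \<open>mult\<close> and \<open>one\<close> inherited from rings play no role.\<close>

definition kspace :: "'v set \<Rightarrow> 'v \<Rightarrow> ('v \<Rightarrow> 'v \<Rightarrow> 'v) \<Rightarrow> ('k \<Rightarrow> 'v \<Rightarrow> 'v) \<Rightarrow> ('k, 'v) module" where
  "kspace V z a s =
     \<lparr>carrier = V, mult = undefined, one = undefined, zero = z, add = a, smult = s\<rparr>"

text \<open>\<open>action_equivalence G V \<alpha> W \<beta> f\<close>: the linear bijection \<open>f\<close> intertwines the actions \<open>\<alpha>\<close>, \<open>\<beta>\<close>
  of \<open>G\<close> on \<open>V\<close> and \<open>W\<close>.\<close>

definition action_equivalence ::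
  "'g monoid \<Rightarrow> ('k, 'v) module \<Rightarrow> ('g \<Rightarrow> 'v \<Rightarrow> 'v) \<Rightarrow> ('k, 'w) module \<Rightarrow> ('g \<Rightarrow> 'w \<Rightarrow> 'w)
    \<Rightarrow> ('v \<Rightarrow> 'w) \<Rightarrow> bool" where
  "action_equivalence G V \<alpha> W \<beta> f \<longleftrightarrow>
     group_action G (carrier V) (\<lambda>g. restrict (\<alpha> g) (carrier V)) \<and>
     group_action G (carrier W) (\<lambda>g. restrict (\<beta> g) (carrier W)) \<and>
     bij_betw f (carrier V) (carrier W) \<and>
     (\<forall>x\<in>carrier V. \<forall>y\<in>carrier V. f (x \<oplus>\<^bsub>V\<^esub> y) = f x \<oplus>\<^bsub>W\<^esub> f y) \<and>
     (\<forall>c. \<forall>x\<in>carrier V. f (c \<odot>\<^bsub>V\<^esub> x) = c \<odot>\<^bsub>W\<^esub> f x) \<and>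
     (\<forall>g\<in>carrier G. \<forall>x\<in>carrier V. f (\<alpha> g x) = \<beta> g (f x))"

definition equivalent_actions ::
  "'g monoid \<Rightarrow> ('k, 'v) module \<Rightarrow> ('g \<Rightarrow> 'v \<Rightarrow> 'v) \<Rightarrow> ('k, 'w) module \<Rightarrow> ('g \<Rightarrow> 'w \<Rightarrow> 'w) \<Rightarrow> bool" where
  "equivalent_actions G V \<alpha> W \<beta> \<longleftrightarrow> (\<exists>f. action_equivalence G V \<alpha> W \<beta> f)"

section \<open>Alternating matrices\<close>

definition Lam :: "'k::field mat4 set" where
  "Lam = {X. transpose X = - X \<and> (\<forall>j. X $ j $ j = 0)}"

definition sbas :: "4 \<Rightarrow> 4 \<Rightarrow> 'k::field mat4" where
  "sbas j k = (\<chi> p q. bvec j $ p * bvec k $ q - bvec k $ p * bvec j $ q)"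

definition pf :: "'k::field mat4 \<Rightarrow> 'k" where
  "pf X = X$0$1 * X$2$3 - X$0$2 * X$1$3 + X$0$3 * X$1$2"

definition pf_polar :: "'k::field mat4 \<Rightarrow> 'k mat4 \<Rightarrow> 'k" where
  "pf_polar X Y = pf (X + Y) - pf X - pf Y"

definition perp :: "'k::field mat4 set \<Rightarrow> 'k mat4 set" where
  "perp U = {X \<in> Lam. \<forall>Y\<in>U. pf_polar X Y = 0}"

definition act :: "'k::field mat4 \<Rightarrow> 'k mat4 \<Rightarrow> 'k mat4" where
  "act M X = M ** X ** transpose M"

definition GL4_stab :: "'k::field mat4 set \<Rightarrow> 'k mat4 set" where
  "GL4_stab U = {M \<in> carrier GL. act M ` U = U}"

definition quot :: "'k::field mat4 set \<Rightarrow> 'k mat4 set \<Rightarrow> 'k mat4 set set" where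
  "quot V U = (\<lambda>X. X +o U) ` V"

definition coset_act :: "'k::field mat4 \<Rightarrow> 'k mat4 set \<Rightarrow> 'k mat4 set" where
  "coset_act M C = act M ` C"

text \<open>The union makes \<open>0 \<cdot> C = U\<close> come out right.\<close>

definition quot_space :: "'k::field mat4 set \<Rightarrow> 'k mat4 set \<Rightarrow> ('k, 'k mat4 set) module" where
  "quot_space V U = kspace (quot V U) U (+) (\<lambda>c C. \<Union>X\<in>C. mscale c X +o U)"

section \<open>The quadratic extension\<close>

definition LL :: "'k::field \<Rightarrow> 'k \<Rightarrow> 'k mat2 set" where
  "LL t d = {mat22 x (- (y * d)) y (x + y * t) | x y. True}"

definition LL_ring :: "'k::field \<Rightarrow> 'k \<Rightarrow> 'k mat2 ring" where
  "LL_ring t d = \<lparr>carrier = LL t d, mult = (**), one = mat 1, zero = 0, add = (+)\<rparr>"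

definition imat :: "'k::field mat2" where
  "imat = mat22 0 1 (- 1) 0"

definition delta :: "'k::field \<Rightarrow> 'k mat2" where
  "delta d = mat22 d 0 0 (- 1)"

definition xi :: "'k::field \<Rightarrow> 'k mat2" where
  "xi t = mat22 1 t 0 (- 1)"

definition Xi :: "'k::field \<Rightarrow> 'k mat4" where
  "Xi t = block (xi t) 0 0 (xi t)"

definition lconj :: "'k::field \<Rightarrow> 'k mat2 \<Rightarrow> 'k mat2" where
  "lconj t X = xi t ** X ** matrix_inv (xi t)"

definition Gal :: "'k::field \<Rightarrow> 'k \<Rightarrow> ('k mat2 \<Rightarrow> 'k mat2) set" where
  "Gal t d = {\<sigma> \<in> Bij (LL t d). \<sigma> \<in> ring_hom (LL_ring t d) (LL_ring t d) \<and> (\<forall>c. \<sigma> (mat c) = mat c)}"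

definition poly_at :: "'k::field poly \<Rightarrow> 'k mat2 \<Rightarrow> 'k mat2" where
  "poly_at p X = fold_coeffs (\<lambda>a Y. mat a + X ** Y) p 0"

text \<open>An irreducible polynomial annihilating \<open>X\<close> is, up to a unit, the minimal polynomial of \<open>X\<close>
  over the ground field.\<close>

definition separable_ext :: "'k::field \<Rightarrow> 'k \<Rightarrow> bool" where
  "separable_ext t d \<longleftrightarrow>
     (\<forall>X\<in>LL t d. \<exists>p. irreducible p \<and> poly_at p X = 0 \<and> coprime p (pderiv p))"

text \<open>The group of values \<open>N(X)\<close>, \<open>X \<noteq> 0\<close>, of the norm of the extension.\<close>

definition norm_values :: "'k::field \<Rightarrow> 'k \<Rightarrow> 'k set" where
  "norm_values t d = {c. \<exists>X\<in>LL t d - {0}. lconj t X ** X = mat c}"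

section \<open>The subspaces and their stabilizers\<close>

definition PL :: "'k::field \<Rightarrow> 'k \<Rightarrow> 'k mat4 set" where
  "PL t d = {block 0 (X ** delta d) (- (X ** delta d)) 0 | X. X \<in> LL t d}"

definition PL0 :: "'k::field \<Rightarrow> 'k \<Rightarrow> 'k mat4 set" where
  "PL0 t d = PL t d + range (\<lambda>c. mscale c (sbas 0 1))"

definition GL2L :: "'k::field \<Rightarrow> 'k \<Rightarrow> 'k mat4 set" where
  "GL2L t d = {block A B C D | A B C D.
     A \<in> LL t d \<and> B \<in> LL t d \<and> C \<in> LL t d \<and> D \<in> LL t d \<and> A ** D - B ** C \<noteq> 0}"

definition SL2L :: "'k::field \<Rightarrow> 'k \<Rightarrow> 'k mat4 set" where
  "SL2L t d = {block A B C D | A B C D.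
     A \<in> LL t d \<and> B \<in> LL t d \<and> C \<in> LL t d \<and> D \<in> LL t d \<and> A ** D - B ** C = mat 1}"

definition upper_triangular_group :: "'k::field \<Rightarrow> 'k \<Rightarrow> 'k mat4 set" where
  "upper_triangular_group t d =
     {block A B 0 D | A B D. A \<in> LL t d - {0} \<and> D \<in> LL t d - {0}}"

text \<open>The element \<open>s\<^sub>0\<^sub>2 + s\<^sub>1\<^sub>3\<close> represents a non-trivial coset of \<open>P\<^sup>0\<close> only if \<open>d \<noteq> -1\<close>. The case
  \<open>d = -1\<close> does occur in characteristic 2, for instance for \<open>X\<^sup>2 + X + 1\<close> over the field with two
  elements.\<close>

lemma sbas02_13_in_PL: "sbas 0 2 + sbas 1 3 \<in> PL (t :: 'a::field) (- 1)"
proof -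
  have n: "(3::4) \<noteq> 0" "(3::4) \<noteq> 1" "(3::4) \<noteq> 2" "(2::4) \<noteq> 0" "(2::4) \<noteq> 1" "(2::2) \<noteq> 1"
    and z: "(4::4) = 0" by simp_all
  have "sbas 0 2 + sbas 1 3 = block 0 (mat (- 1) ** delta (- 1)) (- (mat (- 1) ** delta (- 1))) (0 :: 'a mat2)"
    using n n[symmetric]
    by (simp add: vec_eq_iff forall_4 z sbas_def bvec_def axis_def block_def upper_half_def in_half_def
        delta_def mat22_def mat_def matrix_matrix_mult_def sum_2)
  moreover have "(mat (- 1) :: 'a mat2) = mat22 (- 1) (- (0 * (- 1))) 0 (- 1 + 0 * t)"
    by (simp add: vec_eq_iff forall_2 mat22_def mat_def)
  ultimately show ?thesis
    unfolding PL_def LL_def by blast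
qed

text \<open>\<open>H\<langle>\<Xi>\<rangle>\<close> for a set \<open>H\<close> of invertible matrices.\<close>

definition times_Xi :: "'k::field \<Rightarrow> 'k mat4 set \<Rightarrow> 'k mat4 set" where
  "times_Xi t H = H <#>\<^bsub>GL\<^esub> generate GL {Xi t}"

definition GLsub :: "'k::field mat4 set \<Rightarrow> 'k mat4 monoid" where
  "GLsub H = GL\<lparr>carrier := H\<rparr>"

section \<open>Hermitian matrices and quaternions\<close>

definition Herm :: "'k::field \<Rightarrow> 'k \<Rightarrow> 'k mat4 set" where
  "Herm t d = {block (mat a) X (lconj t X) (mat c) | a X c. X \<in> LL t d}"

definition diag_Herm :: "'k::field mat4 set" where
  "diag_Herm = {block (mat a) 0 0 (mat c) | a c. True}"

definition herm_space :: "'k::field \<Rightarrow> 'k \<Rightarrow> ('k, 'k mat4) module" where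
  "herm_space t d = kspace (Herm t d) 0 (+) mscale"

definition star :: "'k::field \<Rightarrow> 'k mat4 \<Rightarrow> 'k mat4" where
  "star t g = block (lconj t (blk11 g)) (lconj t (blk21 g)) (lconj t (blk12 g)) (lconj t (blk22 g))"

definition herm_act :: "'k::field \<Rightarrow> 'k mat4 \<Rightarrow> 'k mat4 \<Rightarrow> 'k mat4" where
  "herm_act t g M = g ** M ** star t g"

definition herm_to_quot :: "'k::field \<Rightarrow> 'k \<Rightarrow> 'k mat4 \<Rightarrow> 'k mat4 set" where
  "herm_to_quot t d M =
     block (blk11 M ** imat) (blk12 M ** imat) (blk21 M ** imat) (blk22 M ** imat) +o PL t d"

definition transported_act :: "'k::field \<Rightarrow> 'k \<Rightarrow> 'k mat4 \<Rightarrow> 'k mat4 \<Rightarrow> 'k mat4" where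
  "transported_act t d g M =
     the_inv_into (Herm t d) (herm_to_quot t d) (coset_act g (herm_to_quot t d M))"

text \<open>The hermitian form with Gram matrix \<open>M\<close>, evaluated on pairs of elements of \<open>\<bbbL>\<close>; it is
  semilinear in its first argument, so that a change of basis \<open>A\<close> turns \<open>M\<close> into \<open>A\<^sup>* M A\<close>.\<close>

definition herm_form :: "'k::field \<Rightarrow> 'k mat4 \<Rightarrow> 'k mat2 \<times> 'k mat2 \<Rightarrow> 'k mat2 \<times> 'k mat2 \<Rightarrow> 'k mat2" where
  "herm_form t M v w =
     lconj t (fst v) ** blk11 M ** fst w + lconj t (fst v) ** blk12 M ** snd w +
     lconj t (snd v) ** blk21 M ** fst w + lconj t (snd v) ** blk22 M ** snd w"

definition anisotropic :: "'k::field \<Rightarrow> 'k \<Rightarrow> 'k mat4 \<Rightarrow> bool" where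
  "anisotropic t d M \<longleftrightarrow> (\<forall>v \<in> LL t d \<times> LL t d - {(0, 0)}. herm_form t M v v \<noteq> 0)"

definition mats_over_L :: "'k::field \<Rightarrow> 'k \<Rightarrow> 'k mat4 set" where
  "mats_over_L t d = {block A B C D | A B C D.
     A \<in> LL t d \<and> B \<in> LL t d \<and> C \<in> LL t d \<and> D \<in> LL t d}"

definition det_L :: "'k::field mat4 \<Rightarrow> 'k mat2" where
  "det_L g = blk11 g ** blk22 g - blk12 g ** blk21 g"

definition quaternions :: "'k::field \<Rightarrow> 'k \<Rightarrow> 'k mat4 \<Rightarrow> 'k mat4 set" where
  "quaternions t d M =
     {A \<in> mats_over_L t d. star t A ** M ** A = M ** block (det_L A) 0 0 (det_L A)}"

definition norm_group :: "'k::field \<Rightarrow> 'k \<Rightarrow> 'k mat4 \<Rightarrow> 'k mat2 set" where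
  "norm_group t d M = det_L ` (quaternions t d M - {0})"

section \<open>The inseparable case\<close>

definition vec_space :: "('k::field, 'k^2) module" where
  "vec_space = kspace UNIV 0 (+) (*s)"

definition square :: "'k::field mat2 \<Rightarrow> 'k" where
  "square X = scalar_of (X ** X)"

definition Lsq :: "'k::field \<Rightarrow> 'k \<Rightarrow> 'k set" where
  "Lsq t d = {c. \<exists>X\<in>LL t d. X ** X = mat c}"

definition GL2Lsq :: "'k::field \<Rightarrow> 'k \<Rightarrow> 'k mat2 set" where
  "GL2Lsq t d = {N. invertible N \<and> (\<forall>p q. N $ p $ q \<in> Lsq t d)}"

definition squares_mat :: "'k::field mat4 \<Rightarrow> 'k mat2" where
  "squares_mat g = mat22 (square (blk11 g)) (square (blk12 g)) (square (blk21 g)) (square (blk22 g))"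

text \<open>\<open>(x, z)\<close> is an ordered \<open>F\<close>-basis of the two-dimensional \<open>F\<close>-subspace \<open>U\<close> of the field,
  for a subfield \<open>F\<close>.\<close>

definition ordered_basis2 :: "'k::field set \<Rightarrow> 'k set \<Rightarrow> 'k \<Rightarrow> 'k \<Rightarrow> bool" where
  "ordered_basis2 F U x z \<longleftrightarrow>
     U = {a * x + b * z | a b. a \<in> F \<and> b \<in> F} \<and>
     (\<forall>a\<in>F. \<forall>b\<in>F. a * x + b * z = 0 \<longrightarrow> a = 0 \<and> b = 0)"

definition two_dim_subspaces :: "'k::field set \<Rightarrow> 'k set set" where
  "two_dim_subspaces F = {U. \<exists>x z. ordered_basis2 F U x z}"

definition ordered_bases2 :: "'k::field set \<Rightarrow> 'k set \<Rightarrow> ('k^2) set" where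
  "ordered_bases2 F U = {v. ordered_basis2 F U (v$1) (v$2)}"

definition rho :: "'k::field^2 \<Rightarrow> 'k mat4" where
  "rho z = block (mat (z$1) ** imat) (mat 1) (mat 1) (mat (z$2) ** imat)"

definition hash_act :: "'k::field mat4 \<Rightarrow> 'k^2 \<Rightarrow> 'k^2" where
  "hash_act g x =
    (let A = blk11 g; B = blk12 g; C = blk21 g; D = blk22 g in vector
      [square A * x$1 + square B * x$2 + scalar_of ((A ** B + transpose (A ** B)) ** imat),
       square C * x$1 + square D * x$2 + scalar_of ((C ** D + transpose (C ** D)) ** imat)])"

definition affine_over :: "'k::field set \<Rightarrow> ('k^2 \<Rightarrow> 'k^2) \<Rightarrow> bool" where
  "affine_over F \<phi> \<longleftrightarrow> (\<exists>f c. (\<forall>x y. f (x + y) = f x + f y) \<and>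
     (\<forall>a\<in>F. \<forall>x. f (a *s x) = a *s f x) \<and> (\<forall>x. \<phi> x = f x + c))"

end

theory Submission
  imports Defs
begin

text \<open>
  For \<open>A\<close> in \<open>\<bbbL>\<close> one has \<open>iA' = conj(A)i\<close> and \<open>\<delta>A' = A\<delta>\<close>. Hence an element \<open>g\<close> of \<open>GL\<^sub>2(\<bbbL>)\<close> acts on \<open>P\<close> as multiplication
  by \<open>det g\<close>, and it maps \<open>M diag(i,i)\<close> to \<open>(g M g\<^sup>*) diag(i,i)\<close> for every \<open>M\<close> over \<open>\<bbbL>\<close>. The quotients
  \<open>X Y\<^sup>-\<^sup>1\<close> of elements of \<open>P\<close> form the field \<open>\<bbbL>\<close>, so the stabilizer of \<open>P\<close> normalizes \<open>\<bbbL>\<close>; the centralizer of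
  \<open>\<bbbL>\<close> is \<open>\<bbbL>\<^sup>2\<^sup>\<times>\<^sup>2\<close> and \<open>\<Xi>\<close> induces the conjugation. The subspace \<open>P\<^sup>\<bottom>\<close> has the same stabilizer because the Pfaffian
  is multiplied by a scalar under the action, and in \<open>P\<^sup>0\<close> the multiples of \<open>s\<^sub>0\<^sub>1\<close> are the only singular
  matrices, which forces block triangular form. Modulo \<open>P\<close> or \<open>P\<^sup>\<bottom>\<close> an alternating matrix is determined
  by its diagonal blocks and a vector in \<open>\<bbbK>\<^sup>2\<close> depending \<open>\<bbbL>\<close>-linearly on its upper right block; as \<open>\<bbbL>\<close> is
  transitive on the non-zero vectors of \<open>\<bbbK>\<^sup>2\<close>, the orbits can be read off.
\<close>

section \<open>Blocks and 2 by 2 matrices\<close>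

text \<open>Separable and inseparable extensions are handled together as long as possible. The
  device is a pair of linear maps \<open>fP\<close>, \<open>fQ\<close> from 2x2 matrices to K^2
  which turn left multiplication by L into matrix-vector multiplication. If L/K is separable, then L
  i and L delta are complementary, so P_perp is a complement of P and is described by hermitian
  matrices. If L/K is inseparable, then 2 = t = 0, conjugation is trivial, L i = L delta, hence P
  lies in P_perp, and the norm is squaring, a ring homomorphism into K.

  Xi sends a hermitian M to minus its conjugate. An anisotropic M and its conjugate have the same
  diagonal form, so an orbit stays whole exactly if M is congruent to -M; elements of norm 1 adjust
  the determinant of such a congruence to -1.

  The upper right block of s02 + s13 is E_2, and \<open>fP\<close> maps it to (1 + d, 0). If d = -1,
  which forces characteristic 2, this coset is trivial. The orbit in question is therefore first
  represented by any block E with nonzero \<open>fP E\<close>; E is E_2 in general and the block of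
  s02 if d = -1.\<close>

lemma four_distinct: "(0::4) \<noteq> 1" "(0::4) \<noteq> 2" "(0::4) \<noteq> 3" "(1::4) \<noteq> 2" "(1::4) \<noteq> 3" "(2::4) \<noteq> 3"
  "(1::4) \<noteq> 0" "(2::4) \<noteq> 0" "(3::4) \<noteq> 0" "(2::4) \<noteq> 1" "(3::4) \<noteq> 1" "(3::4) \<noteq> 2"
  by simp_all

lemma four_eq_zero: "(4::4) = 0"
  by simp

lemma forall_index4: "(\<forall>i::4. P i) \<longleftrightarrow> P 0 \<and> P 1 \<and> P 2 \<and> P 3"
  using forall_4[of P] by (auto simp: four_eq_zero)

lemma sum_index4: "sum f (UNIV::4 set) = f 0 + f 1 + f 2 + f 3"
  using sum_4[of f] by (simp add: four_eq_zero ac_simps)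

lemma half_simps [simp]:
  "upper_half 0" "upper_half 1" "\<not> upper_half 2" "\<not> upper_half 3"
  "in_half 0 = 1" "in_half 1 = 2" "in_half 2 = 1" "in_half 3 = 2"
  by (simp_all add: upper_half_def in_half_def four_distinct)

lemma mat22_nth [simp]:
  "mat22 a b c e $ 1 $ 1 = a" "mat22 a b c e $ 1 $ 2 = b" "mat22 a b c e $ 2 $ 1 = c" "mat22 a b c e $ 2 $ 2 = e"
  by (simp_all add: mat22_def)

lemma mat22_eta: "mat22 (X$1$1) (X$1$2) (X$2$1) (X$2$2) = X"
  by (simp add: vec_eq_iff forall_2)

lemma mat22_cases: obtains a b c e where "X = mat22 a b c e"
  by (metis mat22_eta)

lemma mat22_eq_iff: "mat22 a b c e = mat22 a' b' c' e' \<longleftrightarrow> a = a' \<and> b = b' \<and> c = c' \<and> e = e'"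
  by (auto simp: vec_eq_iff forall_2)

lemma mat22_mult: "mat22 a b c e ** mat22 a' b' c' e' =
    mat22 (a * a' + b * c') (a * b' + b * e') (c * a' + e * c') (c * b' + e * e')"
  by (simp add: vec_eq_iff forall_2 matrix_matrix_mult_def sum_2)

lemma mat22_add: "mat22 a b c e + mat22 a' b' c' e' = mat22 (a + a') (b + b') (c + c') (e + e')"
  by (simp add: vec_eq_iff forall_2)

lemma mat22_diff: "mat22 a b c e - mat22 a' b' c' e' = mat22 (a - a') (b - b') (c - c') (e - e')"
  by (simp add: vec_eq_iff forall_2)

lemma mat22_uminus: "- mat22 a b c e = mat22 (- a) (- b) (- c) (- e)"
  by (simp add: vec_eq_iff forall_2)

lemma mat22_transpose: "transpose (mat22 a b c e) = mat22 a c b e"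
  by (simp add: vec_eq_iff forall_2 transpose_def)

lemma mat22_mscale: "mscale r (mat22 a b c e) = mat22 (r * a) (r * b) (r * c) (r * e)"
  by (simp add: vec_eq_iff forall_2 mscale_def)

lemma mat22_mat: "(mat r :: 'a::field mat2) = mat22 r 0 0 r"
  by (simp add: vec_eq_iff forall_2 mat_def)

lemma mat22_zero: "(0 :: 'a::field mat2) = mat22 0 0 0 0"
  by (simp add: vec_eq_iff forall_2)

lemma mat22_mult_vec: "mat22 a b c e *v v = vector [a * v$1 + b * v$2, c * v$1 + e * v$2]"
  by (simp add: vec_eq_iff forall_2 matrix_vector_mult_def sum_2)

lemma vec2_eta: "vector [v$1, v$2] = (v :: 'a::zero^2)"
  by (simp add: vec_eq_iff forall_2)

lemma vec2_eq_iff: "vector [x, y] = (vector [x', y'] :: 'a::zero^2) \<longleftrightarrow> x = x' \<and> y = y'"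
  by (auto simp: vec_eq_iff forall_2)

lemmas mat22_simps = mat22_mult mat22_add mat22_diff mat22_uminus mat22_transpose mat22_mscale
  mat22_mat mat22_zero mat22_eq_iff imat_def delta_def xi_def

lemma block_nth:
  "block A B C D $ p $ q = (if upper_half p then (if upper_half q then A else B)
      else (if upper_half q then C else D)) $ in_half p $ in_half q"
  by (simp add: block_def)

lemma block_eq_iff: "block A B C D = block A' B' C' D' \<longleftrightarrow> A = A' \<and> B = B' \<and> C = C' \<and> D = D'"
  by (simp add: vec_eq_iff forall_2 forall_index4 block_nth) blast

lemma blk_block [simp]:
  "blk11 (block A B C D) = A" "blk12 (block A B C D) = B" "blk21 (block A B C D) = C" "blk22 (block A B C D) = D"
  by (simp_all add: blk11_def blk12_def blk21_def blk22_def block_nth mat22_eta)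

lemma block_eta: "block (blk11 g) (blk12 g) (blk21 g) (blk22 g) = g"
  by (simp add: vec_eq_iff forall_2 forall_index4 block_nth blk11_def blk12_def blk21_def blk22_def)

lemma block_cases: obtains A B C D where "g = block A B C D"
  by (metis block_eta)

lemma block_mult: "block A B C D ** block A' B' C' D' =
    block (A ** A' + B ** C') (A ** B' + B ** D') (C ** A' + D ** C') (C ** B' + D ** D')"
  by (simp add: vec_eq_iff forall_2 forall_index4 block_nth matrix_matrix_mult_def sum_2 sum_index4 ac_simps)

lemma block_add: "block A B C D + block A' B' C' D' = block (A + A') (B + B') (C + C') (D + D')"
  by (simp add: vec_eq_iff forall_2 forall_index4 block_nth)

lemma block_diff: "block A B C D - block A' B' C' D' = block (A - A') (B - B') (C - C') (D - D')"
  by (simp add: vec_eq_iff forall_2 forall_index4 block_nth)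

lemma block_uminus: "- block A B C D = block (- A) (- B) (- C) (- D)"
  by (simp add: vec_eq_iff forall_2 forall_index4 block_nth)

lemma block_transpose:
  "transpose (block A B C D) = block (transpose A) (transpose C) (transpose B) (transpose D)"
  by (simp add: vec_eq_iff forall_2 forall_index4 block_nth transpose_def)

lemma block_mscale: "mscale r (block A B C D) = block (mscale r A) (mscale r B) (mscale r C) (mscale r D)"
  by (simp add: vec_eq_iff forall_2 forall_index4 block_nth mscale_def)

lemma block_mat: "(mat r :: 'a::field mat4) = block (mat r) 0 0 (mat r)"
  by (simp add: vec_eq_iff forall_2 forall_index4 block_nth mat_def)

lemma block_zero: "(0 :: 'a::field mat4) = block 0 0 0 0"
  by (simp add: vec_eq_iff forall_2 forall_index4 block_nth)

lemmas block_simps = block_mult block_add block_diff block_uminus block_transpose block_mscale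
  block_mat block_zero block_eq_iff blk_block

lemma matrix_mul_uminus [simp]:
  fixes A :: "'a::field^'n^'m" and B :: "'a^'p^'n"
  shows "(- A) ** B = - (A ** B)" "A ** (- B) = - (A ** B)"
  by (simp_all add: vec_eq_iff matrix_matrix_mult_def sum_negf)

lemma matrix_add_rdistrib:
  fixes A B :: "'a::field^'n^'m"
  shows "(A + B) ** C = A ** C + B ** C"
  by (simp add: vec_eq_iff matrix_matrix_mult_def sum.distrib algebra_simps)

lemma matrix_diff_ldistrib:
  fixes A :: "'a::field^'n^'m"
  shows "A ** (B - C) = A ** B - A ** C"
  by (simp add: vec_eq_iff matrix_matrix_mult_def sum_subtractf algebra_simps)

lemma matrix_diff_rdistrib:
  fixes A B :: "'a::field^'n^'m"
  shows "(A - B) ** C = A ** C - B ** C"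
  by (simp add: vec_eq_iff matrix_matrix_mult_def sum_subtractf algebra_simps)

lemma matrix_mscale_mult:
  fixes A :: "'a::field^'n^'m" and B :: "'a^'p^'n"
  shows "mscale r A ** B = mscale r (A ** B)" "A ** mscale r B = mscale r (A ** B)"
  by (simp_all add: vec_eq_iff matrix_matrix_mult_def mscale_def sum_distrib_left ac_simps)

lemma matrix_mult_mat:
  fixes A :: "'a::field^'n^'m"
  shows "mat r ** A = mscale r A" "A ** mat r = mscale r A"
proof -
  have "(mat r :: 'a^'m^'m) = mscale r (mat 1)" "(mat r :: 'a^'n^'n) = mscale r (mat 1)"
    by (simp_all add: vec_eq_iff mscale_def mat_def)
  then show "mat r ** A = mscale r A" "A ** mat r = mscale r A"
    by (simp_all add: matrix_mscale_mult)
qed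

lemma mscale_simps [simp]:
  "mscale 0 X = 0" "mscale r 0 = 0" "mscale 1 X = X" "mscale (- 1) X = - X"
  "mscale r (mscale s X) = mscale (r * s) X"
  by (simp_all add: vec_eq_iff mscale_def)

lemma mscale_add:
  "mscale r (X + Y) = mscale r X + mscale r Y" "mscale (r + s) X = mscale r X + mscale s X"
  "mscale r (- X) = - mscale r X" "mscale r (X - Y) = mscale r X - mscale r Y"
  by (simp_all add: vec_eq_iff mscale_def algebra_simps)

lemma transpose_add: "transpose (A + B) = transpose A + transpose (B::'a::field^'n^'m)"
  by (simp add: vec_eq_iff transpose_def)

lemma transpose_uminus: "transpose (- A) = - transpose (A::'a::field^'n^'m)"
  by (simp add: vec_eq_iff transpose_def)

lemma transpose_mscale: "transpose (mscale r A) = mscale r (transpose A)"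
  by (simp add: vec_eq_iff transpose_def mscale_def)

lemma transpose_zero [simp]: "transpose (0::'a::field^'n^'m) = 0"
  by (simp add: vec_eq_iff transpose_def)

lemmas matrix_ring_simps = matrix_add_ldistrib matrix_add_rdistrib matrix_diff_ldistrib
  matrix_diff_rdistrib matrix_mscale_mult matrix_mul_uminus

lemma scalar_of_mat [simp]: "scalar_of (mat r) = r"
  by (auto simp: scalar_of_def mat22_mat mat22_eq_iff)

lemma transpose_diff: "transpose (A - B) = transpose A - transpose (B::'a::field^'n^'m)"
  by (simp add: vec_eq_iff transpose_def)

section \<open>The action on alternating matrices\<close>

lemma act_mult: "act (M ** N) X = act M (act N X)"
  by (simp add: act_def matrix_transpose_mul matrix_mul_assoc)

lemma act_one [simp]: "act (mat 1) X = X"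
  by (simp add: act_def)

lemma act_linear:
  "act M (X + Y) = act M X + act M Y" "act M (X - Y) = act M X - act M Y"
  "act M (mscale r X) = mscale r (act M X)" "act M 0 = 0" "act M (- X) = - act M X"
  by (simp_all add: act_def matrix_ring_simps matrix_mul_assoc)

text \<open>Unique coordinates on the alternating matrices: \<open>x\<close> and \<open>z\<close>
  are the coefficients at s01 and s23, the entries of \<open>Y\<close> are the other four.
  Membership in each subspace below becomes a linear condition on \<open>x\<close>,
  \<open>Y\<close>, \<open>z\<close>.\<close>

definition alt_mat :: "'k::field \<Rightarrow> 'k mat2 \<Rightarrow> 'k \<Rightarrow> 'k mat4" where
  "alt_mat x Y z = block (mscale x imat) Y (- transpose Y) (mscale z imat)"

lemma Lam_iff: "X \<in> Lam \<longleftrightarrow> (\<exists>x Y z. X = alt_mat x Y z)"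
proof
  assume X: "X \<in> Lam"
  then have "transpose X $ p $ q = (- X) $ p $ q" for p q
    by (simp add: Lam_def)
  then have skew: "X $ q $ p = - (X $ p $ q)" for p q
    unfolding transpose_def vec_lambda_beta vector_uminus_component .
  have diag: "X $ p $ p = 0" for p
    using X by (simp add: Lam_def)
  have "X = alt_mat (X$0$1) (blk12 X) (X$2$3)"
    by (simp add: alt_mat_def vec_eq_iff forall_index4 block_nth blk12_def mscale_def imat_def
        transpose_def diag skew[of 0 1] skew[of 0 2] skew[of 0 3] skew[of 1 2] skew[of 1 3] skew[of 2 3])
  then show "\<exists>x Y z. X = alt_mat x Y z" by blast
next
  assume "\<exists>x Y z. X = alt_mat x Y z"
  then obtain x Y z where "X = alt_mat x Y z" by blast
  then show "X \<in> Lam"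
    by (simp add: Lam_def alt_mat_def vec_eq_iff forall_index4 block_nth mscale_def imat_def transpose_def)
qed

lemma alt_mat_in_Lam [simp]: "alt_mat x Y z \<in> Lam"
  by (auto simp: Lam_iff)

lemma mscale_imat_eq_iff: "mscale x imat = mscale y imat \<longleftrightarrow> x = y"
  by (simp add: mat22_mscale mat22_eq_iff imat_def)

lemma alt_mat_eq_iff: "alt_mat x Y z = alt_mat x' Y' z' \<longleftrightarrow> x = x' \<and> Y = Y' \<and> z = z'"
  unfolding alt_mat_def block_eq_iff by (metis mscale_imat_eq_iff)

lemma alt_mat_linear:
  "alt_mat x Y z + alt_mat x' Y' z' = alt_mat (x + x') (Y + Y') (z + z')"
  "alt_mat x Y z - alt_mat x' Y' z' = alt_mat (x - x') (Y - Y') (z - z')"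
  "mscale r (alt_mat x Y z) = alt_mat (r * x) (mscale r Y) (r * z)"
  "- alt_mat x Y z = alt_mat (- x) (- Y) (- z)"
  "alt_mat 0 0 0 = 0"
proof -
  have [simp]: "mscale (r - s) X = mscale r X - mscale s X" "mscale (- r) X = - mscale r X" for r s and X :: "'a mat2"
    by (simp_all add: vec_eq_iff mscale_def algebra_simps)
  show "alt_mat x Y z + alt_mat x' Y' z' = alt_mat (x + x') (Y + Y') (z + z')"
    "alt_mat x Y z - alt_mat x' Y' z' = alt_mat (x - x') (Y - Y') (z - z')"
    "mscale r (alt_mat x Y z) = alt_mat (r * x) (mscale r Y) (r * z)"
    "- alt_mat x Y z = alt_mat (- x) (- Y) (- z)"
    "alt_mat 0 0 0 = 0"
    by (simp_all add: alt_mat_def block_simps mscale_add transpose_add transpose_diff transpose_uminus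
      transpose_mscale)
qed

definition det2 :: "'k::field mat2 \<Rightarrow> 'k" where
  "det2 A = A$1$1 * A$2$2 - A$1$2 * A$2$1"

text \<open>The alternating matrix Y - Y' is this multiple of \<open>imat\<close>. It measures what
  an off-diagonal block contributes to the diagonal blocks of M X M'.\<close>

definition skew_coeff :: "'k::field mat2 \<Rightarrow> 'k" where
  "skew_coeff Y = Y$1$2 - Y$2$1"

lemma alt_part: "Y - transpose Y = mscale (skew_coeff Y) imat"
  by (cases Y rule: mat22_cases) (simp add: mat22_simps skew_coeff_def)

lemma imat_congruence: "A ** imat ** transpose A = mscale (det2 A) imat"
  by (cases A rule: mat22_cases) (simp add: mat22_simps det2_def algebra_simps)

lemma transpose_imat: "transpose imat = - imat"
  by (simp add: mat22_simps)

text \<open>A diagonal block of M X M' is made of two congruences of multiples of i, which only pick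
  up determinants, and of W - W' with W = A Y B' or W = C Y D', which is alternating and so again a
  multiple of i.\<close>

lemma act_alt_mat:
  "act (block A B C D) (alt_mat x Y z) =
     alt_mat (det2 A * x + det2 B * z + skew_coeff (A ** Y ** transpose B))
       (mscale x (A ** imat ** transpose C) + A ** Y ** transpose D
         - B ** transpose Y ** transpose C + mscale z (B ** imat ** transpose D))
       (det2 C * x + det2 D * z + skew_coeff (C ** Y ** transpose D))"
proof -
  have diag: "mscale x (A ** imat ** transpose A) - B ** transpose Y ** transpose A
      + (A ** Y ** transpose B + mscale z (B ** imat ** transpose B))
    = mscale (det2 A * x + det2 B * z + skew_coeff (A ** Y ** transpose B)) imat" for A B :: "'a mat2"
  proof -
    have "mscale (skew_coeff (A ** Y ** transpose B)) imat = A ** Y ** transpose B - B ** transpose Y ** transpose A"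
      by (simp add: alt_part[symmetric] matrix_transpose_mul matrix_mul_assoc)
    then show ?thesis
      by (simp add: imat_congruence mscale_add algebra_simps)
  qed
  show ?thesis
    unfolding act_def alt_mat_def block_simps
    using diag[of A B] diag[of C D]
    by (simp add: matrix_ring_simps matrix_mul_assoc matrix_transpose_mul transpose_add transpose_diff
        transpose_uminus transpose_mscale transpose_imat mscale_add)
qed

lemma act_Lam: "X \<in> Lam \<Longrightarrow> act M X \<in> Lam"
  by (cases M rule: block_cases) (metis Lam_iff act_alt_mat)

lemma pf_alt_mat: "pf (alt_mat x Y z) = x * z - det2 Y"
  by (simp add: pf_def alt_mat_def block_nth mscale_def imat_def det2_def transpose_def)

lemma pf_polar_alt_mat: "pf_polar (alt_mat x Y z) (alt_mat x' Y' z') =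
   x * z' + z * x' - (Y$1$1 * Y'$2$2 + Y$2$2 * Y'$1$1 - Y$1$2 * Y'$2$1 - Y$2$1 * Y'$1$2)"
  by (simp add: pf_polar_def pf_alt_mat alt_mat_linear det2_def algebra_simps)

section \<open>Orbits, cosets and systems of representatives\<close>

text \<open>Formulated for total functions, so that actions can be given by plain formulas;
  \<open>acts_on_group_action\<close> restricts them to \<open>E\<close> to obtain the extensional
  bijections required by \<open>group_action\<close>.\<close>

definition acts_on :: "('g, 'm) monoid_scheme \<Rightarrow> 'x set \<Rightarrow> ('g \<Rightarrow> 'x \<Rightarrow> 'x) \<Rightarrow> bool" where
  "acts_on G E \<phi> \<longleftrightarrow> group G \<and> (\<forall>x\<in>E. \<phi> \<one>\<^bsub>G\<^esub> x = x) \<and>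
     (\<forall>g\<in>carrier G. \<forall>h\<in>carrier G. \<forall>x\<in>E. \<phi> (g \<otimes>\<^bsub>G\<^esub> h) x = \<phi> g (\<phi> h x)) \<and>
     (\<forall>g\<in>carrier G. \<forall>x\<in>E. \<phi> g x \<in> E)"

lemma acts_on_group: "acts_on G E \<phi> \<Longrightarrow> group G"
  and acts_on_one: "acts_on G E \<phi> \<Longrightarrow> x \<in> E \<Longrightarrow> \<phi> \<one>\<^bsub>G\<^esub> x = x"
  and acts_on_mult: "acts_on G E \<phi> \<Longrightarrow> g \<in> carrier G \<Longrightarrow> h \<in> carrier G \<Longrightarrow> x \<in> E
    \<Longrightarrow> \<phi> (g \<otimes>\<^bsub>G\<^esub> h) x = \<phi> g (\<phi> h x)"
  and acts_on_closed: "acts_on G E \<phi> \<Longrightarrow> g \<in> carrier G \<Longrightarrow> x \<in> E \<Longrightarrow> \<phi> g x \<in> E"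
  by (auto simp: acts_on_def)

lemma acts_on_inv:
  assumes "acts_on G E \<phi>" "g \<in> carrier G" "x \<in> E"
  shows "\<phi> (inv\<^bsub>G\<^esub> g) (\<phi> g x) = x" "\<phi> g (\<phi> (inv\<^bsub>G\<^esub> g) x) = x"
proof -
  have G: "group G" using assms(1) by (rule acts_on_group)
  have "inv\<^bsub>G\<^esub> g \<in> carrier G" using G assms(2) by (simp add: group.inv_closed)
  then show "\<phi> (inv\<^bsub>G\<^esub> g) (\<phi> g x) = x" "\<phi> g (\<phi> (inv\<^bsub>G\<^esub> g) x) = x"
    using acts_on_mult[OF assms(1), of "inv\<^bsub>G\<^esub> g" g x] acts_on_mult[OF assms(1), of g "inv\<^bsub>G\<^esub> g" x]
      acts_on_one[OF assms(1,3)] assms G by (simp_all add: group.l_inv group.r_inv)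
qed

lemma acts_on_group_action:
  assumes "acts_on G E \<phi>"
  shows "group_action G E (\<lambda>g. restrict (\<phi> g) E)"
proof -
  have G: "group G" using assms by (rule acts_on_group)
  have bij: "restrict (\<phi> g) E \<in> Bij E" if g: "g \<in> carrier G" for g
  proof -
    have gi: "inv\<^bsub>G\<^esub> g \<in> carrier G" using G g by (simp add: group.inv_closed)
    have "bij_betw (\<phi> g) E E"
      by (rule bij_betw_byWitness[where f' = "\<phi> (inv\<^bsub>G\<^esub> g)"])
        (use acts_on_inv[OF assms g] acts_on_closed[OF assms] g gi in auto)
    then have "bij_betw (restrict (\<phi> g) E) E E"
      by (subst bij_betw_cong[of E "restrict (\<phi> g) E" "\<phi> g"]) auto
    then show ?thesis by (simp add: Bij_def)
  qed
  have "(\<lambda>g. restrict (\<phi> g) E) \<in> hom G (BijGroup E)"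
  proof (rule homI)
    fix g h assume gh: "g \<in> carrier G" "h \<in> carrier G"
    show "restrict (\<phi> (g \<otimes>\<^bsub>G\<^esub> h)) E = restrict (\<phi> g) E \<otimes>\<^bsub>BijGroup E\<^esub> restrict (\<phi> h) E"
      using bij[OF gh(1)] bij[OF gh(2)] acts_on_mult[OF assms gh] acts_on_closed[OF assms gh(2)]
      by (auto simp: BijGroup_def compose_def fun_eq_iff)
  qed (use bij in \<open>simp add: BijGroup_def\<close>)
  then show ?thesis
    by (intro group_action.intro group_hom.intro group_hom_axioms.intro G group_BijGroup)
qed

lemma acts_on_orbit_eq_iff:
  assumes A: "acts_on G E \<phi>" and "x \<in> E" "y \<in> E"
  shows "orbit G \<phi> x = orbit G \<phi> y \<longleftrightarrow> (\<exists>g\<in>carrier G. \<phi> g x = y)"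
proof -
  have G: "group G" using A by (rule acts_on_group)
  have sub: "orbit G \<phi> (\<phi> g u) \<subseteq> orbit G \<phi> u" if "g \<in> carrier G" "u \<in> E" for g u
  proof
    fix w assume "w \<in> orbit G \<phi> (\<phi> g u)"
    then obtain h where h: "h \<in> carrier G" "w = \<phi> h (\<phi> g u)" by (auto simp: orbit_def)
    then have "w = \<phi> (h \<otimes>\<^bsub>G\<^esub> g) u" using acts_on_mult[OF A, of h g u] that by simp
    moreover have "h \<otimes>\<^bsub>G\<^esub> g \<in> carrier G" using G h that by (simp add: group.is_monoid monoid.m_closed)
    ultimately show "w \<in> orbit G \<phi> u" by (auto simp: orbit_def)
  qed
  show ?thesis
  proof
    assume eq: "orbit G \<phi> x = orbit G \<phi> y"
    have "\<one>\<^bsub>G\<^esub> \<in> carrier G" using G by (simp add: group.is_monoid monoid.one_closed)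
    then have "y \<in> orbit G \<phi> y" using acts_on_one[OF A assms(3)] by (force simp: orbit_def)
    then show "\<exists>g\<in>carrier G. \<phi> g x = y" unfolding eq[symmetric] by (auto simp: orbit_def)
  next
    assume "\<exists>g\<in>carrier G. \<phi> g x = y"
    then obtain g where g: "g \<in> carrier G" "\<phi> g x = y" by blast
    have "inv\<^bsub>G\<^esub> g \<in> carrier G" using G g by (simp add: group.inv_closed)
    then show "orbit G \<phi> x = orbit G \<phi> y"
      using sub[OF g(1) assms(2)] sub[of "inv\<^bsub>G\<^esub> g" y] acts_on_inv(1)[OF A g(1) assms(2)] g(2) assms(3)
      by auto
  qed
qed

lemma acts_on_mem_orbit:
  assumes "acts_on G E \<phi>" "x \<in> E"
  shows "y \<in> orbit G \<phi> x \<longleftrightarrow> y \<in> E \<and> orbit G \<phi> x = orbit G \<phi> y"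
proof -
  have "y \<in> orbit G \<phi> x \<longleftrightarrow> (\<exists>g\<in>carrier G. \<phi> g x = y)"
    by (auto simp: orbit_def)
  then show ?thesis
    using acts_on_orbit_eq_iff[OF assms] acts_on_closed[OF assms(1) _ assms(2)] by blast
qed

lemma system_of_reps_orbits_iff:
  assumes A: "acts_on G E \<phi>"
  shows "system_of_reps R (orbits G E \<phi>) \<longleftrightarrow>
     R \<subseteq> E \<and> (\<forall>x\<in>E. \<exists>!r. r \<in> R \<and> (\<exists>g\<in>carrier G. \<phi> g x = r))"
proof -
  have U: "\<Union> (orbits G E \<phi>) = E"
    using acts_on_mem_orbit[OF A] by (force simp: orbits_def)
  have "(\<forall>C\<in>orbits G E \<phi>. \<exists>!r. r \<in> R \<inter> C) \<longleftrightarrow> (\<forall>x\<in>E. \<exists>!r. r \<in> R \<inter> orbit G \<phi> x)"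
    unfolding orbits_def by blast
  also have "\<dots> \<longleftrightarrow> (\<forall>x\<in>E. \<exists>!r. r \<in> R \<and> (\<exists>g\<in>carrier G. \<phi> g x = r))"
  proof -
    have "r \<in> R \<inter> orbit G \<phi> x \<longleftrightarrow> r \<in> R \<and> (\<exists>g\<in>carrier G. \<phi> g x = r)" for r x
      by (auto simp: orbit_def)
    then show ?thesis by simp
  qed
  finally show ?thesis by (simp add: system_of_reps_def U)
qed

text \<open>Two representatives found in one orbit are joined by a group element, so uniqueness has
  to be tested between members of \<open>R\<close> only.\<close>

lemma system_of_reps_orbitsI:
  assumes A: "acts_on G E \<phi>" and R: "R \<subseteq> E"
    and ex: "\<And>x. x \<in> E \<Longrightarrow> \<exists>g\<in>carrier G. \<phi> g x \<in> R"
    and uniq: "\<And>r s g. r \<in> R \<Longrightarrow> s \<in> R \<Longrightarrow> g \<in> carrier G \<Longrightarrow> \<phi> g r = s \<Longrightarrow> r = s"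
  shows "system_of_reps R (orbits G E \<phi>)"
  unfolding system_of_reps_orbits_iff[OF A]
proof (intro conjI ballI R)
  fix x assume x: "x \<in> E"
  obtain g where g: "g \<in> carrier G" "\<phi> g x \<in> R" using ex[OF x] by blast
  show "\<exists>!r. r \<in> R \<and> (\<exists>g\<in>carrier G. \<phi> g x = r)"
  proof (rule ex1I[of _ "\<phi> g x"])
    fix r assume r: "r \<in> R \<and> (\<exists>g\<in>carrier G. \<phi> g x = r)"
    then have "orbit G \<phi> x = orbit G \<phi> r" "orbit G \<phi> x = orbit G \<phi> (\<phi> g x)"
      using acts_on_orbit_eq_iff[OF A x] R g by blast+
    then have "\<exists>h\<in>carrier G. \<phi> h r = \<phi> g x"
      using acts_on_orbit_eq_iff[OF A, of r "\<phi> g x"] r R g by auto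
    then show "r = \<phi> g x" using uniq r g by blast
  qed (use g in blast)
qed

lemma card_orbits:
  assumes A: "acts_on G E \<phi>" and R: "system_of_reps R (orbits G E \<phi>)"
  shows "card (orbits G E \<phi>) = card R"
proof -
  have RE: "R \<subseteq> E" and u: "\<And>x. x \<in> E \<Longrightarrow> \<exists>!r. r \<in> R \<and> (\<exists>g\<in>carrier G. \<phi> g x = r)"
    using R unfolding system_of_reps_orbits_iff[OF A] by blast+
  have u: "\<exists>!r. r \<in> R \<and> orbit G \<phi> x = orbit G \<phi> r" if "x \<in> E" for x
  proof -
    have "r \<in> R \<and> orbit G \<phi> x = orbit G \<phi> r \<longleftrightarrow> r \<in> R \<and> (\<exists>g\<in>carrier G. \<phi> g x = r)" for r
      using acts_on_orbit_eq_iff[OF A that, of r] RE by blast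
    then show ?thesis using u[OF that] by simp
  qed
  have "inj_on (orbit G \<phi>) R"
    by (rule inj_onI) (use u RE in blast)
  moreover have "orbit G \<phi> ` R = orbits G E \<phi>"
  proof
    show "orbit G \<phi> ` R \<subseteq> orbits G E \<phi>" using RE by (auto simp: orbits_def)
    show "orbits G E \<phi> \<subseteq> orbit G \<phi> ` R"
    proof
      fix C assume "C \<in> orbits G E \<phi>"
      then obtain x where "x \<in> E" "C = orbit G \<phi> x" by (auto simp: orbits_def)
      then show "C \<in> orbit G \<phi> ` R" using u[of x] by blast
    qed
  qed
  ultimately show ?thesis by (metis card_image)
qed

definition ksubspace :: "'k::field mat4 set \<Rightarrow> bool" where
  "ksubspace U \<longleftrightarrow> 0 \<in> U \<and> (\<forall>X\<in>U. \<forall>Y\<in>U. X + Y \<in> U) \<and> (\<forall>r. \<forall>X\<in>U. mscale r X \<in> U)"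

lemma ksubspace_closed:
  assumes "ksubspace U"
  shows "0 \<in> U" "X \<in> U \<Longrightarrow> Y \<in> U \<Longrightarrow> X + Y \<in> U" "X \<in> U \<Longrightarrow> mscale r X \<in> U"
    "X \<in> U \<Longrightarrow> - X \<in> U" "X \<in> U \<Longrightarrow> Y \<in> U \<Longrightarrow> X - Y \<in> U"
proof -
  show "0 \<in> U" and add: "X \<in> U \<Longrightarrow> Y \<in> U \<Longrightarrow> X + Y \<in> U" and sc: "X \<in> U \<Longrightarrow> mscale r X \<in> U" for X Y r
    using assms by (auto simp: ksubspace_def)
  show "X \<in> U \<Longrightarrow> - X \<in> U" "X \<in> U \<Longrightarrow> Y \<in> U \<Longrightarrow> X - Y \<in> U" for X Y
    using sc[of X "- 1"] sc[of Y "- 1"] add[of X "- Y"] by simp_all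
qed

lemma mem_coset_iff: "(Z::'k::field mat4) \<in> X +o U \<longleftrightarrow> Z - X \<in> U"
  unfolding elt_set_plus_def by (auto intro!: bexI[of _ "Z - X"])

lemma coset_eq_iff:
  assumes "ksubspace U"
  shows "X +o U = Y +o U \<longleftrightarrow> X - Y \<in> U"
proof
  assume "X +o U = Y +o U"
  moreover have "X \<in> X +o U" by (simp add: mem_coset_iff ksubspace_closed[OF assms])
  ultimately show "X - Y \<in> U" by (simp add: mem_coset_iff)
next
  assume "X - Y \<in> U"
  then have "Z - X \<in> U \<longleftrightarrow> Z - Y \<in> U" for Z
    using ksubspace_closed(2)[OF assms, of "Z - X" "X - Y"] ksubspace_closed(5)[OF assms, of "Z - Y" "X - Y"]
    by auto
  then show "X +o U = Y +o U" by (auto simp: mem_coset_iff set_eq_iff)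
qed

lemma coset_zero: "(0::'k::field mat4) +o U = U"
  by (auto simp: mem_coset_iff)

lemma coset_eq_self_iff: "ksubspace U \<Longrightarrow> X +o U = U \<longleftrightarrow> X \<in> U"
  using coset_eq_iff[of U X 0] by (simp add: coset_zero)

lemma coset_add:
  assumes "ksubspace U"
  shows "(X +o U) + (Y +o U) = (X + Y) +o U"
proof -
  have "U + U = U"
  proof
    show "U + U \<subseteq> U" using ksubspace_closed(2)[OF assms] by (auto simp: set_plus_def)
    show "U \<subseteq> U + U"
    proof
      fix x assume "x \<in> U"
      then have "x + 0 \<in> U + U" using ksubspace_closed(1)[OF assms] by (rule set_plus_intro)
      then show "x \<in> U + U" by simp
    qed
  qed
  then show ?thesis by (simp add: set_plus_rearrange)
qed

text \<open>Scalar multiplication on a quotient is encoded as a union over all representatives. All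
  cosets in this union coincide, also for the scalar 0.\<close>

lemma coset_smult:
  assumes "ksubspace U"
  shows "(\<Union>X\<in>Y +o U. mscale c X +o U) = mscale c Y +o U"
proof -
  have "mscale c X +o U = mscale c Y +o U" if "X \<in> Y +o U" for X
    using that ksubspace_closed(3)[OF assms, of "X - Y" c]
    by (simp add: coset_eq_iff[OF assms] mem_coset_iff mscale_add)
  moreover have "Y \<in> Y +o U" by (simp add: mem_coset_iff ksubspace_closed[OF assms])
  ultimately show ?thesis by blast
qed

lemma coset_in_quot: "X \<in> V \<Longrightarrow> X +o U \<in> quot V U"
  by (simp add: quot_def)

lemma quot_cases:
  assumes "C \<in> quot V U" obtains X where "X \<in> V" "C = X +o U"
  using assms by (auto simp: quot_def)

lemma coset_in_quot_iff:
  assumes "ksubspace U" "ksubspace V" "U \<subseteq> V"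
  shows "X +o U \<in> quot V U \<longleftrightarrow> X \<in> V"
proof
  assume "X +o U \<in> quot V U"
  then obtain Y where Y: "Y \<in> V" "X +o U = Y +o U" by (rule quot_cases)
  then have "X - Y \<in> V" using assms by (auto simp: coset_eq_iff)
  then show "X \<in> V" using ksubspace_closed(2)[OF assms(2), of "X - Y" Y] Y by simp
qed (rule coset_in_quot)

section \<open>The general linear group and stabilizers\<close>

lemma invertible_mat_1: "invertible (mat 1 :: 'k::field^'n^'n)"
  by (auto simp: invertible_def intro: exI[of _ "mat 1"])

lemma group_GL: "group (GL :: ('k::field^'n^'n) monoid)"
proof (rule groupI)
  fix x :: "'k^'n^'n" assume "x \<in> carrier GL"
  then show "\<exists>y\<in>carrier GL. y \<otimes>\<^bsub>GL\<^esub> x = \<one>\<^bsub>GL\<^esub>"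
    by (auto simp: GL_def invertible_def)
qed (simp_all add: GL_def invertible_mult matrix_mul_assoc invertible_mat_1)

lemma GL_simps [simp]:
  "carrier GL = {M. invertible M}" "x \<otimes>\<^bsub>GL\<^esub> y = x ** y" "\<one>\<^bsub>GL\<^esub> = mat 1"
  by (simp_all add: GL_def)

lemma GLsub_simps [simp]:
  "carrier (GLsub H) = H" "x \<otimes>\<^bsub>GLsub H\<^esub> y = x ** y" "\<one>\<^bsub>GLsub H\<^esub> = mat 1"
  by (simp_all add: GLsub_def)

text \<open>A right inverse inside \<open>H\<close> suffices: for square matrices it is two-sided,
  which also makes the members of \<open>H\<close> invertible.\<close>

lemma subgroup_GLI:
  fixes H :: "('k::field^'n^'n) set"
  assumes "\<And>M. M \<in> H \<Longrightarrow> \<exists>N\<in>H. M ** N = mat 1" "mat 1 \<in> H" "\<And>M N. M \<in> H \<Longrightarrow> N \<in> H \<Longrightarrow> M ** N \<in> H"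
  shows "subgroup H GL"
proof -
  have inv: "invertible M" if M: "M \<in> H" for M
  proof -
    obtain N where "M ** N = mat 1" using assms(1)[OF M] by blast
    then show ?thesis by (auto simp: invertible_def matrix_left_right_inverse)
  qed
  show ?thesis
  proof (rule group.subgroupI[OF group_GL])
    fix M assume M: "M \<in> H"
    obtain N where N: "N \<in> H" "M ** N = mat 1" using assms(1)[OF M] by blast
    then have "inv\<^bsub>GL\<^esub> M = N"
      using inv M by (intro group.inv_equality[OF group_GL]) (auto simp: matrix_left_right_inverse)
    then show "inv\<^bsub>GL\<^esub> M \<in> H" using N by simp
  qed (use assms inv in auto)
qed

lemma subgroup_GL_inverse:
  assumes "subgroup H GL" "M \<in> H"
  obtains N where "N \<in> H" "M ** N = mat 1" "N ** M = mat 1"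
proof -
  have M: "M \<in> carrier GL" using assms by (rule subgroup.mem_carrier)
  show thesis
    using that[of "inv\<^bsub>GL\<^esub> M"] subgroup.m_inv_closed[OF assms]
      group.l_inv[OF group_GL M] group.r_inv[OF group_GL M] by simp
qed

lemma group_GLsub: "subgroup H GL \<Longrightarrow> group (GLsub H)"
  unfolding GLsub_def by (rule subgroup.subgroup_is_group[OF _ group_GL])

lemma act_inverse: "N ** M = mat 1 \<Longrightarrow> act N (act M X) = X"
  by (metis act_mult act_one)

lemma stab_subgroup: "subgroup (GL4_stab U) GL"
proof (rule subgroup_GLI)
  fix M :: "'a mat4" assume M: "M \<in> GL4_stab U"
  then obtain N where N: "M ** N = mat 1" "N ** M = mat 1"
    by (auto simp: GL4_stab_def invertible_def)
  have "act N ` U = act N ` (act M ` U)" using M by (simp add: GL4_stab_def)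
  also have "\<dots> = U" by (simp add: image_image act_inverse[OF N(2)])
  finally show "\<exists>N\<in>GL4_stab U. M ** N = mat 1"
    using N by (auto simp: GL4_stab_def invertible_def)
next
  fix M N :: "'a mat4" assume MN: "M \<in> GL4_stab U" "N \<in> GL4_stab U"
  have "act (M ** N) ` U = act M ` (act N ` U)" by (simp add: act_mult image_image)
  then show "M ** N \<in> GL4_stab U" using MN by (simp add: GL4_stab_def invertible_mult)
qed (simp add: GL4_stab_def invertible_mat_1)

text \<open>The inverse of \<open>M\<close> lies in the group too and maps \<open>U\<close> into
  itself, which turns the inclusion for \<open>M\<close> into an equality.\<close>

lemma subset_stabI:
  assumes H: "subgroup H GL" and cl: "\<And>M X. M \<in> H \<Longrightarrow> X \<in> U \<Longrightarrow> act M X \<in> U"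
  shows "H \<subseteq> GL4_stab U"
proof
  fix M assume M: "M \<in> H"
  obtain N where N: "N \<in> H" "M ** N = mat 1" by (rule subgroup_GL_inverse[OF H M])
  have "U \<subseteq> act M ` U"
    using cl[OF N(1)] act_inverse[OF N(2)] by (metis image_eqI subsetI)
  then show "M \<in> GL4_stab U"
    using cl[OF M] subgroup.mem_carrier[OF H M] by (auto simp: GL4_stab_def)
qed

lemma stab_act: "M \<in> GL4_stab U \<Longrightarrow> X \<in> U \<Longrightarrow> act M X \<in> U"
  by (auto simp: GL4_stab_def)

lemma coset_act_coset:
  assumes "M \<in> GL4_stab U"
  shows "coset_act M (X +o U) = act M X +o U"
proof -
  have "Y +o V = (\<lambda>Z. Y + Z) ` V" for Y :: "'a mat4" and V
    by (auto simp: elt_set_plus_def)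
  then have "coset_act M (X +o U) = act M X +o (act M ` U)"
    by (simp add: coset_act_def image_image act_linear)
  then show ?thesis using assms by (simp add: GL4_stab_def)
qed

lemma acts_on_quot:
  assumes H: "subgroup H GL" "H \<subseteq> GL4_stab U" and V: "\<And>M X. M \<in> H \<Longrightarrow> X \<in> V \<Longrightarrow> act M X \<in> V"
  shows "acts_on (GLsub H) (quot V U) coset_act"
  unfolding acts_on_def
proof (intro conjI ballI)
  have st: "coset_act M (X +o U) = act M X +o U" if "M \<in> H" for M X
    using coset_act_coset H(2) that by blast
  show "group (GLsub H)" by (rule group_GLsub[OF H(1)])
  fix C assume "C \<in> quot V U"
  then obtain X where X: "X \<in> V" "C = X +o U" by (rule quot_cases)
  show "coset_act \<one>\<^bsub>GLsub H\<^esub> C = C" by (simp add: coset_act_def)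
  fix M assume M: "M \<in> carrier (GLsub H)"
  then show "coset_act M C \<in> quot V U" using X V st by (auto simp: quot_def)
  fix N assume N: "N \<in> carrier (GLsub H)"
  show "coset_act (M \<otimes>\<^bsub>GLsub H\<^esub> N) C = coset_act M (coset_act N C)"
    by (simp add: coset_act_def act_mult image_image)
qed

lemma acts_on_vec:
  assumes "subgroup H (GL :: ('k::field^'n^'n) monoid)"
  shows "acts_on (GL\<lparr>carrier := H\<rparr>) (UNIV :: ('k^'n) set) (*v)"
  unfolding acts_on_def
  using subgroup.subgroup_is_group[OF assms group_GL] by (simp add: matrix_vector_mul_assoc)

section \<open>The polar form of the Pfaffian under congruence\<close>

lemma mscale_nth [simp]: "mscale r X $ i $ j = r * X $ i $ j"
  by (simp add: mscale_def)

lemma pf_polar_linear: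
  assumes "X \<in> Lam" "X' \<in> Lam" "Y \<in> Lam"
  shows "pf_polar (X + X') Y = pf_polar X Y + pf_polar X' Y" "pf_polar (mscale r X) Y = r * pf_polar X Y"
  using assms by (auto simp: Lam_iff alt_mat_linear pf_polar_alt_mat algebra_simps)

lemma pf_polar_commute: "pf_polar X Y = pf_polar Y X"
  by (simp add: pf_polar_def add.commute)

lemma pf_polar_linear_right:
  assumes "X \<in> Lam" "X' \<in> Lam" "Y \<in> Lam"
  shows "pf_polar Y (X + X') = pf_polar Y X + pf_polar Y X'" "pf_polar Y (mscale r X) = r * pf_polar Y X"
  using pf_polar_linear[OF assms] by (simp_all only: pf_polar_commute[of Y])

text \<open>The matrices s01, s02, s03, s12, s13, s23, in this order.\<close>

definition alt_basis :: "'k::field mat4 set" where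
  "alt_basis = {alt_mat 1 0 0, alt_mat 0 (mat22 1 0 0 0) 0, alt_mat 0 (mat22 0 1 0 0) 0,
     alt_mat 0 (mat22 0 0 1 0) 0, alt_mat 0 (mat22 0 0 0 1) 0, alt_mat 0 0 1}"

lemma alt_basis_induct:
  assumes "X \<in> Lam" and add: "\<And>X Y. X \<in> Lam \<Longrightarrow> Y \<in> Lam \<Longrightarrow> Q X \<Longrightarrow> Q Y \<Longrightarrow> Q (X + Y)"
    and scale: "\<And>r X. X \<in> Lam \<Longrightarrow> Q X \<Longrightarrow> Q (mscale r X)" and basis: "\<And>X. X \<in> alt_basis \<Longrightarrow> Q X"
  shows "Q X"
proof -
  obtain x a b c e z where X: "X = alt_mat x (mat22 a b c e) z"
    using assms(1) unfolding Lam_iff by (metis mat22_eta)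
  have "X = mscale x (alt_mat 1 0 0) + (mscale a (alt_mat 0 (mat22 1 0 0 0) 0) + (mscale b (alt_mat 0 (mat22 0 1 0 0) 0)
     + (mscale c (alt_mat 0 (mat22 0 0 1 0) 0) + (mscale e (alt_mat 0 (mat22 0 0 0 1) 0) + mscale z (alt_mat 0 0 1)))))"
    unfolding X alt_mat_linear alt_mat_eq_iff by (simp add: mat22_simps)
  moreover have L: "alt_basis \<subseteq> Lam" by (auto simp: alt_basis_def)
  ultimately show ?thesis
    by (simp only:) (intro add scale basis; simp add: alt_mat_linear alt_basis_def)
qed

text \<open>The factor is in fact det M, but its existence is enough for comparing orthogonal
  spaces. Bilinearity reduces the claim to the 36 pairs of basis elements, where it is a polynomial
  identity in the entries of M.\<close>

lemma pf_polar_act: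
  "\<exists>c. \<forall>X\<in>Lam. \<forall>Y\<in>Lam. pf_polar (act M X) (act M Y) = c * pf_polar X (Y :: 'a::field mat4)"
proof -
  obtain A B C D where M: "M = block A B C D" by (rule block_cases)
  obtain a1 a2 a3 a4 where A: "A = mat22 a1 a2 a3 a4" by (rule mat22_cases)
  obtain b1 b2 b3 b4 where B: "B = mat22 b1 b2 b3 b4" by (rule mat22_cases)
  obtain c1 c2 c3 c4 where C: "C = mat22 c1 c2 c3 c4" by (rule mat22_cases)
  obtain d1 d2 d3 d4 where D: "D = mat22 d1 d2 d3 d4" by (rule mat22_cases)
  \<comment> \<open>The polar form takes the value 1 on s01 and s23, so the factor can only be its
    value on their images.\<close>
  define c where "c = pf_polar (act M (alt_mat 1 0 0)) (act M (alt_mat 0 0 1))"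
  have basis: "pf_polar (act M X) (act M Y) = c * pf_polar X Y" if "X \<in> alt_basis" "Y \<in> alt_basis" for X Y
    using that unfolding alt_basis_def
    by (elim insertE emptyE; hypsubst; unfold c_def M act_alt_mat pf_polar_alt_mat;
        simp add: A B C D det2_def skew_coeff_def mat22_mult imat_def mat22_transpose mat22_mscale mat22_add
          mat22_diff mat22_zero algebra_simps)
  have *: "pf_polar (act M X) (act M Y) = c * pf_polar X Y" if "X \<in> Lam" "Y \<in> alt_basis" for X Y
    using that(1)
  proof (induction X rule: alt_basis_induct)
    case (2 X X')
    moreover have "Y \<in> Lam" using that(2) by (auto simp: alt_basis_def)
    ultimately show ?case by (simp add: act_linear pf_polar_linear act_Lam algebra_simps)
  next
    case (3 r X)
    moreover have "Y \<in> Lam" using that(2) by (auto simp: alt_basis_def)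
    ultimately show ?case by (simp add: act_linear pf_polar_linear act_Lam algebra_simps)
  qed (use that basis in auto)
  have "pf_polar (act M X) (act M Y) = c * pf_polar X Y" if "X \<in> Lam" "Y \<in> Lam" for X Y
    using that(2)
  proof (induction Y rule: alt_basis_induct)
    case (2 Y Y')
    then show ?case using that(1) by (simp add: act_linear pf_polar_linear_right act_Lam distrib_left)
  next
    case (3 r Y)
    then show ?case using that(1) by (simp add: act_linear pf_polar_linear_right act_Lam)
  qed (use that * in auto)
  then show ?thesis by blast
qed

section \<open>The field \<open>\<bbbL>\<close>\<close>

lemma det2_mult: "det2 (A ** B) = det2 A * det2 B"
  by (cases A rule: mat22_cases; cases B rule: mat22_cases) (simp add: det2_def mat22_mult algebra_simps)

lemma det2_simps [simp]: "det2 (mat r) = r * r" "det2 0 = 0" "det2 (- A) = det2 A" "det2 (mat22 a b c e) = a * e - b * c"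
  by (cases A rule: mat22_cases; simp add: det2_def mat22_mat mat22_uminus mat22_zero)+

lemma mat_1_neq_0 [simp]: "(mat 1 :: 'a::field mat2) \<noteq> 0" "(0 :: 'a::field mat2) \<noteq> mat 1"
  by (simp_all add: mat22_simps)

lemma xi_xi: "xi t ** xi t = mat 1"
  by (simp add: mat22_simps)

lemma matrix_inv_eq:
  fixes A :: "'a::field^'n^'n"
  assumes "A ** B = mat 1"
  shows "matrix_inv A = B"
proof -
  have "B ** A = mat 1" using assms by (simp add: matrix_left_right_inverse)
  then have "A ** matrix_inv A = mat 1 \<and> matrix_inv A ** A = mat 1"
    unfolding matrix_inv_def using assms by (intro someI[of "\<lambda>X. A ** X = mat 1 \<and> X ** A = mat 1" B]) simp
  then show ?thesis using \<open>B ** A = mat 1\<close> by (metis matrix_mul_assoc matrix_mul_lid matrix_mul_rid)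
qed

lemma lconj_eq: "lconj t X = xi t ** X ** xi t"
  by (simp add: lconj_def matrix_inv_eq[OF xi_xi])

lemma lconj_simps [simp]:
  "lconj t (X + Y) = lconj t X + lconj t Y" "lconj t (X - Y) = lconj t X - lconj t Y"
  "lconj t (- X) = - lconj t X" "lconj t (mat r) = mat r" "lconj t 0 = 0" "lconj t (lconj t X) = X"
  "lconj t (mscale r X) = mscale r (lconj t X)"
proof -
  have "lconj t (lconj t X) = (xi t ** xi t) ** X ** (xi t ** xi t)"
    by (simp only: lconj_eq matrix_mul_assoc)
  then show "lconj t (lconj t X) = X" by (simp add: xi_xi)
  have "lconj t (mat r) = mscale r (xi t ** xi t)"
    by (simp add: lconj_eq matrix_mult_mat matrix_mscale_mult)
  then show "lconj t (mat r) = mat r" using matrix_mult_mat(1)[of r "mat 1 :: 'a mat2"] by (simp add: xi_xi)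
qed (simp_all add: lconj_eq matrix_ring_simps matrix_mul_assoc)

lemma lconj_mult: "lconj t (X ** Y) = lconj t X ** lconj t Y"
proof -
  have "lconj t X ** lconj t Y = xi t ** X ** (xi t ** xi t) ** Y ** xi t"
    by (simp only: lconj_eq matrix_mul_assoc)
  also have "\<dots> = lconj t (X ** Y)" by (simp add: xi_xi) (simp add: lconj_eq matrix_mul_assoc)
  finally show ?thesis by (rule sym)
qed

lemma xi_imat: "xi t ** imat ** transpose (xi t) = - imat"
  by (simp_all add: mat22_simps)

locale quadratic =
  fixes t d :: "'k::field"
  assumes two_t: "2 * t = 0"
    and irred: "irreducible [:d, t, 1:]"
begin

abbreviation L where "L \<equiv> LL t d"

text \<open>This is x + y omega with omega = \<open>el 0 1\<close>. One has omega^2 = t omega - d,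
  and since -t = t, omega is a root of X^2 + tX + d.\<close>

definition el :: "'k \<Rightarrow> 'k \<Rightarrow> 'k mat2" where
  "el x y = mat22 x (- (y * d)) y (x + y * t)"

lemma t_simps: "t + t = 0" "- t = t" "x * t + x * t = 0" "- (x * t) = x * t" "- (t * x) = t * x"
proof -
  show tt: "t + t = 0" using two_t unfolding mult_2 .
  show mt: "- t = t" by (rule minus_unique[OF tt])
  have "- (x * t) = x * (- t)" "- (t * x) = (- t) * x" by simp_all
  then show "- (x * t) = x * t" "- (t * x) = t * x" by (simp_all only: mt)
  have "x * t + x * t = x * (t + t)" by (rule distrib_left[symmetric])
  then show "x * t + x * t = 0" by (simp only: tt mult_zero_right)
qed

lemma two_t_mult: "t * (x * 2) = 0" "t * (t * (x * 2)) = 0" "x * (t * 2) = 0" "t * 2 = 0"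
  using two_t by (auto simp: ac_simps)

text \<open>A root would split off a linear factor, and the cofactor would be linear as well, so
  neither is a unit. Irreducibility enters the further arguments only in this form.\<close>

lemma no_root: "x * x + t * x + d \<noteq> 0"
proof
  assume "x * x + t * x + d = 0"
  then have "poly [:d, t, 1:] x = 0" by (simp add: algebra_simps)
  then have "[:- x, 1:] dvd [:d, t, 1:]" unfolding poly_eq_0_iff_dvd .
  then obtain q where q: "[:d, t, 1:] = [:- x, 1:] * q" by (rule dvdE)
  then have q0: "q \<noteq> 0" by auto
  then have "degree [:d, t, 1:] = degree [:- x, 1:] + degree q" unfolding q by (intro degree_mult_eq) auto
  then have "degree q = 1" by simp
  then have "\<not> is_unit q" "\<not> is_unit [:- x, 1:]" by (auto simp: is_unit_iff_degree q0)
  then show False using irreducibleD[OF irred q] by blast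
qed

text \<open>After division by y^2 the form is the value of the polynomial at x/y. This is anisotropy
  of the norm form of L/K.\<close>

lemma norm_form_eq_0: "x * x + t * x * y + d * y * y = 0 \<longleftrightarrow> x = 0 \<and> y = 0"
proof (cases "y = 0")
  case False
  then have "x * x + t * x * y + d * y * y = ((x / y) * (x / y) + t * (x / y) + d) * (y * y)"
    by (simp add: field_simps)
  then show ?thesis using no_root[of "x / y"] False by simp
qed simp

lemma d_nonzero: "d \<noteq> 0"
  using no_root[of 0] by simp

lemma LL_iff: "X \<in> L \<longleftrightarrow> (\<exists>x y. X = el x y)"
  by (auto simp: LL_def el_def)

lemma LL_cases: assumes "X \<in> L" obtains x y where "X = el x y"
  using assms by (auto simp: LL_iff)

lemma el_in_LL [simp]: "el x y \<in> L"
  by (auto simp: LL_iff)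

lemma el_eq_iff: "el x y = el x' y' \<longleftrightarrow> x = x' \<and> y = y'"
  by (auto simp: el_def mat22_eq_iff)

lemma el_mult: "el x y ** el x' y' = el (x * x' - d * y * y') (x * y' + y * x' + t * y * y')"
  by (simp add: el_def mat22_mult mat22_eq_iff algebra_simps)

lemma el_add: "el x y + el x' y' = el (x + x') (y + y')"
  by (simp add: el_def mat22_add mat22_eq_iff algebra_simps)

lemma el_diff: "el x y - el x' y' = el (x - x') (y - y')"
  by (simp add: el_def mat22_diff mat22_eq_iff algebra_simps)

lemma el_uminus: "- el x y = el (- x) (- y)"
  by (simp add: el_def mat22_uminus mat22_eq_iff algebra_simps)

lemma el_mscale: "mscale r (el x y) = el (r * x) (r * y)"
  by (simp add: el_def mat22_mscale mat22_eq_iff algebra_simps)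

lemma el_mat: "mat r = el r 0"
  by (simp add: el_def mat22_mat)

lemma el_zero: "0 = el 0 0"
  by (simp add: el_def mat22_zero)

text \<open>Conjugation by xi sends omega to t - omega, the other root of the polynomial.\<close>

lemma el_lconj: "lconj t (el x y) = el (x + t * y) (- y)"
  by (simp add: el_def lconj_eq xi_def mat22_mult mat22_eq_iff algebra_simps t_simps two_t_mult)

lemma el_det2: "det2 (el x y) = x * x + t * x * y + d * y * y"
  by (simp add: el_def algebra_simps)

lemmas el_simps = el_mult el_add el_diff el_uminus el_mscale el_mat el_zero el_lconj el_det2 el_eq_iff

lemma LL_closed [simp]:
  "A \<in> L \<Longrightarrow> B \<in> L \<Longrightarrow> A ** B \<in> L" "A \<in> L \<Longrightarrow> B \<in> L \<Longrightarrow> A + B \<in> L" "A \<in> L \<Longrightarrow> B \<in> L \<Longrightarrow> A - B \<in> L"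
  "A \<in> L \<Longrightarrow> - A \<in> L" "A \<in> L \<Longrightarrow> lconj t A \<in> L" "A \<in> L \<Longrightarrow> mscale r A \<in> L" "mat r \<in> L" "0 \<in> L"
  by (auto simp: LL_iff el_simps)

lemma LL_commute: "A \<in> L \<Longrightarrow> B \<in> L \<Longrightarrow> A ** B = B ** A"
  by (auto simp: LL_iff el_simps algebra_simps)

lemma LL_left_commute: "A \<in> L \<Longrightarrow> B \<in> L \<Longrightarrow> A ** (B ** C) = B ** (A ** C)"
  by (metis LL_commute matrix_mul_assoc)

lemmas LL_ac = matrix_mul_assoc[symmetric] LL_commute LL_left_commute

text \<open>The norm of L/K is the determinant of the 2x2 matrix; from here on \<open>det2\<close>
  stands for the norm on L.\<close>

lemma lconj_mult_self: "A \<in> L \<Longrightarrow> lconj t A ** A = mat (det2 A)"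
  by (auto simp: LL_iff el_simps algebra_simps t_simps two_t_mult)

lemma det2_eq_0_iff: "A \<in> L \<Longrightarrow> det2 A = 0 \<longleftrightarrow> A = 0"
  by (auto simp: LL_iff el_simps norm_form_eq_0)

lemma LL_inverse:
  assumes "A \<in> L" "A \<noteq> 0"
  obtains B where "B \<in> L" "A ** B = mat 1" "B ** A = mat 1" "B \<noteq> 0"
proof -
  define B where "B = mscale (1 / det2 A) (lconj t A)"
  have n: "det2 A \<noteq> 0" using assms by (simp add: det2_eq_0_iff)
  have B: "B \<in> L" using assms by (simp add: B_def)
  have BA: "B ** A = mat 1"
    using n assms(1) by (simp add: B_def matrix_mscale_mult lconj_mult_self) (simp add: el_simps)
  then have "B \<noteq> 0" by auto
  then show thesis using that[OF B] BA LL_commute[OF assms(1) B] by simp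
qed

lemma LL_mult_eq_0_iff: "A \<in> L \<Longrightarrow> B \<in> L \<Longrightarrow> A ** B = 0 \<longleftrightarrow> A = 0 \<or> B = 0"
  using det2_eq_0_iff[of "A ** B"] det2_eq_0_iff[of A] det2_eq_0_iff[of B] by (auto simp: det2_mult)

text \<open>For every 2x2 matrix A the matrix i A' i^-1 is the adjugate of A, and on L the adjugate
  is the conjugate.\<close>

lemma imat_transpose: "A \<in> L \<Longrightarrow> imat ** transpose A = lconj t A ** imat"
  by (auto simp: LL_iff el_lconj) (simp add: el_def mat22_simps algebra_simps t_simps two_t_mult)

text \<open>Since delta is symmetric, this is the symmetry of A delta; it is what makes the matrices
  in \<open>PL\<close> alternating.\<close>

lemma delta_transpose: "A \<in> L \<Longrightarrow> delta d ** transpose A = A ** delta d"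
  by (auto simp: LL_iff) (simp add: el_def mat22_simps algebra_simps t_simps two_t_mult)

lemma transpose_LL_delta: "A \<in> L \<Longrightarrow> transpose (A ** delta d) = A ** delta d"
  using delta_transpose[of A] by (simp add: matrix_transpose_mul) (simp add: mat22_simps)

text \<open>The matrix omega is a companion matrix, so its centralizer consists of the polynomials
  in omega, that is, of L.\<close>

lemma commute_imp_LL:
  assumes "A ** el 0 1 = el 0 1 ** A"
  shows "A \<in> L"
proof -
  have "A$1$2 = - (A$2$1 * d)" "A$2$2 = A$1$1 + A$2$1 * t"
    using assms by (cases A rule: mat22_cases; simp add: el_def mat22_mult mat22_eq_iff algebra_simps)+
  then have "A = el (A$1$1) (A$2$1)" by (simp add: el_def vec_eq_iff forall_2)
  then show ?thesis by (metis el_in_LL)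
qed

section \<open>The group \<open>GL\<^sub>2(\<bbbL>)\<close>\<close>

text \<open>Multiplication by the scalar omega on L^2. The block matrices over L form its
  centralizer, which yields closure under products without computing entries.\<close>

definition J4 :: "'k mat4" where "J4 = block (el 0 1) 0 0 (el 0 1)"

lemma commutes_J4_iff: "block A B C D ** J4 = J4 ** block A B C D \<longleftrightarrow> A \<in> L \<and> B \<in> L \<and> C \<in> L \<and> D \<in> L"
  by (auto simp: J4_def block_simps intro: commute_imp_LL LL_commute)

lemma mats_over_L_iff: "g \<in> mats_over_L t d \<longleftrightarrow> g ** J4 = J4 ** g"
  by (cases g rule: block_cases) (auto simp: mats_over_L_def commutes_J4_iff block_eq_iff)

lemma block_mats_over_L: "block A B C D \<in> mats_over_L t d \<longleftrightarrow> A \<in> L \<and> B \<in> L \<and> C \<in> L \<and> D \<in> L"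
  by (simp add: mats_over_L_iff commutes_J4_iff)

lemma mats_over_L_mult: "g \<in> mats_over_L t d \<Longrightarrow> h \<in> mats_over_L t d \<Longrightarrow> g ** h \<in> mats_over_L t d"
  unfolding mats_over_L_iff by (metis matrix_mul_assoc)

lemma one_mats_over_L [simp]: "mat 1 \<in> mats_over_L t d"
  by (simp add: mats_over_L_iff)

lemma det_L_block: "det_L (block A B C D) = A ** D - B ** C"
  by (simp add: det_L_def)

lemma det_L_in_LL: "g \<in> mats_over_L t d \<Longrightarrow> det_L g \<in> L"
  by (auto simp: mats_over_L_def det_L_block)

lemma det_L_mult:
  assumes "g \<in> mats_over_L t d" "h \<in> mats_over_L t d"
  shows "det_L (g ** h) = det_L g ** det_L h"
proof -
  obtain A B C D where g: "g = block A B C D" "A \<in> L" "B \<in> L" "C \<in> L" "D \<in> L"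
    using assms(1) by (auto simp: mats_over_L_def)
  obtain A' B' C' D' where h: "h = block A' B' C' D'" "A' \<in> L" "B' \<in> L" "C' \<in> L" "D' \<in> L"
    using assms(2) by (auto simp: mats_over_L_def)
  show ?thesis
    using g(2-) h(2-) by (simp add: g(1) h(1) block_mult det_L_block matrix_ring_simps LL_ac)
qed

lemma GL2L_iff: "g \<in> GL2L t d \<longleftrightarrow> g \<in> mats_over_L t d \<and> det_L g \<noteq> 0"
  by (cases g rule: block_cases) (auto simp: GL2L_def mats_over_L_def block_eq_iff det_L_block)

lemma SL2L_iff: "g \<in> SL2L t d \<longleftrightarrow> g \<in> mats_over_L t d \<and> det_L g = mat 1"
  by (cases g rule: block_cases) (auto simp: SL2L_def mats_over_L_def block_eq_iff det_L_block)

lemma det_L_one [simp]: "det_L (mat 1 :: 'k mat4) = mat 1"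
  by (simp add: block_mat det_L_block)

lemma GL2L_inverse:
  assumes "g \<in> GL2L t d"
  obtains h where "h \<in> GL2L t d" "g ** h = mat 1" "h ** g = mat 1"
proof -
  obtain A B C D where g: "g = block A B C D" and L: "A \<in> L" "B \<in> L" "C \<in> L" "D \<in> L" and n: "A ** D - B ** C \<noteq> 0"
    using assms by (auto simp: GL2L_def)
  obtain I where I: "I \<in> L" "I ** (A ** D - B ** C) = mat 1"
    using LL_inverse[OF _ n] L by (metis LL_closed(1,3))
  define h where "h = block (I ** D) (- (I ** B)) (- (I ** C)) (I ** A)"
  have h: "h \<in> mats_over_L t d" using L I by (simp add: h_def block_mats_over_L)
  have "A ** (I ** D) - B ** (I ** C) = mat 1" "D ** (I ** A) - C ** (I ** B) = mat 1"
    using L I(2) I(1) by (simp_all add: matrix_diff_ldistrib LL_ac)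
  then have gh: "g ** h = mat 1"
    using L I(1) by (simp add: g h_def block_simps LL_ac)
  have "g \<in> mats_over_L t d" using assms by (simp add: GL2L_iff)
  then have "det_L g ** det_L h = mat 1" using det_L_mult[OF _ h, of g] gh by simp
  then have "det_L h \<noteq> 0" by auto
  then show thesis using that[of h] h gh by (simp add: GL2L_iff matrix_left_right_inverse)
qed

lemma GL2L_subgroup: "subgroup (GL2L t d) GL"
proof (rule subgroup_GLI)
  show "mat 1 \<in> GL2L t d" by (simp add: GL2L_iff)
  fix M N assume "M \<in> GL2L t d" "N \<in> GL2L t d"
  then show "M ** N \<in> GL2L t d"
    by (simp add: GL2L_iff mats_over_L_mult det_L_mult LL_mult_eq_0_iff det_L_in_LL)
next
  fix M assume "M \<in> GL2L t d" then show "\<exists>N\<in>GL2L t d. M ** N = mat 1" using GL2L_inverse by blast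
qed

lemma SL2L_subset: "SL2L t d \<subseteq> GL2L t d"
  by (auto simp: SL2L_iff GL2L_iff)

lemma SL2L_subgroup: "subgroup (SL2L t d) GL"
proof (rule subgroup_GLI)
  fix M assume M: "M \<in> SL2L t d"
  then obtain N where N: "N \<in> GL2L t d" "M ** N = mat 1" using SL2L_subset GL2L_inverse by blast
  have "det_L (M ** N) = det_L M ** det_L N"
    using M N(1) by (intro det_L_mult) (simp_all add: SL2L_iff GL2L_iff)
  moreover have "det_L M = mat 1" using M by (simp add: SL2L_iff)
  ultimately have "det_L N = mat 1" by (simp add: N(2))
  then show "\<exists>N\<in>SL2L t d. M ** N = mat 1" using N by (intro bexI[of _ N]) (simp_all add: SL2L_iff GL2L_iff)
next
  show "mat 1 \<in> SL2L t d" by (simp add: SL2L_iff)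
next
  fix M N assume "M \<in> SL2L t d" "N \<in> SL2L t d"
  then show "M ** N \<in> SL2L t d" by (simp add: SL2L_iff mats_over_L_mult det_L_mult)
qed

text \<open>The product of g with its adjugate over L is the L-determinant times the identity. If
  the determinant were zero, cancelling g would make the adjugate zero, hence g itself.\<close>

lemma invertible_commutes_J4:
  assumes "invertible g" "g ** J4 = J4 ** g"
  shows "g \<in> GL2L t d"
proof -
  obtain A B C D where g: "g = block A B C D" by (rule block_cases)
  then have L: "A \<in> L" "B \<in> L" "C \<in> L" "D \<in> L" using assms(2) unfolding g commutes_J4_iff by blast+
  have "A ** D - B ** C \<noteq> 0"
  proof
    assume z: "A ** D - B ** C = 0"
    have "g ** block D (- B) (- C) A = block (A ** D - B ** C) 0 0 (A ** D - B ** C)"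
      using L by (simp add: g block_simps LL_ac)
    then have "g ** block D (- B) (- C) A = 0" using z by (simp add: block_zero)
    moreover obtain h where h: "h ** g = mat 1" using assms(1) by (auto simp: invertible_def)
    have "block D (- B) (- C) A = h ** (g ** block D (- B) (- C) A)"
      by (simp add: matrix_mul_assoc h)
    ultimately have "block D (- B) (- C) A = 0" by simp
    then have "g = 0" by (simp add: g block_zero block_eq_iff)
    then have "(mat 1 :: 'k mat4) = 0" using h by simp
    then show False by (simp add: block_simps mat22_simps)
  qed
  then show ?thesis unfolding g GL2L_iff det_L_block block_mats_over_L using L by blast
qed

end

section \<open>Stabilizers of orthogonal spaces, and the involution Xi\<close>

lemma skew_coeff_symmetric: "transpose W = W \<Longrightarrow> skew_coeff W = 0"
proof -
  assume W: "transpose W = W"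
  have "transpose W $ 1 $ 2 = W $ 2 $ 1" by (simp add: transpose_def)
  then show "skew_coeff W = 0" unfolding W skew_coeff_def by simp
qed

text \<open>M multiplies the polar form by a constant, and every Y in \<open>U\<close> is the image
  of some Z in \<open>U\<close>; so orthogonality to Z is carried over to Y.\<close>

lemma perp_act:
  assumes M: "invertible M" and U: "U \<subseteq> Lam" "act M ` U = U" and X: "X \<in> perp U"
  shows "act M X \<in> perp U"
proof -
  obtain c where c: "\<forall>X\<in>Lam. \<forall>Y\<in>Lam. pf_polar (act M X) (act M Y) = c * pf_polar X Y"
    using pf_polar_act by blast
  have "pf_polar (act M X) Y = 0" if "Y \<in> U" for Y
  proof -
    have "Y \<in> act M ` U" unfolding U(2) by (rule that)
    then obtain Z where Z: "Z \<in> U" "Y = act M Z" by blast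
    have "X \<in> Lam" "Z \<in> Lam" "pf_polar X Z = 0" using X U(1) Z(1) unfolding perp_def by blast+
    then show ?thesis using c by (simp add: Z(2))
  qed
  moreover have "act M X \<in> Lam" using X unfolding perp_def by (blast intro: act_Lam)
  ultimately show ?thesis unfolding perp_def by blast
qed

lemma stab_perp:
  assumes "U \<subseteq> Lam"
  shows "GL4_stab U \<subseteq> GL4_stab (perp U)"
proof (rule subset_stabI[OF stab_subgroup])
  fix M X assume "M \<in> GL4_stab U" "X \<in> perp U"
  then show "act M X \<in> perp U" using perp_act[OF _ assms] by (simp add: GL4_stab_def)
qed

lemma ksubspace_alt_matI:
  assumes sub: "U \<subseteq> Lam" and zero: "alt_mat 0 0 0 \<in> U"
    and add: "\<And>x Y z x' Y' z'. alt_mat x Y z \<in> U \<Longrightarrow> alt_mat x' Y' z' \<in> U \<Longrightarrow> alt_mat (x + x') (Y + Y') (z + z') \<in> U"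
    and scale: "\<And>r x Y z. alt_mat x Y z \<in> U \<Longrightarrow> alt_mat (r * x) (mscale r Y) (r * z) \<in> U"
  shows "ksubspace U"
  unfolding ksubspace_def
proof (intro conjI ballI allI)
  show "0 \<in> U" using zero by (simp add: alt_mat_linear)
  fix X assume X: "X \<in> U"
  then obtain x A z where Xb: "X = alt_mat x A z" using sub Lam_iff by blast
  show "mscale r X \<in> U" for r using scale X by (simp add: Xb alt_mat_linear)
  fix Y assume Y: "Y \<in> U"
  then obtain y B w where "Y = alt_mat y B w" using sub Lam_iff by blast
  then show "X + Y \<in> U" using add X Y by (simp add: Xb alt_mat_linear)
qed

lemma ksubspace_Lam: "ksubspace Lam"
  by (rule ksubspace_alt_matI) simp_all

lemma Xi_simps: "Xi t ** Xi t = mat 1" "act (Xi t) (alt_mat x Y z) = alt_mat (- x) (xi t ** Y ** transpose (xi t)) (- z)"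
proof -
  have "det2 (xi t) = - 1" by (simp add: xi_def)
  then show "act (Xi t) (alt_mat x Y z) = alt_mat (- x) (xi t ** Y ** transpose (xi t)) (- z)"
    unfolding Xi_def act_alt_mat by (simp add: skew_coeff_def)
qed (simp add: Xi_def block_simps xi_xi)

lemma generate_Xi: "generate GL {Xi t} = {mat 1, Xi t :: 'a::field mat4}"
proof
  have Xi: "subgroup {mat 1, Xi t :: 'a mat4} GL"
    by (rule subgroup_GLI) (auto simp: Xi_simps)
  then show "generate GL {Xi t} \<subseteq> {mat 1, Xi t :: 'a mat4}"
    by (rule group.generate_subgroup_incl[OF group_GL, rotated]) simp
  show "{mat 1, Xi t :: 'a mat4} \<subseteq> generate GL {Xi t}"
    using generate.one[of "GL :: 'a mat4 monoid"] by (auto intro: generate.incl)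
qed

text \<open>As Xi is an involution, H<Xi> is the union of H and H Xi.\<close>

lemma times_Xi_iff: "M \<in> times_Xi t H \<longleftrightarrow> M \<in> H \<or> (\<exists>N\<in>H. M = N ** Xi t)"
  unfolding times_Xi_def generate_Xi set_mult_def by auto

context quadratic
begin

section \<open>The subspaces and their stabilizers\<close>

text \<open>The two coordinate maps \<open>fP\<close> and \<open>fQ\<close> have the kernels \<open>\<bbbL>\<delta>\<close> and \<open>\<bbbL>i\<close>.\<close>

definition fP :: "'k mat2 \<Rightarrow> 'k^2" where
  "fP Y = vector [Y$1$1 + d * Y$2$2 + t * Y$1$2, Y$2$1 - Y$1$2]"

definition fQ :: "'k mat2 \<Rightarrow> 'k^2" where
  "fQ Y = vector [Y$1$1 - d * Y$2$2, Y$1$2 + Y$2$1 + t * Y$2$2]"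

definition E11 :: "'k mat2" where "E11 = mat22 1 0 0 0"

lemma fP_linear: "fP (X + Y) = fP X + fP Y" "fP (X - Y) = fP X - fP Y" "fP (mscale r Y) = r *s fP Y" "fP 0 = 0" "fP (- Y) = - fP Y"
  by (simp_all add: fP_def vec_eq_iff forall_2 algebra_simps)

lemma fQ_linear: "fQ (X + Y) = fQ X + fQ Y" "fQ (X - Y) = fQ X - fQ Y" "fQ (mscale r Y) = r *s fQ Y" "fQ 0 = 0" "fQ (- Y) = - fQ Y"
  by (simp_all add: fQ_def vec_eq_iff forall_2 algebra_simps)

text \<open>L acts on K^2 by matrix-vector multiplication, which makes K^2 a one-dimensional
  L-space. Thus \<open>fP\<close> identifies the quotient of all 2x2 matrices by L delta with K^2 as
  L-spaces.\<close>

lemma fP_LL_mult: "A \<in> L \<Longrightarrow> fP (A ** Y) = A *v fP Y"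
  by (cases Y rule: mat22_cases, auto simp: LL_iff)
    (simp add: fP_def el_def mat22_mult mat22_mult_vec vec2_eq_iff algebra_simps t_simps two_t_mult)

lemma fQ_LL_mult: "A \<in> L \<Longrightarrow> fQ (A ** Y) = A *v fQ Y"
  by (cases Y rule: mat22_cases, auto simp: LL_iff)
    (simp add: fQ_def el_def mat22_mult mat22_mult_vec vec2_eq_iff algebra_simps t_simps two_t_mult)

text \<open>In the separable case the 2x2 matrices are the sum of L i and L delta. Right
  multiplication by A' preserves L i because i A' = conj(A) i, and it is left multiplication by A on
  L delta because delta A' = A delta. The direct computation covers the inseparable case as
  well.\<close>

lemma fQ_LL_mult_transpose: "A \<in> L \<Longrightarrow> fQ (Y ** transpose A) = A *v fQ Y"
  by (cases Y rule: mat22_cases, auto simp: LL_iff)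
    (simp add: fQ_def el_def mat22_mult mat22_transpose mat22_mult_vec vec2_eq_iff algebra_simps t_simps two_t_mult)

lemma fQ_el_E11: "fQ (el x y ** E11) = vector [x, y]"
  by (simp add: fQ_def el_def E11_def mat22_mult)

lemma fP_eq_0_iff: "fP Y = 0 \<longleftrightarrow> (\<exists>X\<in>L. Y = X ** delta d)"
proof
  assume "fP Y = 0"
  moreover obtain a b c e where Y: "Y = mat22 a b c e" by (rule mat22_cases)
  ultimately have c: "c = b" and a: "a = - (d * e) - t * b"
    by (simp_all add: fP_def vec_eq_iff forall_2 eq_neg_iff_add_eq_0 algebra_simps)
  \<comment> \<open>The two coordinates are read off the second column of Y = X delta.\<close>
  have "Y = el (- e - b / d * t) (b / d) ** delta d"
    unfolding Y c a by (simp add: el_def mat22_simps d_nonzero field_simps)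
  then show "\<exists>X\<in>L. Y = X ** delta d" by (metis el_in_LL)
next
  assume "\<exists>X\<in>L. Y = X ** delta d"
  then show "fP Y = 0"
    by (auto simp: LL_iff) (simp add: el_def delta_def mat22_mult fP_def vec_eq_iff forall_2 algebra_simps)
qed

lemma fQ_eq_0_iff: "fQ Y = 0 \<longleftrightarrow> (\<exists>X\<in>L. Y = X ** imat)"
proof
  assume "fQ Y = 0"
  moreover obtain a b c e where Y: "Y = mat22 a b c e" by (rule mat22_cases)
  ultimately have "a = d * e" "c = - b - t * e"
    by (simp_all add: fQ_def vec_eq_iff forall_2 eq_neg_iff_add_eq_0 algebra_simps)
  then have "Y = el b e ** imat"
    by (simp add: Y el_def mat22_simps algebra_simps)
  then show "\<exists>X\<in>L. Y = X ** imat" by (metis el_in_LL)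
next
  assume "\<exists>X\<in>L. Y = X ** imat"
  then show "fQ Y = 0"
    by (auto simp: LL_iff) (simp add: el_def imat_def mat22_mult fQ_def vec_eq_iff forall_2 algebra_simps)
qed

lemma PL_iff_ex: "Z \<in> PL t d \<longleftrightarrow> (\<exists>X\<in>L. Z = alt_mat 0 (X ** delta d) 0)"
  unfolding PL_def alt_mat_def by (auto simp: transpose_LL_delta)

lemma PL_iff: "alt_mat x Y z \<in> PL t d \<longleftrightarrow> x = 0 \<and> z = 0 \<and> fP Y = 0"
  by (auto simp: PL_iff_ex alt_mat_eq_iff fP_eq_0_iff)

lemma PL_subset_Lam: "PL t d \<subseteq> Lam"
  by (auto simp: PL_iff_ex)

lemma ksubspace_PL: "ksubspace (PL t d)"
  by (rule ksubspace_alt_matI[OF PL_subset_Lam]) (auto simp: PL_iff fP_linear)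

lemma sbas_alt_mat:
  "sbas 0 1 = alt_mat 1 0 (0::'k)" "sbas 2 3 = alt_mat 0 0 (1::'k)" "sbas 0 2 = alt_mat 0 E11 0"
  "sbas 0 2 + sbas 1 3 = alt_mat 0 (mat 1) (0::'k)"
  by (simp_all add: vec_eq_iff forall_index4 forall_2 sbas_def bvec_def axis_def alt_mat_def block_nth imat_def
      transpose_def mat_def E11_def)

lemma PL0_iff_ex: "Z \<in> PL0 t d \<longleftrightarrow> (\<exists>x. \<exists>X\<in>L. Z = alt_mat x (X ** delta d) 0)"
proof -
  have sum: "alt_mat 0 (X ** delta d) 0 + mscale x (sbas 0 1) = alt_mat x (X ** delta d) (0::'k)" for x X
    by (simp add: sbas_alt_mat alt_mat_linear)
  show ?thesis
  proof
    assume "Z \<in> PL0 t d"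
    then obtain W x where W: "W \<in> PL t d" "Z = W + mscale x (sbas 0 1)"
      by (auto simp: PL0_def set_plus_def)
    obtain X where "X \<in> L" "W = alt_mat 0 (X ** delta d) 0" using W(1) unfolding PL_iff_ex by blast
    then show "\<exists>x. \<exists>X\<in>L. Z = alt_mat x (X ** delta d) 0" using W(2) sum by blast
  next
    assume "\<exists>x. \<exists>X\<in>L. Z = alt_mat x (X ** delta d) 0"
    then obtain x X where X: "X \<in> L" "Z = alt_mat x (X ** delta d) 0" by blast
    have "alt_mat 0 (X ** delta d) 0 \<in> PL t d" using X(1) unfolding PL_iff_ex by blast
    then show "Z \<in> PL0 t d"
      unfolding X(2) sum[of X x, symmetric] PL0_def by (intro set_plus_intro) auto
  qed
qed

lemma PL0_iff: "alt_mat x Y z \<in> PL0 t d \<longleftrightarrow> z = 0 \<and> fP Y = 0"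
  by (auto simp: PL0_iff_ex alt_mat_eq_iff fP_eq_0_iff)

lemma PL0_subset_Lam: "PL0 t d \<subseteq> Lam"
  by (auto simp: PL0_iff_ex)

lemma ksubspace_PL0: "ksubspace (PL0 t d)"
  by (rule ksubspace_alt_matI[OF PL0_subset_Lam]) (auto simp: PL0_iff fP_linear)

lemma perp_PL_iff: "alt_mat x Y z \<in> perp (PL t d) \<longleftrightarrow> fQ Y = 0"
proof -
  obtain a b c e where Y: "Y = mat22 a b c e" by (rule mat22_cases)
  \<comment> \<open>The coefficient of u is the first coordinate of \<open>fQ Y\<close>; that of v
    is t times the first plus d times the second. As d is nonzero, both vanish exactly if
    \<open>fQ Y\<close> does.\<close>
  have pol: "pf_polar (alt_mat x Y z) (alt_mat 0 (el u v ** delta d) 0) =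
      u * (a - d * e) + v * (t * (a - d * e) + d * (b + c + t * e))" for u v
    using two_t by (simp add: pf_polar_alt_mat Y el_def delta_def mat22_mult algebra_simps)
  have "PL t d = {alt_mat 0 (el u v ** delta d) 0 | u v. True}"
  proof (intro Set.set_eqI iffI)
    fix Z assume "Z \<in> PL t d"
    then obtain X where "X \<in> L" "Z = alt_mat 0 (X ** delta d) 0" unfolding PL_iff_ex by blast
    then show "Z \<in> {alt_mat 0 (el u v ** delta d) 0 | u v. True}" unfolding LL_iff by blast
  next
    fix Z assume "Z \<in> {alt_mat 0 (el u v ** delta d) 0 | u v. True}"
    then show "Z \<in> PL t d" unfolding PL_iff_ex using el_in_LL by blast
  qed
  then have "alt_mat x Y z \<in> perp (PL t d) \<longleftrightarrow> (\<forall>u v. u * (a - d * e) + v * (t * (a - d * e) + d * (b + c + t * e)) = 0)"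
    by (auto simp: perp_def pol[symmetric])
  also have "\<dots> \<longleftrightarrow> a - d * e = 0 \<and> b + c + t * e = 0"
  proof (intro iffI allI)
    assume *: "\<forall>u v. u * (a - d * e) + v * (t * (a - d * e) + d * (b + c + t * e)) = 0"
    have "a - d * e = 0" using *[rule_format, of 1 0] by simp
    moreover have "t * (a - d * e) + d * (b + c + t * e) = 0" using *[rule_format, of 0 1] by simp
    ultimately show "a - d * e = 0 \<and> b + c + t * e = 0" using d_nonzero by simp
  qed simp
  also have "\<dots> \<longleftrightarrow> fQ Y = 0" by (simp add: Y fQ_def vec_eq_iff forall_2)
  finally show ?thesis .
qed

lemma perp_subset_Lam: "perp U \<subseteq> Lam"
  by (auto simp: perp_def)

lemma ksubspace_perp_PL: "ksubspace (perp (PL t d))"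
  by (rule ksubspace_alt_matI[OF perp_subset_Lam]) (auto simp: perp_PL_iff fQ_linear)

text \<open>For the harder inclusion Z is tested against four elements of the orthogonal space: s23,
  s01 and those with upper right block i and omega i.\<close>

lemma perp_perp_PL: "perp (perp (PL t d)) = PL t d"
proof
  show "PL t d \<subseteq> perp (perp (PL t d))"
    using PL_subset_Lam by (auto simp: perp_def pf_polar_commute)
  show "perp (perp (PL t d)) \<subseteq> PL t d"
  proof
    fix Z assume Z: "Z \<in> perp (perp (PL t d))"
    then obtain x Y z where Zeq: "Z = alt_mat x Y z" by (auto simp: perp_def Lam_iff)
    obtain a b c e where Y: "Y = mat22 a b c e" by (rule mat22_cases)
    have pol: "pf_polar Z (alt_mat u (el p q ** imat) v) = 0" for u p q v
    proof -
      have "fQ (el p q ** imat) = 0" by (auto simp: fQ_eq_0_iff)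
      then show ?thesis using Z by (auto simp: perp_def[of "perp _"] perp_PL_iff)
    qed
    have "x = 0" using pol[of 0 0 0 1] by (simp add: Zeq pf_polar_alt_mat el_def mat22_simps)
    moreover have "z = 0" using pol[of 1 0 0 0] by (simp add: Zeq pf_polar_alt_mat el_def mat22_simps)
    moreover have "b = c" using pol[of 0 1 0 0]
      by (simp add: Zeq Y pf_polar_alt_mat el_def imat_def mat22_mult)
    moreover have "a + d * e + t * b = 0"
    proof -
      have "pf_polar Z (alt_mat 0 (el 0 1 ** imat) 0) = - (a + d * e + t * b)"
        by (simp add: Zeq Y pf_polar_alt_mat el_def imat_def mat22_mult algebra_simps)
      then have "- (a + d * e + t * b) = 0" using pol[of 0 0 1 0] by (rule trans[OF sym])
      then show ?thesis by (simp only: neg_equal_0_iff_equal)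
    qed
    ultimately show "Z \<in> PL t d"
      by (simp add: Zeq Y PL_iff fP_def vec_eq_iff forall_2)
  qed
qed

text \<open>A transposed factor from L moves through delta to the left. The off-diagonal block
  becomes (AD - BC) X delta, while matrices of the form A X B delta are symmetric and contribute
  nothing to the diagonal blocks.\<close>

lemma act_PL:
  assumes g: "g \<in> mats_over_L t d" and X: "X \<in> L"
  shows "act g (alt_mat 0 (X ** delta d) 0) = alt_mat 0 (det_L g ** X ** delta d) 0"
proof -
  obtain A B C D where g: "g = block A B C D" and L: "A \<in> L" "B \<in> L" "C \<in> L" "D \<in> L"
    using g by (auto simp: mats_over_L_def)
  have "skew_coeff (A ** (X ** delta d) ** transpose B) = 0" if "A \<in> L" "B \<in> L" for A B
  proof -
    have "A ** (X ** delta d) ** transpose B = A ** X ** B ** delta d"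
      using delta_transpose[OF that(2)] by (simp add: matrix_mul_assoc[symmetric])
    then show ?thesis
      using transpose_LL_delta[of "A ** X ** B"] that X by (simp add: skew_coeff_symmetric)
  qed
  note skew0 = this
  have "A ** (X ** delta d) ** transpose D - B ** transpose (X ** delta d) ** transpose C
      = (A ** D - B ** C) ** X ** delta d"
    using L X by (simp add: transpose_LL_delta delta_transpose matrix_diff_rdistrib LL_ac)
  then show ?thesis
    using L by (simp add: g act_alt_mat alt_mat_eq_iff skew0 det_L_block)
qed

lemma GL2L_stab_PL: "GL2L t d \<subseteq> GL4_stab (PL t d)"
proof (rule subset_stabI[OF GL2L_subgroup])
  fix M X assume "M \<in> GL2L t d" "X \<in> PL t d"
  then show "act M X \<in> PL t d"
    using act_PL det_L_in_LL by (auto simp: PL_iff_ex GL2L_iff intro!: bexI[of _ "det_L M ** _"])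
qed

lemma Xi_PL:
  assumes "X \<in> L"
  shows "\<exists>X'\<in>L. act (Xi t) (alt_mat x (X ** delta d) 0) = alt_mat (- x) (X' ** delta d) 0"
proof -
  \<comment> \<open>The matrix xi delta xi' again lies in L delta. Because xi is an involution, the
    remaining factor xi X xi is the conjugate of X.\<close>
  have "fP (xi t ** delta d ** transpose (xi t)) = 0"
    by (simp add: xi_def delta_def mat22_mult mat22_transpose fP_def vec_eq_iff forall_2)
  then obtain C where C: "C \<in> L" "xi t ** delta d ** transpose (xi t) = C ** delta d"
    by (auto simp: fP_eq_0_iff)
  have "xi t ** (X ** delta d) ** transpose (xi t)
      = (xi t ** X ** xi t) ** (xi t ** delta d ** transpose (xi t))"
  proof -
    have "xi t ** (xi t ** Z) = Z" for Z :: "'k mat2" by (simp add: matrix_mul_assoc xi_xi)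
    then show ?thesis by (simp add: matrix_mul_assoc[symmetric])
  qed
  also have "\<dots> = (lconj t X ** C) ** delta d"
    by (simp only: C lconj_eq matrix_mul_assoc)
  finally show ?thesis
    using C assms by (auto simp: Xi_simps alt_mat_eq_iff intro!: bexI[of _ "lconj t X ** C"])
qed

lemma Xi_inverse_stabI:
  assumes "\<And>X. X \<in> U \<Longrightarrow> act (Xi t) X \<in> U"
  shows "Xi t \<in> GL4_stab U"
proof -
  have "X = act (Xi t) (act (Xi t) X)" for X :: "'k mat4" by (simp add: act_mult[symmetric] Xi_simps)
  then have "U \<subseteq> act (Xi t) ` U" using assms by blast
  then show ?thesis using assms Xi_simps(1)[of t] by (auto simp: GL4_stab_def invertible_def)
qed

lemma Xi_stab_PL: "Xi t \<in> GL4_stab (PL t d)"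
  by (rule Xi_inverse_stabI) (use Xi_PL[of _ 0] in \<open>fastforce simp: PL_iff_ex\<close>)

lemma Xi_J4: "Xi t ** J4 = (mat t - J4) ** Xi t"
  by (simp add: Xi_def J4_def block_simps xi_def el_def mat22_simps algebra_simps t_simps)

text \<open>In the field L the polynomial X^2 - tX + d factors as (X - omega)(X - (t - omega)), and
  one of the factors must vanish at c.\<close>

lemma LL_root_cases:
  assumes "c \<in> L" "c ** c = mscale t c - mat d"
  shows "c = el 0 1 \<or> c = el t (- 1)"
proof -
  have "(c - el 0 1) ** (c - el t (- 1)) = 0"
    using assms by (auto simp: LL_iff) (simp add: el_simps algebra_simps)
  then show ?thesis
    using LL_mult_eq_0_iff[of "c - el 0 1" "c - el t (- 1)"] assms(1) by simp
qed

text \<open>With H the matrix of \<open>delta d\<close>, the elements of P are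
  \<open>dg A ** H\<close> with A in L. If M sends H to \<open>dg a ** H\<close> and J4 H to
  \<open>dg b ** H\<close>, then the unknown factors H M' cancel and M J4 M^-1 = \<open>dg c\<close>
  with c = b a^-1 in L. This c is a root of the same quadratic polynomial as omega, so only two
  values remain.\<close>

lemma stab_PL_commutes:
  assumes M: "M \<in> GL4_stab (PL t d)"
  shows "M ** J4 = J4 ** M \<or> M ** J4 = (mat t - J4) ** M"
proof -
  define dg :: "'k mat2 \<Rightarrow> 'k mat4" where "dg A = block A 0 0 A" for A
  define H where "H = alt_mat 0 (delta d) (0::'k)"
  have dg: "alt_mat 0 (A ** delta d) 0 = dg A ** H" if "A \<in> L" for A
    using transpose_LL_delta[OF that] transpose_LL_delta[of "mat 1"]
    by (simp add: dg_def H_def alt_mat_def block_simps)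
  have dgm: "dg (A ** B) = dg A ** dg B" "dg (A - B) = dg A - dg B" "dg (mat r) = mat r" for A B r
    by (simp_all add: dg_def block_simps)
  obtain M' where M': "M ** M' = mat 1" "M' ** M = mat 1"
    using M by (auto simp: GL4_stab_def invertible_def)
  obtain H' where H': "H ** H' = mat 1"
  proof -
    have "H ** block 0 (mat22 (- 1 / d) 0 0 1) (mat22 (1 / d) 0 0 (- 1)) 0 = mat 1"
      using d_nonzero by (simp add: H_def alt_mat_def delta_def block_simps mat22_simps)
    then show thesis by (rule that)
  qed
  have ex: "\<exists>B\<in>L. M ** (dg A ** H) ** transpose M = dg B ** H" if "A \<in> L" for A
  proof -
    have "dg A ** H \<in> PL t d" unfolding dg[OF that, symmetric] PL_iff_ex using that by blast
    then have "act M (dg A ** H) \<in> PL t d" by (rule stab_act[OF M])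
    then obtain B where "B \<in> L" "act M (dg A ** H) = alt_mat 0 (B ** delta d) 0"
      unfolding PL_iff_ex by blast
    then show ?thesis unfolding act_def using dg by metis
  qed
  obtain a where a: "a \<in> L" "M ** H ** transpose M = dg a ** H"
    using ex[of "mat 1"] by (auto simp: dgm)
  obtain b where b: "b \<in> L" "M ** (dg (el 0 1) ** H) ** transpose M = dg b ** H"
    using ex[of "el 0 1"] by auto
  have J: "dg (el 0 1) = J4" by (simp add: dg_def J4_def)
  have "a \<noteq> 0"
  proof
    assume "a = 0"
    then have "act M H = 0" using a by (simp add: act_def dg_def block_zero[symmetric])
    then have "act M' (act M H) = 0" by (simp add: act_linear)
    then have "H = 0" by (simp add: act_inverse[OF M'(2)])
    then have "(mat 1 :: 'k mat4) = 0" using H' by simp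
    then show False by (simp add: block_mat block_zero block_eq_iff)
  qed
  then obtain a' where a': "a' \<in> L" "a ** a' = mat 1" "a' ** a = mat 1" using LL_inverse[OF a(1)] by blast
  define c where "c = b ** a'"
  have cL: "c \<in> L" using b a' by (simp add: c_def)
  have "dg b ** H = M ** J4 ** (M' ** M) ** H ** transpose M"
    using b(2) by (simp add: M' J matrix_mul_assoc)
  also have "\<dots> = M ** J4 ** M' ** (M ** H ** transpose M)" by (simp add: matrix_mul_assoc)
  also have "\<dots> = M ** J4 ** M' ** dg a ** H" by (simp add: a matrix_mul_assoc)
  finally have "dg b ** (H ** H') = M ** J4 ** M' ** dg a ** (H ** H')" by (simp only: matrix_mul_assoc)
  then have "dg b ** dg a' = M ** J4 ** M' ** dg a ** dg a'" by (simp add: H')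
  also have "\<dots> = M ** J4 ** M' ** (dg a ** dg a')" by (simp add: matrix_mul_assoc)
  also have "dg a ** dg a' = mat 1" by (simp add: dgm[symmetric] a')
  finally have "M ** J4 ** M' = dg c" by (simp add: c_def dgm)
  then have "dg c ** M = M ** J4 ** (M' ** M)" by (simp add: matrix_mul_assoc)
  then have MJ: "M ** J4 = dg c ** M" by (simp add: M')
  \<comment> \<open>The quadratic relation for J4 is transported to c along M J4 =
    \<open>dg c\<close> M.\<close>
  have JJ: "J4 ** J4 = mscale t J4 - mat d"
    by (simp add: J4_def block_simps el_simps)
  have "dg (c ** c) ** M = dg c ** (dg c ** M)" by (simp add: dgm matrix_mul_assoc)
  also have "\<dots> = dg c ** M ** J4" by (simp add: MJ[symmetric] matrix_mul_assoc)
  also have "\<dots> = M ** (J4 ** J4)" by (simp add: MJ[symmetric] matrix_mul_assoc)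
  also have "\<dots> = mscale t (dg c ** M) - mscale d M"
    by (simp add: JJ matrix_diff_ldistrib matrix_mscale_mult matrix_mult_mat MJ)
  also have "\<dots> = dg (mscale t c - mat d) ** M"
    by (simp add: dgm matrix_diff_rdistrib matrix_mult_mat) (simp add: dg_def block_mscale matrix_mscale_mult[symmetric])
  finally have "dg (c ** c) ** (M ** M') = dg (mscale t c - mat d) ** (M ** M')" by (simp add: matrix_mul_assoc)
  then have cc: "c ** c = mscale t c - mat d" by (simp add: M' dg_def block_eq_iff)
  then have "c = el 0 1 \<or> c = el t (- 1)" using LL_root_cases cL by blast
  moreover have "dg (el t (- 1)) = mat t - J4" by (simp add: J[symmetric] dgm[symmetric]) (simp add: el_simps)
  ultimately show ?thesis using MJ J by auto
qed

lemma stab_PL: "GL4_stab (PL t d) = times_Xi t (GL2L t d)"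
proof (intro Set.set_eqI iffI)
  fix M assume M: "M \<in> GL4_stab (PL t d)"
  then have inv: "invertible M" by (simp add: GL4_stab_def)
  from stab_PL_commutes[OF M] show "M \<in> times_Xi t (GL2L t d)"
  proof
    assume "M ** J4 = J4 ** M"
    then show ?thesis using invertible_commutes_J4[OF inv] by (simp add: times_Xi_iff)
  next
    \<comment> \<open>Xi also interchanges omega and t - omega, so M Xi commutes with J4 and hence
      lies in GL_2(L).\<close>
    assume *: "M ** J4 = (mat t - J4) ** M"
    have "(M ** Xi t) ** J4 = M ** ((mat t - J4) ** Xi t)" by (simp add: matrix_mul_assoc[symmetric] Xi_J4)
    also have "\<dots> = (mscale t M - M ** J4) ** Xi t"
      by (simp add: matrix_mul_assoc matrix_diff_ldistrib matrix_mult_mat)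
    also have "mscale t M - M ** J4 = J4 ** M"
      by (simp add: * matrix_diff_rdistrib matrix_mult_mat)
    finally have "(M ** Xi t) ** J4 = J4 ** (M ** Xi t)" by (simp add: matrix_mul_assoc)
    moreover have "invertible (M ** Xi t)"
      using inv Xi_simps(1)[of t] by (intro invertible_mult) (auto simp: invertible_def)
    ultimately have "M ** Xi t \<in> GL2L t d" by (intro invertible_commutes_J4)
    moreover have "M = M ** Xi t ** Xi t" by (simp add: matrix_mul_assoc[symmetric] Xi_simps)
    ultimately show ?thesis by (auto simp: times_Xi_iff)
  qed
next
  fix M assume "M \<in> times_Xi t (GL2L t d)"
  then show "M \<in> GL4_stab (PL t d)"
    using GL2L_stab_PL Xi_stab_PL subgroup.m_closed[OF stab_subgroup, of _ "PL t d" "Xi t"]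
    by (auto simp: times_Xi_iff)
qed

text \<open>Passing to the orthogonal space can only enlarge a stabilizer. Doing so twice leads back
  to \<open>PL\<close>, so both inclusions are equalities.\<close>

lemma stab_perp_PL: "GL4_stab (perp (PL t d)) = times_Xi t (GL2L t d)"
  using stab_perp[OF PL_subset_Lam] stab_perp[OF perp_subset_Lam[of "PL t d"]]
  unfolding perp_perp_PL stab_PL by (rule subset_antisym[rotated])

lemma upper_triangular_subgroup: "subgroup (upper_triangular_group t d) GL"
proof (rule subgroup_GLI)
  fix M assume "M \<in> upper_triangular_group t d"
  then obtain A B D where M: "M = block A B 0 D" and L: "A \<in> L" "D \<in> L" "A \<noteq> 0" "D \<noteq> 0"
    by (auto simp: upper_triangular_group_def)
  obtain A' where A': "A' \<in> L" "A ** A' = mat 1" "A' \<noteq> 0" using LL_inverse[OF L(1,3)] by metis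
  obtain D' where D': "D' \<in> L" "D ** D' = mat 1" "D' \<noteq> 0" using LL_inverse[OF L(2,4)] by metis
  have "M ** block A' (- (A' ** B ** D')) 0 D' = mat 1"
    using A' D' by (simp add: M block_simps matrix_mul_assoc)
  moreover have "block A' (- (A' ** B ** D')) 0 D' \<in> upper_triangular_group t d"
    using A' D' by (auto simp: upper_triangular_group_def)
  ultimately show "\<exists>N\<in>upper_triangular_group t d. M ** N = mat 1" by blast
next
  have "mat 1 = block (mat 1) 0 0 (mat 1 :: 'k mat2)" by (simp add: block_mat)
  then show "mat 1 \<in> upper_triangular_group t d" by (force simp: upper_triangular_group_def)
next
  fix M N assume "M \<in> upper_triangular_group t d" "N \<in> upper_triangular_group t d"
  then obtain A B D A' B' D' where "M = block A B 0 D" "A \<in> L" "D \<in> L" "A \<noteq> 0" "D \<noteq> 0"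
    "N = block A' B' 0 D'" "A' \<in> L" "D' \<in> L" "A' \<noteq> 0" "D' \<noteq> 0"
    by (auto simp: upper_triangular_group_def)
  then have "M ** N = block (A ** A') (A ** B' + B ** D') 0 (D ** D')" "A ** A' \<in> L - {0}" "D ** D' \<in> L - {0}"
    by (simp_all add: block_simps LL_mult_eq_0_iff)
  then show "M ** N \<in> upper_triangular_group t d" unfolding upper_triangular_group_def by blast
qed

lemma upper_triangular_stab_PL0: "upper_triangular_group t d \<subseteq> GL4_stab (PL0 t d)"
proof (rule subset_stabI[OF upper_triangular_subgroup])
  fix M Z assume "M \<in> upper_triangular_group t d" "Z \<in> PL0 t d"
  then obtain A B D x X where M: "M = block A B 0 D" "A \<in> L" "D \<in> L" and Z: "Z = alt_mat x (X ** delta d) 0" "X \<in> L"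
    by (auto simp: upper_triangular_group_def PL0_iff_ex)
  have "A ** (X ** delta d) ** transpose D = A ** X ** D ** delta d"
    using delta_transpose[OF M(3)] by (simp add: matrix_mul_assoc[symmetric])
  moreover have "fP (A ** X ** D ** delta d) = 0" using M Z by (auto simp: fP_eq_0_iff)
  ultimately show "act M Z \<in> PL0 t d" by (simp add: M(1) Z(1) act_alt_mat PL0_iff skew_coeff_def)
qed

lemma Xi_stab_PL0: "Xi t \<in> GL4_stab (PL0 t d)"
  by (rule Xi_inverse_stabI) (use Xi_PL in \<open>fastforce simp: PL0_iff_ex\<close>)

text \<open>The image of s01 lies in P^0, so det C = 0 and A i C' = X delta with X in L. Then X has
  norm 0, hence X = 0; also C i C' = (det C) i = 0. So M annihilates the first block column built
  from i C', and invertibility of M gives C = 0. For the second claim, the block B influences only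
  the coordinate at s01 of the image of an element of P.\<close>

lemma stab_PL0_blocks:
  assumes M: "M \<in> GL4_stab (PL0 t d)"
  obtains A B D where "M = block A B 0 D" "\<And>Z. Z \<in> PL t d \<Longrightarrow> act (block A 0 0 D) Z \<in> PL t d"
proof -
  obtain A B C D where Mb: "M = block A B C D" by (rule block_cases)
  obtain M' where M': "M' ** M = mat 1"
    using M by (auto simp: GL4_stab_def invertible_def)
  have "act M (alt_mat 1 0 0) \<in> PL0 t d" by (rule stab_act[OF M]) (simp add: PL0_iff fP_linear)
  then have C0: "det2 C = 0" and "fP (A ** imat ** transpose C) = 0"
    by (simp_all add: Mb act_alt_mat PL0_iff skew_coeff_def)
  then obtain X where X: "X \<in> L" "A ** imat ** transpose C = X ** delta d"
    by (auto simp: fP_eq_0_iff)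
  have "det2 (transpose C) = 0"
    using C0 by (simp add: det2_def transpose_def mult.commute)
  then have "det2 (X ** delta d) = 0" unfolding X(2)[symmetric] det2_mult by simp
  then have "det2 X = 0" using d_nonzero by (simp add: det2_mult delta_def)
  then have "X = 0" using X(1) by (simp add: det2_eq_0_iff)
  then have 1: "A ** (imat ** transpose C) = 0" using X(2) by (simp add: matrix_mul_assoc)
  have 2: "C ** (imat ** transpose C) = 0" using imat_congruence[of C] C0 by (simp add: matrix_mul_assoc)
  have "M ** block (imat ** transpose C) 0 0 0 = 0" by (simp add: Mb block_mult 1 2 block_zero)
  then have "M' ** M ** block (imat ** transpose C) 0 0 0 = 0" by (simp add: matrix_mul_assoc[symmetric])
  then have "imat ** transpose C = 0" by (simp add: M' block_zero block_eq_iff)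
  then have C: "C = 0" by (cases C rule: mat22_cases) (simp add: mat22_simps)
  have "act (block A 0 0 D) Z \<in> PL t d" if Z: "Z \<in> PL t d" for Z
  proof -
    obtain X where X: "X \<in> L" "Z = alt_mat 0 (X ** delta d) 0" using Z by (auto simp: PL_iff_ex)
    then have "act M Z \<in> PL0 t d" by (intro stab_act[OF M]) (auto simp: PL0_iff_ex)
    then show ?thesis by (simp add: X(2) Mb C act_alt_mat PL0_iff PL_iff skew_coeff_def)
  qed
  then show thesis using that[of A B D] by (simp add: Mb C)
qed

text \<open>The diagonal part of the inverse of M is the inverse of the diagonal part of M, so the
  latter stabilizes P and belongs to GL_2(L) or to GL_2(L) Xi. The upper right block is arbitrary in
  both cases.\<close>

lemma stab_PL0: "GL4_stab (PL0 t d) = times_Xi t (upper_triangular_group t d)"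
proof (intro Set.set_eqI iffI)
  fix M assume M: "M \<in> GL4_stab (PL0 t d)"
  obtain A B D where Mb: "M = block A B 0 D" and M0: "\<And>Z. Z \<in> PL t d \<Longrightarrow> act (block A 0 0 D) Z \<in> PL t d"
    using stab_PL0_blocks[OF M] by blast
  obtain N where N: "N \<in> GL4_stab (PL0 t d)" "M ** N = mat 1" "N ** M = mat 1"
    by (rule subgroup_GL_inverse[OF stab_subgroup M])
  obtain A' B' D' where Nb: "N = block A' B' 0 D'" and N0: "\<And>Z. Z \<in> PL t d \<Longrightarrow> act (block A' 0 0 D') Z \<in> PL t d"
    using stab_PL0_blocks[OF N(1)] by blast
  have inv: "block A 0 0 D ** block A' 0 0 D' = mat 1" "block A' 0 0 D' ** block A 0 0 D = mat 1"
    using N by (simp_all add: Mb Nb block_simps)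
  have "PL t d \<subseteq> act (block A 0 0 D) ` PL t d"
    using N0 act_inverse[OF inv(1)] by (metis image_eqI subsetI)
  then have "block A 0 0 D \<in> GL4_stab (PL t d)"
    using M0 inv by (auto simp: GL4_stab_def invertible_def)
  then consider "block A 0 0 D \<in> GL2L t d" | N where "N \<in> GL2L t d" "block A 0 0 D = N ** Xi t"
    by (auto simp: stab_PL times_Xi_iff)
  then show "M \<in> times_Xi t (upper_triangular_group t d)"
  proof cases
    case 1
    then have "A \<in> L - {0}" "D \<in> L - {0}" by (auto simp: GL2L_iff block_mats_over_L det_L_block)
    then show ?thesis unfolding times_Xi_iff upper_triangular_group_def Mb by blast
  next
    case 2
    have "block A 0 0 D ** Xi t = N ** (Xi t ** Xi t)" by (simp add: 2 matrix_mul_assoc)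
    then have "N = block (A ** xi t) 0 0 (D ** xi t)" by (simp add: Xi_simps) (simp add: Xi_def block_simps)
    then have "A ** xi t \<in> L - {0}" "D ** xi t \<in> L - {0}"
      using 2(1) by (auto simp: GL2L_iff block_mats_over_L det_L_block)
    then have "block (A ** xi t) (B ** xi t) 0 (D ** xi t) \<in> upper_triangular_group t d"
      unfolding upper_triangular_group_def by blast
    moreover have "M = block (A ** xi t) (B ** xi t) 0 (D ** xi t) ** Xi t"
      by (simp add: Mb Xi_def block_simps matrix_mul_assoc[symmetric] xi_xi)
    ultimately show ?thesis unfolding times_Xi_iff by blast
  qed
next
  fix M assume "M \<in> times_Xi t (upper_triangular_group t d)"
  then show "M \<in> GL4_stab (PL0 t d)"
    using upper_triangular_stab_PL0 Xi_stab_PL0 subgroup.m_closed[OF stab_subgroup, of _ "PL0 t d" "Xi t"]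
    by (auto simp: times_Xi_iff)
qed

end

section \<open>Vectors of K^4 as pairs of vectors of K^2\<close>

definition join :: "'k^2 \<Rightarrow> 'k^2 \<Rightarrow> 'k::field^4" where
  "join u w = (\<chi> p. (if upper_half p then u else w) $ in_half p)"

lemma join_cases: obtains u w where "v = join u w"
proof
  show "v = join (vector [v$0, v$1]) (vector [v$2, v$3])"
    by (simp add: join_def vec_eq_iff forall_index4)
qed

lemma join_eq_iff: "join u w = join u' w' \<longleftrightarrow> u = u' \<and> w = w'"
  by (auto simp: join_def vec_eq_iff forall_index4 forall_2)

lemma join_zero: "0 = join 0 0"
  by (simp add: join_def vec_eq_iff)

lemma block_mult_join: "block A B C D *v join u w = join (A *v u + B *v w) (C *v u + D *v w)"
  by (simp add: vec_eq_iff forall_index4 block_nth join_def matrix_vector_mult_def sum_2 sum_index4 ac_simps)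

lemma bvec_join: "bvec 0 = join (vector [1, 0]) 0" "bvec 2 = join 0 (vector [1, 0])"
  by (simp_all add: bvec_def axis_def join_def vec_eq_iff forall_index4)

lemma uminus_mult_vec: "(- A) *v x = - (A *v x)" for A :: "'k::field^'n^'m"
  by (simp add: vec_eq_iff matrix_vector_mult_def sum_negf)

lemma skew_coeff_zero [simp]: "skew_coeff 0 = 0"
  by (simp add: skew_coeff_def)

lemma e1_nonzero: "(vector [1, 0] :: 'k::field^2) \<noteq> 0"
  by (simp add: vec_eq_iff forall_2)

lemma inverse_mult_vec_eq_0:
  fixes g :: "'k::field^'n^'n"
  assumes "h ** g = mat 1" "g *v x = 0"
  shows "x = 0"
proof -
  have "x = h *v (g *v x)" by (simp add: matrix_vector_mul_assoc assms(1))
  then show ?thesis by (simp add: assms(2))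
qed

lemma generate_involution:
  assumes "group G" "g \<in> carrier G" "g \<otimes>\<^bsub>G\<^esub> g = \<one>\<^bsub>G\<^esub>"
  shows "generate G {g} = {\<one>\<^bsub>G\<^esub>, g}"
proof
  interpret group G by fact
  have "inv\<^bsub>G\<^esub> g = g" using assms by (simp add: inv_equality)
  then have "subgroup {\<one>\<^bsub>G\<^esub>, g} G"
    using assms by (intro subgroupI) auto
  then show "generate G {g} \<subseteq> {\<one>\<^bsub>G\<^esub>, g}" by (intro generate_subgroup_incl) auto
  show "{\<one>\<^bsub>G\<^esub>, g} \<subseteq> generate G {g}" by (auto intro: generate.intros)
qed

lemma group_units_of_field: "group (units_of_field :: 'k::field monoid)"
proof (rule groupI)
  fix x :: 'k assume "x \<in> carrier units_of_field"
  then show "\<exists>y\<in>carrier units_of_field. y \<otimes>\<^bsub>units_of_field\<^esub> x = \<one>\<^bsub>units_of_field\<^esub>"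
    by (auto simp: units_of_field_def intro: exI[of _ "1 / x"])
qed (auto simp: units_of_field_def)

context quadratic
begin

section \<open>The Galois group\<close>

lemma LL_ring_simps [simp]:
  "carrier (LL_ring t d) = L" "x \<otimes>\<^bsub>LL_ring t d\<^esub> y = x ** y" "x \<oplus>\<^bsub>LL_ring t d\<^esub> y = x + y" "\<one>\<^bsub>LL_ring t d\<^esub> = mat 1"
  by (simp_all add: LL_ring_def)

lemma lconj_Bij: "restrict (lconj t) L \<in> Bij L"
proof -
  have "bij_betw (lconj t) L L" by (rule bij_betw_byWitness[where f' = "lconj t"]) auto
  then have "bij_betw (restrict (lconj t) L) L L"
    by (subst bij_betw_cong[of L "restrict (lconj t) L" "lconj t"]) auto
  then show ?thesis by (simp add: Bij_def)
qed

text \<open>An automorphism over K is determined by the image of omega, which is omega or t - omega.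
  The two listed maps coincide if t = 0 and 2 = 0.\<close>

lemma Gal_eq: "Gal t d = {\<lambda>X\<in>L. X, restrict (lconj t) L}"
proof (intro Set.set_eqI iffI)
  fix \<sigma> assume \<sigma>: "\<sigma> \<in> Gal t d"
  have ext: "\<sigma> \<in> extensional L" using \<sigma> by (simp add: Gal_def Bij_def)
  have hom: "\<sigma> \<in> ring_hom (LL_ring t d) (LL_ring t d)" and fx: "\<sigma> (mat r) = mat r" for r
    using \<sigma> by (auto simp: Gal_def)
  have mult: "\<sigma> (X ** Y) = \<sigma> X ** \<sigma> Y" and add: "\<sigma> (X + Y) = \<sigma> X + \<sigma> Y" and cl: "\<sigma> X \<in> L"
    if "X \<in> L" "Y \<in> L" for X Y
    using ring_hom_mult[OF hom, of X Y] ring_hom_add[OF hom, of X Y] ring_hom_closed[OF hom, of X] that by simp_all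
  define c where "c = \<sigma> (el 0 1)"
  have val: "\<sigma> (el x y) = mat x + mat y ** c" for x y
  proof -
    have "el x y = mat x + mat y ** el 0 1" by (simp add: el_simps)
    then show ?thesis by (simp add: mult add fx c_def)
  qed
  have "c ** c = \<sigma> (el 0 1 ** el 0 1)" by (simp add: c_def mult)
  also have "el 0 1 ** el 0 1 = el (- d) t" by (simp add: el_simps)
  also have "\<sigma> (el (- d) t) = mscale t c - mat d"
    unfolding val by (simp add: matrix_mult_mat) (simp add: mat22_simps)
  finally have "c = el 0 1 \<or> c = el t (- 1)"
    using cl[of "el 0 1" "el 0 1"] by (intro LL_root_cases) (auto simp: c_def)
  then show "\<sigma> \<in> {\<lambda>X\<in>L. X, restrict (lconj t) L}"
  proof
    assume c: "c = el 0 1"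
    have "\<sigma> X = X" if "X \<in> L" for X
      using that by (auto simp: LL_iff val c) (simp add: el_simps)
    then have "\<sigma> = (\<lambda>X\<in>L. X)" using ext by (intro extensionalityI) auto
    then show ?thesis by simp
  next
    assume c: "c = el t (- 1)"
    have "\<sigma> X = lconj t X" if "X \<in> L" for X
      using that by (auto simp: LL_iff val c) (simp add: el_simps algebra_simps)
    then have "\<sigma> = restrict (lconj t) L" using ext by (intro extensionalityI) auto
    then show ?thesis by simp
  qed
next
  fix \<sigma> assume "\<sigma> \<in> {\<lambda>X\<in>L. X, restrict (lconj t) L}"
  then show "\<sigma> \<in> Gal t d"
  proof (elim insertE emptyE)
    assume "\<sigma> = (\<lambda>X\<in>L. X)"
    then show ?thesis
      using id_Bij[of L] by (simp add: Gal_def ring_hom_def)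
  next
    assume "\<sigma> = restrict (lconj t) L"
    then show ?thesis
      using lconj_Bij by (simp add: Gal_def ring_hom_def lconj_mult)
  qed
qed

lemma generate_lconj: "generate (BijGroup L) {restrict (lconj t) L} = Gal t d"
proof -
  have "compose L (restrict (lconj t) L) (restrict (lconj t) L) = (\<lambda>X\<in>L. X)"
    by (auto simp: compose_def)
  then have "generate (BijGroup L) {restrict (lconj t) L} = {\<one>\<^bsub>BijGroup L\<^esub>, restrict (lconj t) L}"
    using lconj_Bij by (intro generate_involution group_BijGroup) (simp_all add: BijGroup_def)
  then show ?thesis by (simp add: Gal_eq BijGroup_def)
qed

section \<open>Orbits on vectors and on \<open>\<Lambda>/P\<^sup>\<bottom>\<close>\<close>

lemma el_e1: "el x y *v vector [1, 0] = vector [x, y]"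
  by (simp add: el_def mat22_mult_vec)

text \<open>An element of L is determined by its first column, and that column is arbitrary.
  Transitivity of the non-zero elements of L on non-zero vectors is then division in L.\<close>

lemma LL_e1_obtains:
  obtains U where "U \<in> L" "U *v vector [1, 0] = u" "U = 0 \<longleftrightarrow> u = 0"
proof
  show "el (u$1) (u$2) *v vector [1, 0] = u" unfolding el_e1 by (rule vec2_eta)
  show "el (u$1) (u$2) = 0 \<longleftrightarrow> u = 0" 
    unfolding el_zero el_eq_iff by (simp add: vec_eq_iff forall_2)
qed simp

lemma LL_transitive:
  assumes "u \<noteq> 0" "w \<noteq> 0"
  obtains A where "A \<in> L" "A \<noteq> 0" "A *v u = w"
proof -
  obtain U where U: "U \<in> L" "U *v vector [1, 0] = u" "U \<noteq> 0" using LL_e1_obtains assms(1) by metis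
  obtain W where W: "W \<in> L" "W *v vector [1, 0] = w" "W \<noteq> 0" using LL_e1_obtains assms(2) by metis
  obtain U' where U': "U' \<in> L" "U' ** U = mat 1" "U' \<noteq> 0" using LL_inverse[OF U(1,3)] by metis
  have "(W ** U') *v u = W *v ((U' ** U) *v vector [1, 0])"
    by (simp add: U(2)[symmetric] matrix_vector_mul_assoc matrix_mul_assoc)
  then have "(W ** U') *v u = w" by (simp add: U' W)
  then show thesis using that[of "W ** U'"] U' W by (simp add: LL_mult_eq_0_iff)
qed

lemma times_Xi_subset: "H \<subseteq> times_Xi t H"
  by (auto simp: times_Xi_iff)

lemma orbits_vec_PL:
  "system_of_reps {0, bvec 0} (orbits (GLsub (GL4_stab (PL t d))) (UNIV :: ('k^4) set) (*v))"
  unfolding GLsub_def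
proof (rule system_of_reps_orbitsI[OF acts_on_vec[OF stab_subgroup]])
  fix v :: "'k^4"
  have GL: "GL2L t d \<subseteq> GL4_stab (PL t d)" by (rule GL2L_stab_PL)
  obtain u w where v: "v = join u w" by (rule join_cases)
  have "\<exists>g\<in>GL2L t d. g *v v \<in> {0, bvec 0}"
  proof (cases "u = 0")
    case False
    obtain A where A: "A \<in> L" "A \<noteq> 0" "A *v u = vector [1, 0]" using LL_transitive[OF False e1_nonzero] by blast
    \<comment> \<open>Writing w as W e1 = W A u makes the lower half removable by a multiple of the
      upper half.\<close>
    obtain W where W: "W \<in> L" "W *v vector [1, 0] = w" using LL_e1_obtains by metis
    have "(W ** A) *v u = w" by (simp add: matrix_vector_mul_assoc[symmetric] A W)
    then have "block A 0 (- (W ** A)) (mat 1) *v v = bvec 0"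
      by (simp add: v block_mult_join bvec_join join_eq_iff A uminus_mult_vec)
    moreover have "block A 0 (- (W ** A)) (mat 1) \<in> GL2L t d"
      using A W by (simp add: GL2L_iff block_mats_over_L det_L_block)
    ultimately show ?thesis by blast
  next
    case True
    show ?thesis
    proof (cases "w = 0")
      case True
      have "mat 1 \<in> GL2L t d" by (simp add: GL2L_iff)
      then show ?thesis using True \<open>u = 0\<close> by (intro bexI[of _ "mat 1"]) (simp_all add: v join_zero[symmetric])
    next
      case False
      obtain A where A: "A \<in> L" "A \<noteq> 0" "A *v w = vector [1, 0]" using LL_transitive[OF False e1_nonzero] by blast
      then have "block 0 A (mat 1) 0 *v v = bvec 0"
        using True by (simp add: v block_mult_join bvec_join join_eq_iff)
      moreover have "block 0 A (mat 1) 0 \<in> GL2L t d"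
        using A by (simp add: GL2L_iff block_mats_over_L det_L_block)
      ultimately show ?thesis by blast
    qed
  qed
  then show "\<exists>g\<in>carrier (GL\<lparr>carrier := GL4_stab (PL t d)\<rparr>). g *v v \<in> {0, bvec 0}" using GL by auto
next
  fix r s :: "'k^4" and g
  assume rs: "r \<in> {0, bvec 0}" "s \<in> {0, bvec 0}" and g: "g \<in> carrier (GL\<lparr>carrier := GL4_stab (PL t d)\<rparr>)" "g *v r = s"
  obtain h where "h ** g = mat 1" using g(1) by (auto simp: GL4_stab_def invertible_def)
  then have "r = 0 \<longleftrightarrow> s = 0" using inverse_mult_vec_eq_0 g(2) by auto
  then show "r = s" using rs by auto
qed simp

lemma stab_PL_subset_stab_perp: "GL4_stab (PL t d) \<subseteq> GL4_stab (perp (PL t d))"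
  by (simp add: stab_PL stab_perp_PL)

lemma acts_on_quot_perp: "acts_on (GLsub (GL4_stab (PL t d))) (quot Lam (perp (PL t d))) coset_act"
  by (rule acts_on_quot[OF stab_subgroup stab_PL_subset_stab_perp]) (rule act_Lam)

text \<open>Modulo the orthogonal space only the vector \<open>fQ Y\<close> is left, and diag(A, 1)
  multiplies it by A. The trivial coset is fixed by the whole group.\<close>

lemma orbits_quot_perp:
  assumes C: "C \<in> quot Lam (perp (PL t d))" "C \<noteq> perp (PL t d)"
  shows "system_of_reps {perp (PL t d), C} (orbits (GLsub (GL4_stab (PL t d))) (quot Lam (perp (PL t d))) coset_act)"
proof (rule system_of_reps_orbitsI[OF acts_on_quot_perp])
  let ?P = "perp (PL t d)"
  have P: "?P \<in> quot Lam ?P"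
    using coset_in_quot[of 0 Lam ?P] ksubspace_closed(1)[OF ksubspace_Lam] by (simp add: coset_zero)
  then show "{?P, C} \<subseteq> quot Lam ?P" using C by simp
  obtain x Y z where X: "C = alt_mat x Y z +o ?P" using C(1) by (auto simp: quot_def Lam_iff)
  then have Y: "fQ Y \<noteq> 0" using C(2) by (auto simp: coset_eq_self_iff[OF ksubspace_perp_PL] perp_PL_iff)
  fix D assume "D \<in> quot Lam ?P"
  then obtain x' Y' z' where X': "D = alt_mat x' Y' z' +o ?P" by (auto simp: quot_def Lam_iff)
  show "\<exists>g\<in>carrier (GLsub (GL4_stab (PL t d))). coset_act g D \<in> {?P, C}"
  proof (cases "fQ Y' = 0")
    case True
    then have "D = ?P" by (simp add: X' coset_eq_self_iff[OF ksubspace_perp_PL] perp_PL_iff)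
    then have "coset_act (mat 1) D = ?P" by (simp add: coset_act_def)
    moreover have "mat 1 \<in> GL4_stab (PL t d)" using subgroup.one_closed[OF stab_subgroup, of "PL t d"] by simp
    ultimately show ?thesis by auto
  next
    case False
    obtain A where A: "A \<in> L" "A \<noteq> 0" "A *v fQ Y' = fQ Y" using LL_transitive[OF False Y] by blast
    have "block A 0 0 (mat 1) \<in> GL2L t d" using A by (simp add: GL2L_iff block_mats_over_L det_L_block)
    then have g: "block A 0 0 (mat 1) \<in> GL4_stab (PL t d)" using GL2L_stab_PL by blast
    then have "coset_act (block A 0 0 (mat 1)) D = act (block A 0 0 (mat 1)) (alt_mat x' Y' z') +o ?P"
      unfolding X' using g stab_PL_subset_stab_perp by (intro coset_act_coset) blast
    also have "\<dots> = C"
      unfolding X coset_eq_iff[OF ksubspace_perp_PL]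
      by (simp add: act_alt_mat alt_mat_linear perp_PL_iff fQ_linear fQ_LL_mult A)
    finally show ?thesis using g by auto
  qed
next
  let ?P = "perp (PL t d)"
  fix r s g
  assume rs: "r \<in> {?P, C}" "s \<in> {?P, C}" and g: "g \<in> carrier (GLsub (GL4_stab (PL t d)))" "coset_act g r = s"
  have P: "?P \<in> quot Lam ?P"
    using coset_in_quot[of 0 Lam ?P] ksubspace_closed(1)[OF ksubspace_Lam] by (simp add: coset_zero)
  have fx: "coset_act h ?P = ?P" if "h \<in> GL4_stab (PL t d)" for h
    using that stab_PL_subset_stab_perp by (auto simp: coset_act_def GL4_stab_def)
  obtain h where h: "h \<in> GL4_stab (PL t d)" "h ** g = mat 1"
    using subgroup_GL_inverse[OF stab_subgroup, of g] g(1) by auto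
  have "r = ?P" if "s = ?P"
  proof -
    have "r = coset_act h (coset_act g r)"
      by (simp add: coset_act_def image_image act_mult[symmetric] h(2))
    then show ?thesis using g(2) that fx[OF h(1)] by simp
  qed
  then show "r = s" using rs g fx by auto
qed

lemma card_orbits_vec: "card (orbits (GLsub (GL4_stab (PL t d))) (UNIV :: ('k^4) set) (*v)) = 2"
proof -
  have "bvec 0 \<noteq> (0 :: 'k^4)" by (simp add: bvec_join join_zero join_eq_iff e1_nonzero)
  then have "card {0, bvec 0 :: 'k^4} = 2" by auto
  then show ?thesis
    using card_orbits[OF acts_on_vec[OF stab_subgroup, folded GLsub_def] orbits_vec_PL] by simp
qed

lemma card_orbits_quot_perp:
  "card (orbits (GLsub (GL4_stab (PL t d))) (quot Lam (perp (PL t d))) coset_act) = 2"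
proof -
  \<comment> \<open>A non-trivial coset is needed for counting; the block \<open>E11\<close>
    provides one because \<open>fQ E11\<close> is (1, 0).\<close>
  let ?P = "perp (PL t d)" and ?C = "alt_mat 0 E11 0 +o perp (PL t d)"
  have "fQ E11 = vector [1, 0]" using fQ_el_E11[of 1 0] by (simp add: el_mat[symmetric])
  then have "fQ E11 \<noteq> 0" by (simp add: e1_nonzero)
  then have C: "?C \<in> quot Lam ?P" "?C \<noteq> ?P"
    by (auto simp: coset_in_quot coset_eq_self_iff[OF ksubspace_perp_PL] perp_PL_iff)
  then have "card {?P, ?C} = 2" by auto
  then show ?thesis using card_orbits[OF acts_on_quot_perp orbits_quot_perp[OF C]] by simp
qed

section \<open>Orbits of the stabilizer of \<open>P\<^sup>0\<close>\<close>

lemma upper_triangular_subset: "upper_triangular_group t d \<subseteq> GL4_stab (PL0 t d)"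
  by (simp add: stab_PL0 times_Xi_subset)

lemma upper_triangularI: "A \<in> L \<Longrightarrow> D \<in> L \<Longrightarrow> A \<noteq> 0 \<Longrightarrow> D \<noteq> 0 \<Longrightarrow> block A B 0 D \<in> upper_triangular_group t d"
  by (auto simp: upper_triangular_group_def)

text \<open>The lower left block of every group element is zero, so vectors with vanishing lower
  half stay such; this separates b0 from b2.\<close>

lemma orbits_vec_PL0:
  "system_of_reps {0, bvec 0, bvec 2} (orbits (GLsub (GL4_stab (PL0 t d))) (UNIV :: ('k^4) set) (*v))"
  unfolding GLsub_def
proof (rule system_of_reps_orbitsI[OF acts_on_vec[OF stab_subgroup]])
  fix v :: "'k^4"
  obtain u w where v: "v = join u w" by (rule join_cases)
  have "\<exists>g\<in>upper_triangular_group t d. g *v v \<in> {0, bvec 0, bvec 2}"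
  proof (cases "w = 0")
    case False
    obtain D where D: "D \<in> L" "D \<noteq> 0" "D *v w = vector [1, 0]" using LL_transitive[OF False e1_nonzero] by blast
    obtain U where U: "U \<in> L" "U *v vector [1, 0] = u" using LL_e1_obtains by metis
    have "(U ** D) *v w = u" by (simp add: matrix_vector_mul_assoc[symmetric] D U)
    then have "block (mat 1) (- (U ** D)) 0 D *v v = bvec 2"
      by (simp add: v block_mult_join bvec_join join_eq_iff D uminus_mult_vec)
    then show ?thesis using upper_triangularI[of "mat 1" D] D by auto
  next
    case True
    show ?thesis
    proof (cases "u = 0")
      case u: True
      then have "mat 1 *v v = 0" using True by (simp add: v join_zero[symmetric])
      moreover have "mat 1 \<in> upper_triangular_group t d"
        using subgroup.one_closed[OF upper_triangular_subgroup] by simp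
      ultimately show ?thesis by blast
    next
      case False
      obtain A where A: "A \<in> L" "A \<noteq> 0" "A *v u = vector [1, 0]" using LL_transitive[OF False e1_nonzero] by blast
      have "block A 0 0 (mat 1) *v v = bvec 0"
        by (simp add: v block_mult_join bvec_join join_eq_iff A True)
      then show ?thesis using upper_triangularI[of A "mat 1"] A by auto
    qed
  qed
  then show "\<exists>g\<in>carrier (GL\<lparr>carrier := GL4_stab (PL0 t d)\<rparr>). g *v v \<in> {0, bvec 0, bvec 2}"
    using upper_triangular_subset by auto
next
  fix r s :: "'k^4" and g
  assume rs: "r \<in> {0, bvec 0, bvec 2}" "s \<in> {0, bvec 0, bvec 2}"
    and g: "g \<in> carrier (GL\<lparr>carrier := GL4_stab (PL0 t d)\<rparr>)" "g *v r = s"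
  have nz: "bvec 0 \<noteq> (0 :: 'k^4)" "bvec 2 \<noteq> (0 :: 'k^4)" "bvec 0 \<noteq> (bvec 2 :: 'k^4)"
    by (simp_all add: bvec_join join_zero join_eq_iff e1_nonzero)
  have g': "g \<in> GL4_stab (PL0 t d)" using g(1) by simp
  obtain h where h: "h \<in> GL4_stab (PL0 t d)" "h ** g = mat 1"
    by (rule subgroup_GL_inverse[OF stab_subgroup g'])
  have hs: "h *v s = r" by (simp add: g(2)[symmetric] matrix_vector_mul_assoc h(2))
  have no: "k *v bvec 0 \<noteq> bvec 2" if k: "k \<in> GL4_stab (PL0 t d)" for k
  proof -
    obtain A B D where "k = block A B 0 D" using stab_PL0_blocks[OF k] by metis
    then show ?thesis using e1_nonzero[where 'k = 'k, symmetric] by (simp add: bvec_join block_mult_join join_eq_iff)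
  qed
  have "r = 0 \<longleftrightarrow> s = 0" using inverse_mult_vec_eq_0[OF h(2)] g(2) by auto
  then show "r = s" using rs no[OF g'] no[OF h(1)] hs g(2) nz by auto
qed simp

lemma norm_values_eq: "norm_values t d = det2 ` (L - {0})"
  unfolding norm_values_def by (auto simp: lconj_mult_self mat22_mat mat22_eq_iff image_iff)

abbreviation signed_norms where
  "signed_norms \<equiv> norm_values t d <#>\<^bsub>units_of_field\<^esub> generate units_of_field {- 1}"

lemma signed_norms_iff: "h \<in> signed_norms \<longleftrightarrow> (\<exists>D\<in>L - {0}. h = det2 D \<or> h = - det2 D)"
proof -
  have "generate units_of_field {- 1} = {1, - 1 :: 'k}"
    using generate_involution[OF group_units_of_field, of "- 1 :: 'k"] by (simp add: units_of_field_def)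
  then show ?thesis by (auto simp: set_mult_def norm_values_eq) (auto simp: units_of_field_def)
qed

lemma system_of_reps_signed_norms:
  assumes "system_of_reps R (rcosets\<^bsub>units_of_field\<^esub> signed_norms)"
  shows "R \<subseteq> - {0}" and "\<And>x. x \<noteq> 0 \<Longrightarrow> \<exists>!r. r \<in> R \<and> (\<exists>h\<in>signed_norms. r = h * x)"
proof -
  have nz: "h \<noteq> 0" if "h \<in> signed_norms" for h
    using that by (auto simp: signed_norms_iff det2_eq_0_iff)
  have cos: "signed_norms #>\<^bsub>units_of_field\<^esub> x = {h * x | h. h \<in> signed_norms}" for x
    by (auto simp: r_coset_def) (auto simp: units_of_field_def)
  have rc: "(rcosets\<^bsub>units_of_field\<^esub> signed_norms) = {{h * x | h. h \<in> signed_norms} | x. x \<noteq> 0}"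
    unfolding RCOSETS_def cos by (auto simp: units_of_field_def)
  show "R \<subseteq> - {0}"
  proof
    fix r assume "r \<in> R"
    then have "r \<in> \<Union> {{h * x | h. h \<in> signed_norms} | x. x \<noteq> 0}" using assms unfolding system_of_reps_def rc by blast
    then show "r \<in> - {0}" using nz by auto
  qed
  fix x :: 'k assume "x \<noteq> 0"
  then have "{h * x | h. h \<in> signed_norms} \<in> {{h * x | h. h \<in> signed_norms} | x. x \<noteq> 0}"
    by (intro CollectI exI[of _ x]) simp
  then have "\<exists>!r. r \<in> R \<inter> {h * x | h. h \<in> signed_norms}"
    using assms unfolding system_of_reps_def rc by (intro bspec[of "{{h * x | h. h \<in> signed_norms} | x. x \<noteq> 0}" "\<lambda>C. \<exists>!r. r \<in> R \<inter> C"]) simp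
  moreover have "r \<in> R \<inter> {h * x | h. h \<in> signed_norms} \<longleftrightarrow> r \<in> R \<and> (\<exists>h\<in>signed_norms. r = h * x)" for r by blast
  ultimately show "\<exists>!r. r \<in> R \<and> (\<exists>h\<in>signed_norms. r = h * x)" by simp
qed

text \<open>The lower right block is D or D xi with D in L. As det xi = -1, its determinant is a
  norm or the negative of one; this is where the factor <-1> comes from.\<close>

lemma stab_PL0_signed_norm:
  assumes "g \<in> GL4_stab (PL0 t d)"
  obtains A B D where "g = block A B 0 D" "det2 D \<in> signed_norms"
proof -
  from assms consider (1) "g \<in> upper_triangular_group t d" | (2) N where "N \<in> upper_triangular_group t d" "g = N ** Xi t"
    by (auto simp: stab_PL0 times_Xi_iff)
  then show thesis
  proof cases
    case 1
    then obtain A B D where "g = block A B 0 D" "D \<in> L - {0}" by (auto simp: upper_triangular_group_def)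
    then show thesis using that[of A B D] unfolding signed_norms_iff by blast
  next
    case 2
    then obtain A B D where N: "N = block A B 0 D" "D \<in> L - {0}" by (auto simp: upper_triangular_group_def)
    have "det2 (D ** xi t) = - det2 D" by (simp add: det2_mult) (simp add: xi_def)
    then have "det2 (D ** xi t) \<in> signed_norms" using N(2) unfolding signed_norms_iff by blast
    then show thesis using that[of "A ** xi t" "B ** xi t" "D ** xi t"] by (simp add: 2 N Xi_def block_simps)
  qed
qed

lemma acts_on_quot_PL0: "acts_on (GLsub (GL4_stab (PL0 t d))) (quot Lam (PL0 t d)) coset_act"
  by (rule acts_on_quot[OF stab_subgroup order.refl]) (rule act_Lam)

text \<open>A coset of P^0 is described by z and \<open>fP Y\<close>. The group multiplies z by
  signed norms; if z is nonzero, then Y can be removed, and if z = 0, then \<open>fP Y\<close> can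
  be moved to any nonzero vector. The block E is a parameter because E_2 fails to represent a
  non-trivial coset if d = -1.\<close>

lemma orbits_quot_PL0:
  assumes R: "system_of_reps R (rcosets\<^bsub>units_of_field\<^esub> signed_norms)" and E: "fP E \<noteq> 0"
  shows "system_of_reps ({PL0 t d, alt_mat 0 E 0 +o PL0 t d} \<union> {mscale c (sbas 2 3) +o PL0 t d | c. c \<in> R})
           (orbits (GLsub (GL4_stab (PL0 t d))) (quot Lam (PL0 t d)) coset_act)"
proof (rule system_of_reps_orbitsI[OF acts_on_quot_PL0])
  let ?P = "PL0 t d"
  let ?T = "{?P, alt_mat 0 E 0 +o ?P} \<union> {mscale c (sbas 2 3) +o ?P | c. c \<in> R}"
  have s23: "mscale c (sbas 2 3) = alt_mat 0 0 c" for c :: 'k by (simp add: sbas_alt_mat alt_mat_linear)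
  note R0 = system_of_reps_signed_norms(1)[OF R] and R1 = system_of_reps_signed_norms(2)[OF R]
  have T: "C \<in> ?T \<longleftrightarrow> (\<exists>X. C = X +o ?P \<and> (X = 0 \<or> X = alt_mat 0 E 0 \<or> (\<exists>c\<in>R. X = alt_mat 0 0 c)))" for C
  proof -
    have "C \<in> ?T \<longleftrightarrow> C = 0 +o ?P \<or> C = alt_mat 0 E 0 +o ?P \<or> (\<exists>c\<in>R. C = alt_mat 0 0 c +o ?P)"
      by (auto simp: s23 coset_zero)
    then show ?thesis by blast
  qed
  have quot: "C \<in> quot Lam ?P \<longleftrightarrow> (\<exists>X\<in>Lam. C = X +o ?P)" for C by (auto simp: quot_def)
  have ceq: "X +o ?P = Y +o ?P \<longleftrightarrow> X - Y \<in> ?P" for X Y by (rule coset_eq_iff[OF ksubspace_PL0])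
  have cact: "coset_act g (X +o ?P) = act g X +o ?P" if "g \<in> GL4_stab ?P" for g X by (rule coset_act_coset[OF that])
  have Lam0: "0 \<in> Lam" by (rule ksubspace_closed(1)[OF ksubspace_Lam])
  show "?T \<subseteq> quot Lam ?P" unfolding subset_iff T quot using Lam0 by auto
  {
    fix C assume "C \<in> quot Lam ?P"
    then obtain x Y z where C: "C = alt_mat x Y z +o ?P" by (auto simp: quot Lam_iff)
    have kill: "\<exists>g\<in>upper_triangular_group t d. coset_act g (alt_mat x Y z +o ?P) = alt_mat 0 0 (det2 D * z) +o ?P"
      if z: "z \<noteq> 0" and D: "D \<in> L - {0}" for x Y z D
    proof -
      \<comment> \<open>As i i = -1, the upper right block (1/z) Y i makes z B i D' cancel Y
        D'.\<close>
      let ?g = "block (mat 1) (mscale (1 / z) (Y ** imat)) 0 D"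
      have g: "?g \<in> upper_triangular_group t d" using D by (intro upper_triangularI) auto
      have ii: "Y ** imat ** imat = - Y" by (cases Y rule: mat22_cases) (simp add: mat22_simps)
      have "act ?g (alt_mat x Y z) - alt_mat 0 0 (det2 D * z) \<in> ?P"
        using z by (simp add: act_alt_mat alt_mat_linear PL0_iff matrix_mscale_mult ii fP_linear skew_coeff_def)
      then show ?thesis using g upper_triangular_subset cact ceq by blast
    qed
    have "\<exists>g\<in>GL4_stab ?P. \<exists>X. coset_act g C = X +o ?P \<and> (X = 0 \<or> X = alt_mat 0 E 0 \<or> (\<exists>c\<in>R. X = alt_mat 0 0 c))"
    proof (cases "z = 0")
      case False
      obtain r h where r: "r \<in> R" "h \<in> signed_norms" "r = h * z" using R1[OF False] by blast
      from r(2) obtain D where D: "D \<in> L - {0}" "h = det2 D \<or> h = - det2 D" unfolding signed_norms_iff by blast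
      from D(2) show ?thesis
      proof
        assume "h = det2 D"
        then show ?thesis using kill[OF False D(1), of x Y] r upper_triangular_subset C by blast
      next
        \<comment> \<open>The sign is supplied by Xi, which replaces z by -z before the norm is
          applied.\<close>
        assume h: "h = - det2 D"
        have mz: "- z \<noteq> 0" using False by simp
        obtain g where g: "g \<in> upper_triangular_group t d"
          "coset_act g (alt_mat (- x) (xi t ** Y ** transpose (xi t)) (- z) +o ?P) = alt_mat 0 0 (det2 D * (- z)) +o ?P"
          using kill[OF mz D(1), of "- x" "xi t ** Y ** transpose (xi t)"] by blast
        have "coset_act (g ** Xi t) C = coset_act g (coset_act (Xi t) C)"
          by (simp add: coset_act_def image_image act_mult)
        also have "coset_act (Xi t) C = alt_mat (- x) (xi t ** Y ** transpose (xi t)) (- z) +o ?P"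
          using cact[OF Xi_stab_PL0] by (simp add: C Xi_simps)
        also have "coset_act g \<dots> = alt_mat 0 0 r +o ?P" by (simp add: g(2) r(3) h)
        finally have "coset_act (g ** Xi t) C = alt_mat 0 0 r +o ?P" .
        moreover have "g ** Xi t \<in> GL4_stab ?P" using g(1) by (auto simp: stab_PL0 times_Xi_iff)
        ultimately show ?thesis using r(1) by blast
      qed
    next
      case True
      show ?thesis
      proof (cases "fP Y = 0")
        case fY: True
        then have "alt_mat x Y z - 0 \<in> ?P" using True by (simp add: PL0_iff)
        then have "coset_act (mat 1) C = 0 +o ?P" unfolding ceq[symmetric] by (simp add: coset_act_def C)
        moreover have "mat 1 \<in> GL4_stab ?P" using subgroup.one_closed[OF stab_subgroup, of ?P] by simp
        ultimately show ?thesis by blast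
      next
        case False
        obtain A where A: "A \<in> L" "A \<noteq> 0" "A *v fP Y = fP E" using LL_transitive[OF False E] by blast
        have g: "block A 0 0 (mat 1) \<in> GL4_stab ?P"
          using upper_triangularI[of A "mat 1" 0] A upper_triangular_subset by auto
        have "act (block A 0 0 (mat 1)) (alt_mat x Y z) - alt_mat 0 E 0 \<in> ?P"
          using A True by (simp add: act_alt_mat alt_mat_linear PL0_iff fP_linear fP_LL_mult)
        then have "coset_act (block A 0 0 (mat 1)) C = alt_mat 0 E 0 +o ?P" using ceq cact[OF g] C by simp
        then show ?thesis using g by blast
      qed
    qed
    then show "\<exists>g\<in>carrier (GLsub (GL4_stab ?P)). coset_act g C \<in> ?T" unfolding T GLsub_simps .
  next
    fix r s g assume rs: "r \<in> ?T" "s \<in> ?T" and g: "g \<in> carrier (GLsub (GL4_stab ?P))" "coset_act g r = s"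
    have g': "g \<in> GL4_stab ?P" using g(1) by simp
    obtain h where h: "h \<in> GL4_stab ?P" "h ** g = mat 1"
      by (rule subgroup_GL_inverse[OF stab_subgroup g'])
    have zero: "act k 0 = 0" for k :: "'k mat4" by (rule act_linear)
    from rs(1) obtain X where X: "r = X +o ?P" "X = 0 \<or> X = alt_mat 0 E 0 \<or> (\<exists>c\<in>R. X = alt_mat 0 0 c)" unfolding T by blast
    from rs(2) obtain Y where Y: "s = Y +o ?P" "Y = 0 \<or> Y = alt_mat 0 E 0 \<or> (\<exists>c\<in>R. Y = alt_mat 0 0 c)" unfolding T by blast
    have gX: "act g X - Y \<in> ?P" using g(2) cact[OF g'] by (simp add: X(1) Y(1) ceq)
    have "coset_act h s = r"
      by (simp add: g(2)[symmetric] coset_act_def image_image act_mult[symmetric] h(2))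
    then have hY: "act h Y - X \<in> ?P" using cact[OF h(1)] by (simp add: X(1) Y(1) ceq)
    obtain A B D where gb: "g = block A B 0 D" and D: "det2 D \<in> signed_norms" using stab_PL0_signed_norm[OF g'] .
    have Dnz: "det2 D \<noteq> 0" using D by (auto simp: signed_norms_iff det2_eq_0_iff)
    have nz: "X \<noteq> 0 \<longrightarrow> X \<notin> ?P" "Y \<noteq> 0 \<longrightarrow> Y \<notin> ?P"
      using X(2) Y(2) R0 E by (auto simp: PL0_iff)
    show "r = s"
    proof (cases "X = 0 \<or> Y = 0")
      case True
      have "X = 0" if "Y = 0"
        using hY that nz ksubspace_closed(4)[OF ksubspace_PL0, of "- X"] by (auto simp: zero)
      moreover have "Y = 0" if "X = 0"
        using gX that nz ksubspace_closed(4)[OF ksubspace_PL0, of "- Y"] by (auto simp: zero)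
      ultimately show ?thesis using True X(1) Y(1) by blast
    next
      case False
      then have X': "X = alt_mat 0 E 0 \<or> (\<exists>c\<in>R. X = alt_mat 0 0 c)"
        and Y': "Y = alt_mat 0 E 0 \<or> (\<exists>c\<in>R. Y = alt_mat 0 0 c)" using X(2) Y(2) by blast+
      show ?thesis
      proof (cases "X = alt_mat 0 E 0")
        case XE: True
        have "Y = alt_mat 0 E 0"
          using Y' gX R0 by (auto simp: XE gb act_alt_mat alt_mat_linear PL0_iff skew_coeff_def)
        then show ?thesis using X(1) Y(1) XE by simp
      next
        case False
        then obtain c where c: "c \<in> R" "X = alt_mat 0 0 c" using X' by blast
        then have cz: "c \<noteq> 0" using R0 by auto
        have "Y \<noteq> alt_mat 0 E 0"
          using gX Dnz cz by (auto simp: c gb act_alt_mat alt_mat_linear PL0_iff skew_coeff_def)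
        then obtain e where e: "e \<in> R" "Y = alt_mat 0 0 e" using Y' by blast
        have "e = det2 D * c"
          using gX by (simp add: c e gb act_alt_mat alt_mat_linear PL0_iff skew_coeff_def)
        then have "\<exists>h\<in>signed_norms. e = h * c" using D by blast
        moreover have "\<exists>h\<in>signed_norms. c = h * c"
        proof -
          have "mat 1 \<in> L - {0}" "1 = det2 (mat 1 :: 'k mat2)" by simp_all
          then have "1 \<in> signed_norms" unfolding signed_norms_iff by blast
          then show ?thesis by force
        qed
        ultimately have "e = c" using R1[OF cz] c(1) e(1) by blast
        then show ?thesis using X(1) Y(1) c e by simp
      qed
    qed
  }
qed

end

section \<open>Characteristic 2, evaluation of polynomials at matrices, irreducibility and inverse
  equivalences\<close>

lemma two_eq_0_simps:
  fixes x :: "'k::field"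
  assumes "(2 :: 'k) = 0"
  shows "x + x = 0" "- x = x"
proof -
  show *: "x + x = 0" using assms mult_2[of x] by (metis mult_zero_left)
  show "- x = x" by (rule minus_unique[OF *])
qed

lemma poly_at_pCons: "poly_at (pCons a p) X = mat a + X ** poly_at p X"
\<comment> \<open>\<open>fold_coeffs\<close> sees no coefficient at all if both \<open>a\<close> and
  \<open>p\<close> are zero; the value 0 then agrees with \<open>mat 0\<close>.\<close>
proof (cases "p = 0 \<and> a = 0")
  case True
  moreover have "(mat 0 :: 'a mat2) = 0" by (simp add: mat22_simps)
  ultimately show ?thesis by (simp add: poly_at_def)
next
  case False
  then show ?thesis
    by (cases "a = 0") (simp_all add: poly_at_def)
qed

lemma poly_at_0 [simp]: "poly_at 0 X = 0"
  by (simp add: poly_at_def)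

lemma mat_hom: "mat (a + b) = mat a + (mat b :: 'a::field mat2)" "mat (a * b) = mat a ** (mat b :: 'a mat2)"
  by (simp_all add: mat22_simps)

lemma poly_at_add: "poly_at (p + q) X = poly_at p X + poly_at q X"
  by (induction p q rule: poly_induct2) (simp_all add: poly_at_pCons matrix_ring_simps mat_hom)

lemma poly_at_smult: "poly_at (Polynomial.smult a p) X = mat a ** poly_at p X"
  by (induction p) (simp_all add: poly_at_pCons matrix_ring_simps mat_hom(2) matrix_mult_mat)

lemma poly_at_mult: "poly_at (p * q) X = poly_at p X ** poly_at q X"
proof (induction p)
  case (pCons a p)
  have "(mat 0 :: 'a mat2) = 0" by (simp add: mat22_simps)
  then show ?case
    by (simp add: poly_at_pCons poly_at_add poly_at_smult matrix_ring_simps pCons.IH matrix_mul_assoc)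
qed simp

lemma char_2_iff: "(2 :: 'k::field) = 0 \<longleftrightarrow> CHAR('k) = 2"
proof -
  have "(2 :: 'k) = 0 \<longleftrightarrow> CHAR('k) dvd 2"
    using of_nat_eq_0_iff_char_dvd[of 2, where ?'a = 'k] by simp
  also have "\<dots> \<longleftrightarrow> CHAR('k) = 1 \<or> CHAR('k) = 2"
    using dvd_imp_le[of "CHAR('k)" 2] by (auto simp: le_Suc_eq numeral_2_eq_2)
  also have "\<dots> \<longleftrightarrow> CHAR('k) = 2" by simp
  finally show ?thesis .
qed

lemma irreducible_quadratic:
  fixes p :: "'k::field poly"
  assumes "degree p = 2" "\<And>x. poly p x \<noteq> 0"
  shows "irreducible p"
proof (rule irreducibleI)
  show "p \<noteq> 0" using assms(1) by auto
  then show "\<not> is_unit p" using assms(1) by (simp add: is_unit_iff_degree)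
  fix q r assume p: "p = q * r"
  then have nz: "q \<noteq> 0" "r \<noteq> 0" using assms(1) by auto
  then have deg: "degree q + degree r = 2" using assms(1) p by (simp add: degree_mult_eq)
  have no1: "degree s \<noteq> 1" if "s dvd p" for s
  proof
    assume "degree s = 1"
    then obtain a b where s: "s = [:a, b:]" "b \<noteq> 0"
      by (metis degree1_coeffs)
    then have "poly s (- a / b) = 0" by simp
    then have "poly p (- a / b) = 0" using that by (auto elim!: dvdE)
    then show False using assms(2) by blast
  qed
  have "degree q \<noteq> 1" using no1[of q] p by simp
  then have "degree q = 0 \<or> degree r = 0" using deg by linarith
  then show "is_unit q \<or> is_unit r" using nz by (auto simp: is_unit_iff_degree)
qed

lemma irreducible_coprime:
  fixes p q :: "'k::field poly"
  assumes p: "irreducible p" and q: "q \<noteq> 0" "degree q < degree p"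
  shows "coprime p q"
proof (rule coprimeI)
  fix c assume c: "c dvd p" "c dvd q"
  then obtain e where e: "p = c * e" by (auto elim: dvdE)
  then have "is_unit c \<or> is_unit e" using p by (rule irreducibleD[rotated])
  moreover have "\<not> is_unit e"
  proof
    assume "is_unit e"
    moreover have "c \<noteq> 0" "e \<noteq> 0" using e p by auto
    ultimately have "degree p = degree c" using e by (simp add: degree_mult_eq is_unit_iff_degree)
    also have "\<dots> \<le> degree q" using c(2) q(1) by (rule dvd_imp_degree_le)
    finally show False using q(2) by simp
  qed
  ultimately show "is_unit c" by blast
qed

text \<open>Equivalences with quotient spaces are constructed out of the space of representatives,
  where they are given by formulas. This supplies the opposite direction.\<close>

lemma action_equivalence_inverse:
  assumes E: "action_equivalence G V \<alpha> W \<beta> f"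
    and add: "\<And>x y. x \<in> carrier V \<Longrightarrow> y \<in> carrier V \<Longrightarrow> x \<oplus>\<^bsub>V\<^esub> y \<in> carrier V"
    and smult: "\<And>c x. x \<in> carrier V \<Longrightarrow> c \<odot>\<^bsub>V\<^esub> x \<in> carrier V"
    and act: "\<And>g x. g \<in> carrier G \<Longrightarrow> x \<in> carrier V \<Longrightarrow> \<alpha> g x \<in> carrier V"
  shows "action_equivalence G W \<beta> V \<alpha> (the_inv_into (carrier V) f)"
proof -
  let ?h = "the_inv_into (carrier V) f"
  have bij: "bij_betw f (carrier V) (carrier W)"
    and fadd: "\<And>x y. x \<in> carrier V \<Longrightarrow> y \<in> carrier V \<Longrightarrow> f (x \<oplus>\<^bsub>V\<^esub> y) = f x \<oplus>\<^bsub>W\<^esub> f y"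
    and fsmult: "\<And>c x. x \<in> carrier V \<Longrightarrow> f (c \<odot>\<^bsub>V\<^esub> x) = c \<odot>\<^bsub>W\<^esub> f x"
    and fact: "\<And>g x. g \<in> carrier G \<Longrightarrow> x \<in> carrier V \<Longrightarrow> f (\<alpha> g x) = \<beta> g (f x)"
    using E unfolding action_equivalence_def by blast+
  have inj: "inj_on f (carrier V)" and im: "f ` carrier V = carrier W" using bij by (auto simp: bij_betw_def)
  have h: "?h w \<in> carrier V" "f (?h w) = w" if "w \<in> carrier W" for w
    using the_inv_into_into[OF inj, of w "carrier V"] f_the_inv_into_f[OF inj, of w] that im by auto
  have hf: "?h (f x) = x" if "x \<in> carrier V" for x using the_inv_into_f_f[OF inj that] .
  show ?thesis
    unfolding action_equivalence_def
  proof (intro conjI ballI allI)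
    show "group_action G (carrier W) (\<lambda>g. restrict (\<beta> g) (carrier W))"
      "group_action G (carrier V) (\<lambda>g. restrict (\<alpha> g) (carrier V))"
      using E unfolding action_equivalence_def by blast+
    show "bij_betw ?h (carrier W) (carrier V)" by (rule bij_betw_the_inv_into[OF bij])
  next
    fix x y assume xy: "x \<in> carrier W" "y \<in> carrier W"
    show "?h (x \<oplus>\<^bsub>W\<^esub> y) = ?h x \<oplus>\<^bsub>V\<^esub> ?h y"
      using hf[OF add[OF h(1)[OF xy(1)] h(1)[OF xy(2)]]] fadd[OF h(1)[OF xy(1)] h(1)[OF xy(2)]] h(2) xy by simp
  next
    fix c x assume x: "x \<in> carrier W"
    show "?h (c \<odot>\<^bsub>W\<^esub> x) = c \<odot>\<^bsub>V\<^esub> ?h x"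
      using hf[OF smult[OF h(1)[OF x], of c]] fsmult[OF h(1)[OF x], of c] h(2) x by simp
  next
    fix g x assume gx: "g \<in> carrier G" "x \<in> carrier W"
    show "?h (\<beta> g x) = \<alpha> g (?h x)"
      using hf[OF act[OF gx(1) h(1)[OF gx(2)]]] fact[OF gx(1) h(1)[OF gx(2)]] h(2) gx by simp
  qed
qed

context quadratic
begin

section \<open>The separable case\<close>

lemma separable_extI:
  assumes "t \<noteq> 0 \<or> (2 :: 'k) \<noteq> 0"
  shows "separable_ext t d"
  unfolding separable_ext_def
proof
  fix X assume "X \<in> L"
  then obtain x y where X: "X = el x y" by (rule LL_cases)
  show "\<exists>p. irreducible p \<and> poly_at p X = 0 \<and> coprime p (pderiv p)"
  proof (cases "y = 0")
    case True
    have "irreducible [:- x, 1:]"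
    proof (rule irreducibleI)
      fix q r assume p: "[:- x, 1:] = q * r"
      then have nz: "q \<noteq> 0" "r \<noteq> 0" by auto
      have "degree (q * r) = 1" unfolding p[symmetric] by simp
      then show "is_unit q \<or> is_unit r" using nz by (auto simp: degree_mult_eq is_unit_iff_degree)
    qed (auto simp: is_unit_iff_degree)
    moreover have "poly_at [:- x, 1:] X = 0"
      by (simp add: poly_at_pCons X True) (simp add: el_simps)
    moreover have "coprime [:- x, 1:] (pderiv [:- x, 1:])" by (simp add: pderiv_pCons flip: one_pCons)
    ultimately show ?thesis by blast
  next
    case False
    \<comment> \<open>The characteristic polynomial of x + y omega. Its value at u is the norm of (x
      - u) + y omega, so there is no root as y is nonzero.\<close>
    let ?p = "[:x * x + t * x * y + d * y * y, - (2 * x + t * y), 1:]"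
    have "poly ?p u = (x - u) * (x - u) + t * (x - u) * y + d * y * y" for u
      by (simp add: algebra_simps)
    then have "poly ?p u \<noteq> 0" for u using False by (metis norm_form_eq_0)
    then have irr: "irreducible ?p" by (intro irreducible_quadratic) simp_all
    have der: "pderiv ?p = [:- (2 * x + t * y), 2:]" by (simp add: pderiv_pCons)
    have "pderiv ?p \<noteq> 0"
    proof
      assume "pderiv ?p = 0"
      then have two: "(2 :: 'k) = 0" and "- (2 * x + t * y) = 0"
        unfolding der pCons_eq_0_iff by blast+
      then have "t * y = 0" by (simp only: neg_equal_0_iff_equal two mult_zero_left add_0_left)
      then show False using assms False two by simp
    qed
    moreover have "degree (pderiv ?p) < degree ?p" unfolding der by simp
    ultimately have "coprime ?p (pderiv ?p)" by (intro irreducible_coprime[OF irr])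
    moreover have "poly_at ?p X = 0"
      by (simp add: poly_at_pCons X) (simp add: el_simps algebra_simps)
    ultimately show ?thesis using irr by blast
  qed
qed

text \<open>For the converse let t = 0 and 2 = 0. Division by f = X^2 + tX + d leaves a remainder a
  + bX whose value at omega is \<open>el a b\<close>. So an irreducible p annihilating omega is a
  constant multiple of f; its derivative is zero and cannot be coprime to it.\<close>

lemma separable_ext_iff: "separable_ext t d \<longleftrightarrow> t \<noteq> 0 \<or> (2 :: 'k) \<noteq> 0"
proof
  assume sep: "separable_ext t d"
  show "t \<noteq> 0 \<or> (2 :: 'k) \<noteq> 0"
  proof (rule ccontr)
    assume "\<not> ?thesis"
    then have t: "t = 0" and two: "(2 :: 'k) = 0" by auto
    let ?f = "[:d, t, 1:]"
    obtain p where p: "irreducible p" "poly_at p (el 0 1) = 0" "coprime p (pderiv p)"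
      using sep el_in_LL unfolding separable_ext_def by blast
    have f: "poly_at ?f (el 0 1) = 0"
      by (simp add: poly_at_pCons) (simp add: el_simps algebra_simps two_t_mult)
    have "poly_at (p mod ?f) (el 0 1) = 0"
    proof -
      have "poly_at p (el 0 1) = poly_at (p div ?f * ?f + p mod ?f) (el 0 1)" by (simp only: div_mult_mod_eq)
      also have "\<dots> = poly_at (p mod ?f) (el 0 1)" by (simp only: poly_at_add poly_at_mult f) simp
      finally show ?thesis using p(2) by simp
    qed
    moreover obtain a b where r: "p mod ?f = [:a, b:]"
    proof -
      have "degree (p mod ?f) < 2 \<or> p mod ?f = 0" using degree_mod_less[of ?f p] by auto
      then have "degree (p mod ?f) \<le> 1" by auto
      then have "p mod ?f = [:coeff (p mod ?f) 0, coeff (p mod ?f) 1:]"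
        by (intro poly_eqI) (auto simp: coeff_pCons coeff_eq_0 split: nat.splits)
      then show thesis by (rule that)
    qed
    ultimately have "el a b = 0"
      by (simp add: poly_at_pCons) (simp add: el_simps)
    then have "p mod ?f = 0" using r by (simp add: el_simps)
    then obtain q where q: "p = ?f * q" by (metis dvd_eq_mod_eq_0 dvdE)
    moreover have "\<not> is_unit ?f" by (simp add: is_unit_iff_degree)
    ultimately have "is_unit q" using irreducibleD[OF p(1)] by blast
    then obtain c where c: "q = [:c:]" by (auto simp: is_unit_poly_iff)
    have "pderiv p = 0" unfolding q c by (simp add: pderiv_mult pderiv_pCons t two)
    then have "is_unit p" using p(3) by simp
    then show False using p(1) by (simp add: irreducible_def)
  qed
qed (rule separable_extI)

lemma char_not_2_separable: "CHAR('k) \<noteq> 2 \<Longrightarrow> separable_ext t d"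
  using char_2_iff[where 'k = 'k] by (simp add: separable_ext_iff)

subsection \<open>Hermitian matrices\<close>

definition I4 :: "'k mat4" where "I4 = block imat 0 0 imat"

lemma herm_to_quot_eq: "herm_to_quot t d M = M ** I4 +o PL t d"
  by (cases M rule: block_cases) (simp add: herm_to_quot_def I4_def block_simps)

lemma star_block: "star t (block A B C D) = block (lconj t A) (lconj t C) (lconj t B) (lconj t D)"
  by (simp add: star_def)

lemma star_star [simp]: "star t (star t g) = g"
  by (cases g rule: block_cases) (simp add: star_block)

lemma star_one [simp]: "star t (mat 1) = mat 1"
  by (simp add: block_mat star_block)

lemma star_mats_over_L [simp]: "g \<in> mats_over_L t d \<Longrightarrow> star t g \<in> mats_over_L t d"
  by (cases g rule: block_cases) (simp add: star_block block_mats_over_L)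

lemma star_mult:
  assumes "g \<in> mats_over_L t d" "h \<in> mats_over_L t d"
  shows "star t (g ** h) = star t h ** star t g"
proof -
  obtain A B C D where g: "g = block A B C D" "A \<in> L" "B \<in> L" "C \<in> L" "D \<in> L"
    using assms(1) by (auto simp: mats_over_L_def)
  obtain A' B' C' D' where h: "h = block A' B' C' D'" "A' \<in> L" "B' \<in> L" "C' \<in> L" "D' \<in> L"
    using assms(2) by (auto simp: mats_over_L_def)
  show ?thesis
    using g(2-) h(2-) by (simp add: g(1) h(1) block_mult star_block block_eq_iff lconj_mult LL_commute)
qed

lemma det_L_star:
  assumes "g \<in> mats_over_L t d"
  shows "det_L (star t g) = lconj t (det_L g)"
proof -
  obtain A B C D where g: "g = block A B C D" "A \<in> L" "B \<in> L" "C \<in> L" "D \<in> L"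
    using assms by (auto simp: mats_over_L_def)
  show ?thesis
    using g(2-) by (simp add: g(1) det_L_block star_block lconj_mult LL_commute)
qed

lemma I4_transpose: "g \<in> mats_over_L t d \<Longrightarrow> I4 ** transpose g = star t g ** I4"
  by (auto simp: mats_over_L_def I4_def block_simps star_block imat_transpose)

lemma act_I4: "g \<in> mats_over_L t d \<Longrightarrow> act g (M ** I4) = herm_act t g M ** I4"
  using I4_transpose[of g] by (simp add: act_def herm_act_def matrix_mul_assoc[symmetric])

text \<open>Multiplication by diag(i, i) turns hermitian into alternating matrices because -(X i)' =
  i X' = conj(X) i.\<close>

lemma herm_I4:
  "X \<in> L \<Longrightarrow> block (mat a) X (lconj t X) (mat c) ** I4 = alt_mat a (X ** imat) c"
  by (simp add: I4_def block_mult alt_mat_def block_eq_iff matrix_mult_mat matrix_mscale_mult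
      matrix_transpose_mul transpose_imat imat_transpose[symmetric])

lemma Herm_iff: "M \<in> Herm t d \<longleftrightarrow> (\<exists>a X c. M = block (mat a) X (lconj t X) (mat c) \<and> X \<in> L)"
  by (auto simp: Herm_def)

lemma Herm_mats_over_L: "M \<in> Herm t d \<Longrightarrow> M \<in> mats_over_L t d"
  by (auto simp: Herm_def block_mats_over_L)

lemma star_Herm: "M \<in> Herm t d \<Longrightarrow> star t M = M"
  by (auto simp: Herm_def star_block)

text \<open>A fixed x + y omega satisfies t y = 0 and 2 y = 0, and separability allows t or 2 to be
  cancelled.\<close>

lemma lconj_fixed:
  assumes sep: "separable_ext t d" and A: "A \<in> L" "lconj t A = A"
  obtains a where "A = mat a"
proof -
  obtain x y where xy: "A = el x y" using A(1) by (rule LL_cases)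
  then have *: "t * y = 0" "- y = y" using A(2) by (simp_all add: el_simps)
  then have "2 * y = 0" by (metis add.right_inverse mult_2)
  then have "y = 0" using * sep by (auto simp: separable_ext_iff)
  then show thesis using that[of x] by (simp add: xy el_mat)
qed

lemma HermI:
  assumes sep: "separable_ext t d" and M: "M \<in> mats_over_L t d" "star t M = M"
  shows "M \<in> Herm t d"
proof -
  obtain A B C D where g: "M = block A B C D" "A \<in> L" "B \<in> L" "C \<in> L" "D \<in> L"
    using M(1) by (auto simp: mats_over_L_def)
  then have *: "lconj t A = A" "lconj t D = D" "lconj t B = C" using M(2) by (simp_all add: star_block block_eq_iff)
  obtain a c where "A = mat a" "D = mat c" using lconj_fixed[OF sep] g * by metis
  then show ?thesis using g * unfolding Herm_iff by blast
qed

lemma GL2L_mats: "g \<in> GL2L t d \<Longrightarrow> g \<in> mats_over_L t d"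
  by (simp add: GL2L_iff)

lemma herm_act_Herm:
  assumes sep: "separable_ext t d" and "g \<in> mats_over_L t d" "M \<in> Herm t d"
  shows "herm_act t g M \<in> Herm t d"
proof (rule HermI[OF sep])
  have m: "g \<in> mats_over_L t d" "M \<in> mats_over_L t d" "star t g \<in> mats_over_L t d"
    using assms Herm_mats_over_L by simp_all
  then show "herm_act t g M \<in> mats_over_L t d" unfolding herm_act_def by (intro mats_over_L_mult)
  show "star t (herm_act t g M) = herm_act t g M"
    using m by (simp add: herm_act_def star_mult mats_over_L_mult star_Herm assms(3) matrix_mul_assoc)
qed

lemma ksubspace_Herm: "ksubspace (Herm t d)"
proof -
  have m: "mat (a + b) = mat a + (mat b :: 'k mat2)" "mat (r * a) = mscale r (mat a :: 'k mat2)" for a b r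
    by (simp_all add: mat22_simps)
  have z: "0 = block (mat 0) 0 (lconj t 0) (mat 0 :: 'k mat2)"
    by (simp add: block_zero block_eq_iff)
  have "0 \<in> Herm t d" unfolding Herm_iff using z LL_closed(8) by blast
  moreover have "M + N \<in> Herm t d" if M: "M \<in> Herm t d" and N: "N \<in> Herm t d" for M N
  proof -
    obtain a X c b Y e where *: "M = block (mat a) X (lconj t X) (mat c)" "X \<in> L"
      "N = block (mat b) Y (lconj t Y) (mat e)" "Y \<in> L" using M N unfolding Herm_iff by blast
    then have "M + N = block (mat (a + b)) (X + Y) (lconj t (X + Y)) (mat (c + e))" "X + Y \<in> L"
      by (simp_all add: block_add m)
    then show ?thesis unfolding Herm_iff by blast
  qed
  moreover have "mscale r M \<in> Herm t d" if M: "M \<in> Herm t d" for M r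
  proof -
    obtain a X c where *: "M = block (mat a) X (lconj t X) (mat c)" "X \<in> L" using M unfolding Herm_iff by blast
    then have "mscale r M = block (mat (r * a)) (mscale r X) (lconj t (mscale r X)) (mat (r * c))" "mscale r X \<in> L"
      by (simp_all add: block_mscale m)
    then show ?thesis unfolding Herm_iff by blast
  qed
  ultimately show ?thesis unfolding ksubspace_def by blast
qed

lemma acts_on_Herm:
  assumes sep: "separable_ext t d"
  shows "acts_on (GLsub (GL2L t d)) (Herm t d) (herm_act t)"
proof -
  have "herm_act t (mat 1) M = M" for M by (simp add: herm_act_def)
  moreover have "herm_act t (g ** h) M = herm_act t g (herm_act t h M)"
    if "g \<in> GL2L t d" "h \<in> GL2L t d" for g h M
    using that by (simp add: herm_act_def star_mult GL2L_mats matrix_mul_assoc)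
  ultimately show ?thesis
    unfolding acts_on_def using group_GLsub[OF GL2L_subgroup] herm_act_Herm[OF sep] GL2L_mats by simp
qed

lemma acts_on_quot_PL: "acts_on (GLsub (GL2L t d)) (quot Lam (PL t d)) coset_act"
  by (rule acts_on_quot[OF GL2L_subgroup GL2L_stab_PL]) (rule act_Lam)

lemma acts_on_quot_PL_full: "acts_on (GLsub (times_Xi t (GL2L t d))) (quot Lam (PL t d)) coset_act"
  unfolding stab_PL[symmetric] by (rule acts_on_quot[OF stab_subgroup order.refl]) (rule act_Lam)

lemma fP_LL_imat: "fP (el u v ** imat) = vector [2 * d * v + t * u, - (2 * u) - t * v]"
  by (simp add: fP_def el_def imat_def mat22_mult vec2_eq_iff algebra_simps)

text \<open>In other words, L i meets L delta trivially, which makes the hermitian representative of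
  a coset of P unique. From 2t = 0 it follows that 2 = 0 or t = 0, so one half of the terms in
  \<open>fP_LL_imat\<close> disappears and the system decouples; separability makes the other
  coefficient nonzero.\<close>

lemma fP_LL_imat_eq_0:
  assumes sep: "separable_ext t d" and X: "X \<in> L" "fP (X ** imat) = 0"
  shows "X = 0"
proof -
  obtain u v where uv: "X = el u v" using X(1) by (rule LL_cases)
  then have *: "2 * d * v + t * u = 0" "- (2 * u) - t * v = 0"
    using X(2) unfolding uv fP_LL_imat by (simp_all add: vec_eq_iff forall_2)
  have "u = 0 \<and> v = 0"
  proof (cases "(2 :: 'k) = 0")
    case True
    then have "t \<noteq> 0" using sep by (simp add: separable_ext_iff)
    then show ?thesis using * by (simp add: True)
  next
    case False
    then have "t = 0" using two_t by simp
    then show ?thesis using * False d_nonzero by simp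
  qed
  then show ?thesis by (simp add: uv el_zero)
qed

lemma fP_LL_imat_surj:
  assumes sep: "separable_ext t d"
  obtains X where "X \<in> L" "fP (X ** imat) = p"
proof (cases "(2 :: 'k) = 0")
  case True
  then have "t \<noteq> 0" using sep by (simp add: separable_ext_iff)
  then have "fP (el (p$1 / t) (- p$2 / t) ** imat) = p"
    by (simp add: fP_LL_imat True vec_eq_iff forall_2)
  then show thesis using that el_in_LL by blast
next
  case False
  then have t: "t = 0" using two_t by simp
  have "fP (el (- p$2 / 2) (p$1 / (2 * d)) ** imat) = p"
    using False d_nonzero unfolding fP_LL_imat by (simp add: t vec_eq_iff forall_2)
  then show thesis using that el_in_LL by blast
qed

lemma herm_to_quot_inj:
  assumes sep: "separable_ext t d" and "M \<in> Herm t d" "N \<in> Herm t d" "herm_to_quot t d M = herm_to_quot t d N"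
  shows "M = N"
proof -
  obtain a X c where M: "M = block (mat a) X (lconj t X) (mat c)" "X \<in> L" using assms(2) unfolding Herm_iff by blast
  obtain b Y e where N: "N = block (mat b) Y (lconj t Y) (mat e)" "Y \<in> L" using assms(3) unfolding Herm_iff by blast
  have "M ** I4 - N ** I4 \<in> PL t d" using assms(4) by (simp add: herm_to_quot_eq coset_eq_iff[OF ksubspace_PL])
  then have "a - b = 0" "c - e = 0" "fP ((X - Y) ** imat) = 0"
    using M(2) N(2) by (simp_all add: M(1) N(1) herm_I4 alt_mat_linear PL_iff matrix_diff_rdistrib)
  moreover have "X - Y = 0" using fP_LL_imat_eq_0[OF sep _ calculation(3)] M(2) N(2) by simp
  ultimately show ?thesis by (simp add: M N)
qed

lemma herm_to_quot_bij:
  assumes sep: "separable_ext t d"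
  shows "bij_betw (herm_to_quot t d) (Herm t d) (quot Lam (PL t d))"
  unfolding bij_betw_def
proof
  show "inj_on (herm_to_quot t d) (Herm t d)" by (rule inj_onI) (rule herm_to_quot_inj[OF sep])
  show "herm_to_quot t d ` Herm t d = quot Lam (PL t d)"
  proof (rule subset_antisym; rule subsetI)
    fix C assume "C \<in> herm_to_quot t d ` Herm t d"
    then show "C \<in> quot Lam (PL t d)"
      by (auto simp: Herm_iff herm_to_quot_eq herm_I4 intro!: coset_in_quot)
  next
    fix C assume "C \<in> quot Lam (PL t d)"
    then obtain x Y z where C: "C = alt_mat x Y z +o PL t d" by (auto simp: quot_def Lam_iff)
    obtain X where X: "X \<in> L" "fP (X ** imat) = fP Y" by (rule fP_LL_imat_surj[OF sep])
    let ?M = "block (mat x) X (lconj t X) (mat z)"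
    have "C = herm_to_quot t d ?M"
      unfolding C herm_to_quot_eq coset_eq_iff[OF ksubspace_PL] herm_I4[OF X(1)]
      by (simp add: alt_mat_linear PL_iff fP_linear X(2))
    moreover have "?M \<in> Herm t d" unfolding Herm_iff using X(1) by blast
    ultimately show "C \<in> herm_to_quot t d ` Herm t d" by blast
  qed
qed

lemma coset_act_herm_to_quot:
  assumes "g \<in> GL2L t d"
  shows "coset_act g (herm_to_quot t d M) = herm_to_quot t d (herm_act t g M)"
proof -
  have "g \<in> GL4_stab (PL t d)" using assms GL2L_stab_PL by blast
  then show ?thesis
    unfolding herm_to_quot_eq by (simp add: coset_act_coset act_I4[OF GL2L_mats[OF assms]])
qed

lemma herm_action_equivalence:
  assumes sep: "separable_ext t d"
  shows "action_equivalence (GLsub (GL2L t d)) (herm_space t d) (herm_act t)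
    (quot_space Lam (PL t d)) coset_act (herm_to_quot t d)"
  unfolding action_equivalence_def herm_space_def quot_space_def kspace_def
  using acts_on_group_action[OF acts_on_Herm[OF sep]] acts_on_group_action[OF acts_on_quot_PL]
    herm_to_quot_bij[OF sep] coset_act_herm_to_quot
  by (simp add: herm_to_quot_eq matrix_add_rdistrib matrix_mscale_mult coset_add[OF ksubspace_PL] coset_smult[OF ksubspace_PL])

lemma herm_equivalent_actions:
  assumes sep: "separable_ext t d"
  shows "equivalent_actions (GLsub (GL2L t d)) (quot_space Lam (PL t d)) coset_act (herm_space t d) (herm_act t)"
  unfolding equivalent_actions_def
  by (rule exI, rule action_equivalence_inverse[OF herm_action_equivalence[OF sep]])
    (use ksubspace_closed[OF ksubspace_Herm] herm_act_Herm[OF sep] GL2L_mats in \<open>simp_all add: herm_space_def kspace_def\<close>)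

text \<open>The transpose over L. On hermitian matrices it is entrywise conjugation, since the
  diagonal entries are scalars.\<close>

definition herm_bar :: "'k mat4 \<Rightarrow> 'k mat4" where
  "herm_bar M = block (blk11 M) (blk21 M) (blk12 M) (blk22 M)"

text \<open>Each block X i becomes (xi X xi)(xi i xi') = -conj(X) i, because xi is an involution of
  determinant -1.\<close>

lemma Xi_herm_to_quot:
  assumes "M \<in> Herm t d"
  shows "coset_act (Xi t) (herm_to_quot t d M) = herm_to_quot t d (- herm_bar M)" "- herm_bar M \<in> Herm t d"
proof -
  obtain a X c where M: "M = block (mat a) X (lconj t X) (mat c)" "X \<in> L" using assms unfolding Herm_iff by blast
  have m: "- mat r = (mat (- r) :: 'k mat2)" for r by (simp add: mat22_simps)
  have bar: "- herm_bar M = block (mat (- a)) (- lconj t X) (lconj t (- lconj t X)) (mat (- c))"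
    by (simp add: M herm_bar_def block_uminus m)
  then show "- herm_bar M \<in> Herm t d"
    unfolding Herm_iff using M(2) by (intro exI[of _ "- a"] exI[of _ "- lconj t X"] exI[of _ "- c"]) simp
  have "xi t ** (X ** imat) ** transpose (xi t) = xi t ** X ** xi t ** (xi t ** imat ** transpose (xi t))"
  proof -
    have "xi t ** (xi t ** Z) = Z" for Z :: "'k mat2" by (simp add: matrix_mul_assoc xi_xi)
    then show ?thesis by (simp add: matrix_mul_assoc[symmetric])
  qed
  also have "\<dots> = - lconj t X ** imat" by (simp only: xi_imat lconj_eq) simp
  finally have "act (Xi t) (M ** I4) = - herm_bar M ** I4"
    unfolding bar using M(2) herm_I4[of "- lconj t X" "- a" "- c"] by (simp add: M(1) herm_I4 Xi_simps)
  then show "coset_act (Xi t) (herm_to_quot t d M) = herm_to_quot t d (- herm_bar M)"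
    by (simp add: herm_to_quot_eq coset_act_coset[OF Xi_stab_PL])
qed

lemma transported_Xi_diag:
  assumes sep: "separable_ext t d" and M: "M \<in> diag_Herm"
  shows "transported_act t d (Xi t) M = - M"
proof -
  obtain a c where Ma: "M = block (mat a) 0 0 (mat c)" using M by (auto simp: diag_Herm_def)
  then have MH: "M \<in> Herm t d" unfolding Herm_iff by (intro exI[of _ a] exI[of _ 0] exI[of _ c]) simp
  have "herm_bar M = M" by (simp add: Ma herm_bar_def)
  then show ?thesis
    using the_inv_into_f_f[OF bij_betw_imp_inj_on[OF herm_to_quot_bij[OF sep]]] Xi_herm_to_quot[OF MH]
    by (simp add: transported_act_def)
qed

text \<open>The matrix \<open>M\<close> is diagonalized as \<open>S\<^sup>* \<Delta> S\<close> with unitriangular \<open>S\<close>. The unitary group of \<open>\<Delta>\<close>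
  contains \<open>diag(1, \<mu>)\<close> for every \<open>\<mu>\<close> of norm \<open>1\<close>, so determinants can be adjusted by such \<open>\<mu>\<close>.\<close>

lemma norm_group_minus_one_iff:
  assumes M: "M \<in> Herm t d" and an: "anisotropic t d M"
  shows "- mat 1 \<in> norm_group t d M \<longleftrightarrow> (\<exists>g\<in>GL2L t d. herm_act t g M = - herm_bar M)"
proof -
  obtain a X c where Mb: "M = block (mat a) X (lconj t X) (mat c)" and X: "X \<in> L" using M unfolding Herm_iff by blast
  have nz: "herm_form t M v v \<noteq> 0" if "v \<in> L \<times> L" "v \<noteq> (0, 0)" for v
    using an that by (auto simp: anisotropic_def)
  have a: "a \<noteq> 0"
  proof
    assume "a = 0"
    then have "herm_form t M (mat 1, 0) (mat 1, 0) = 0"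
      by (simp add: herm_form_def Mb)
    then show False using nz[of "(mat 1, 0)"] by simp
  qed
  \<comment> \<open>Completing the square: M = S* diag(a, c') S, where S is the shear by Z = X/a and
    c' = c - N(X)/a.\<close>
  define Z where "Z = mscale (1 / a) X"
  define c' where "c' = c - det2 X / a"
  have Z: "Z \<in> L" "mat a ** Z = X" "lconj t Z ** mat a = lconj t X" "lconj t Z ** X = mat (c - c')"
    using X a lconj_mult_self[OF X]
    by (simp_all add: Z_def c'_def matrix_mult_mat matrix_mscale_mult) (simp add: mat22_simps)
  \<comment> \<open>The vector (-Z, 1) is orthogonal to (1, 0), and the form takes the value c' on
    it.\<close>
  have c': "c' \<noteq> 0"
  proof
    assume "c' = 0"
    then have "lconj t Z ** X = mat c" using Z(4) by simp
    then have "herm_form t M (- Z, mat 1) (- Z, mat 1) = 0"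
      using Z(2) lconj_mult_self[OF X] Z(3)
      by (simp add: herm_form_def Mb matrix_mul_assoc[symmetric] Z(2)) 
    then show False using nz[of "(- Z, mat 1)"] Z(1) by simp
  qed
  define S where "S = block (mat 1) Z 0 (mat 1 :: 'k mat2)"
  define S' where "S' = block (mat 1) (- Z) 0 (mat 1 :: 'k mat2)"
  \<comment> \<open>The shear that diagonalizes the conjugate of M. The diagonal form is the same
    since a and c' are fixed by conjugation.\<close>
  define T where "T = block (mat 1) (lconj t Z) 0 (mat 1 :: 'k mat2)"
  define T' where "T' = block (mat 1) (- lconj t Z) 0 (mat 1 :: 'k mat2)"
  define \<Delta> where "\<Delta> = block (mat a) 0 0 (mat c' :: 'k mat2)"
  have inv: "S ** S' = mat 1" "S' ** S = mat 1" "T ** T' = mat 1" "T' ** T = mat 1"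
    by (simp_all add: S_def S'_def T_def T'_def block_simps)
  have mem: "S \<in> mats_over_L t d" "S' \<in> mats_over_L t d" "T \<in> mats_over_L t d" "T' \<in> mats_over_L t d"
    using Z(1) by (simp_all add: S_def S'_def T_def T'_def block_mats_over_L)
  have det: "det_L S = mat 1" "det_L S' = mat 1" "det_L T = mat 1" "det_L T' = mat 1"
    by (simp_all add: S_def S'_def T_def T'_def det_L_block)
  have sinv: "star t S' ** star t S = mat 1" "star t S ** star t S' = mat 1"
    "star t T' ** star t T = mat 1" "star t T ** star t T' = mat 1"
    by (simp_all add: star_mult[symmetric] mem inv)
  have XZ: "lconj t X ** Z = mat (c - c')"
  proof -
    have "lconj t X ** Z = lconj t Z ** mat a ** Z" by (simp only: Z(3))
    also have "\<dots> = lconj t Z ** (mat a ** Z)" by (simp only: matrix_mul_assoc)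
    finally show ?thesis by (simp only: Z(2,4))
  qed
  have ZX: "X ** lconj t Z = mat (c - c')" using Z(4) LL_commute[OF X, of "lconj t Z"] Z(1) by simp
  have aZ: "mat a ** lconj t Z = lconj t X" "Z ** mat a = X"
    using arg_cong[OF Z(2), of "lconj t"] arg_cong[OF Z(3), of "lconj t"] by (simp_all add: lconj_mult)
  have cc: "mat (c - c') + mat c' = (mat c :: 'k mat2)" by (simp add: mat22_simps)
  have Mdiag: "M = star t S ** \<Delta> ** S"
    using XZ Z(2,3) cc by (simp add: Mb S_def \<Delta>_def star_block block_mult block_eq_iff)
  have bar: "herm_bar M = star t T ** \<Delta> ** T"
    using ZX aZ cc by (simp add: Mb herm_bar_def T_def \<Delta>_def star_block block_mult block_eq_iff)
  have \<Delta>: "\<Delta> \<in> mats_over_L t d" "det_L \<Delta> = mat (a * c')"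
    by (simp_all add: \<Delta>_def block_mats_over_L det_L_block mat_hom)
  have MML: "M \<in> mats_over_L t d" using M by (rule Herm_mats_over_L)
  show ?thesis
  proof
    assume "- mat 1 \<in> norm_group t d M"
    then obtain A where "A \<in> quaternions t d M" and det_A: "- mat 1 = det_L A"
      unfolding norm_group_def by blast
    then have A: "A \<in> mats_over_L t d" "star t A ** M ** A = M ** block (- mat 1) 0 0 (- mat 1)" "det_L A = - mat 1"
      by (simp_all add: quaternions_def det_A)
    have "block (- mat 1) 0 0 (- mat 1) = - (mat 1 :: 'k mat4)" by (simp add: block_simps)
    then have AM: "star t A ** M ** A = - M" using A(2,3) by simp
    \<comment> \<open>A* takes M to -M, then S'* takes -M to the negative of the diagonal form, and
      T* takes this to minus the conjugate of M.\<close>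
    define g where "g = star t T ** star t S' ** star t A"
    have g: "g \<in> mats_over_L t d" unfolding g_def by (intro mats_over_L_mult star_mats_over_L mem A)
    have sg: "star t g = A ** S' ** T"
      unfolding g_def using mem A by (simp add: star_mult mats_over_L_mult matrix_mul_assoc)
    have "herm_act t g M = star t T ** star t S' ** (star t A ** M ** A) ** S' ** T"
      by (simp add: herm_act_def sg) (simp add: g_def matrix_mul_assoc)
    also have "\<dots> = - (star t T ** ((star t S' ** star t S) ** \<Delta> ** (S ** S')) ** T)"
      by (simp add: AM) (simp add: Mdiag matrix_mul_assoc)
    also have "\<dots> = - herm_bar M" by (simp add: sinv inv bar)
    finally have "herm_act t g M = - herm_bar M" .
    moreover have "g \<in> GL2L t d"
    proof -
      have "det_L g = - mat 1"
        unfolding g_def using mem A det by (simp add: det_L_mult mats_over_L_mult det_L_star)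
      then show ?thesis using g by (simp add: GL2L_iff)
    qed
    ultimately show "\<exists>g\<in>GL2L t d. herm_act t g M = - herm_bar M" by blast
  next
    assume "\<exists>g\<in>GL2L t d. herm_act t g M = - herm_bar M"
    then obtain g where g: "g \<in> mats_over_L t d" "herm_act t g M = - herm_bar M" using GL2L_mats by blast
    \<comment> \<open>The same detour backwards: h takes M to -M, but its determinant is not yet
      under control.\<close>
    define h where "h = star t S ** star t T' ** g"
    have h: "h \<in> mats_over_L t d" unfolding h_def by (intro mats_over_L_mult star_mats_over_L mem g)
    have sh: "star t h = star t g ** T' ** S"
      unfolding h_def using mem g by (simp add: star_mult mats_over_L_mult matrix_mul_assoc)
    have "h ** M ** star t h = star t S ** star t T' ** herm_act t g M ** T' ** S"
      unfolding sh herm_act_def by (simp add: h_def matrix_mul_assoc)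
    also have "\<dots> = - (star t S ** ((star t T' ** star t T) ** \<Delta> ** (T ** T')) ** S)"
      by (simp add: g(2)) (simp add: bar matrix_mul_assoc)
    also have "\<dots> = - M" by (simp add: sinv inv Mdiag)
    finally have hM: "h ** M ** star t h = - M" .
    have dM: "det_L M = mat (a * c')"
      using mem det \<Delta> by (simp add: Mdiag det_L_mult mats_over_L_mult det_L_star)
    \<comment> \<open>M and -M have the same 2x2 determinant, which is nonzero, so det h and hence
      \<mu> have norm 1. Consequently diag(1, \<mu>) preserves the diagonal form.\<close>
    define \<mu> where "\<mu> = - det_L h"
    have \<mu>: "\<mu> \<in> L" using h by (simp add: \<mu>_def det_L_in_LL)
    have "det_L (h ** M ** star t h) = det_L M"
      unfolding hM by (cases M rule: block_cases) (simp add: block_uminus det_L_block)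
    then have "det_L h ** mat (a * c') ** lconj t (det_L h) = mat (a * c')"
      using h MML by (simp add: det_L_mult mats_over_L_mult det_L_star dM)
    then have "mat (a * c') ** (lconj t \<mu> ** \<mu>) = mat (a * c')"
      using \<mu> by (simp add: \<mu>_def LL_ac h det_L_in_LL)
    then have "det2 \<mu> = 1"
      using a c' by (simp add: lconj_mult_self[OF \<mu>]) (simp add: mat22_simps)
    then have \<mu>1: "lconj t \<mu> ** \<mu> = mat 1" by (simp add: lconj_mult_self[OF \<mu>])
    define \<Lambda> where "\<Lambda> = block (mat 1) 0 0 \<mu>"
    have \<Lambda>: "\<Lambda> \<in> mats_over_L t d" "det_L \<Lambda> = \<mu>"
      using \<mu> by (simp_all add: \<Lambda>_def block_mats_over_L det_L_block)
    have "lconj t \<mu> ** mat c' ** \<mu> = mat c'"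
      using \<mu>1 by (simp add: matrix_mult_mat matrix_mscale_mult) (simp add: mat22_simps)
    then have \<Lambda>\<Delta>: "star t \<Lambda> ** \<Delta> ** \<Lambda> = \<Delta>"
      by (simp add: \<Lambda>_def \<Delta>_def star_block block_mult block_eq_iff)
    \<comment> \<open>The isometry S' diag(1, \<mu>) S of M corrects the determinant of h*: conj(det
      h) \<mu> = -conj(\<mu>) \<mu> = -1.\<close>
    define A where "A = star t h ** S' ** \<Lambda> ** S"
    have A: "A \<in> mats_over_L t d" unfolding A_def by (intro mats_over_L_mult star_mats_over_L mem h \<Lambda>)
    have sA: "star t A = star t S ** star t \<Lambda> ** star t S' ** h"
      unfolding A_def using mem h \<Lambda> by (simp add: star_mult mats_over_L_mult matrix_mul_assoc)
    have "star t A ** M ** A = star t S ** star t \<Lambda> ** star t S' ** (h ** M ** star t h) ** S' ** \<Lambda> ** S"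
      unfolding sA by (simp add: A_def matrix_mul_assoc)
    also have "\<dots> = - (star t S ** (star t \<Lambda> ** ((star t S' ** star t S) ** \<Delta> ** (S ** S')) ** \<Lambda>) ** S)"
      by (simp add: hM) (simp add: Mdiag matrix_mul_assoc)
    also have "\<dots> = - M" by (simp add: sinv inv Mdiag \<Lambda>\<Delta>)
    finally have AM: "star t A ** M ** A = - M" .
    have "det_L A = lconj t (det_L h) ** \<mu>"
      unfolding A_def using mem h \<Lambda> det by (simp add: det_L_mult mats_over_L_mult det_L_star)
    also have "\<dots> = - (lconj t \<mu> ** \<mu>)" by (simp add: \<mu>_def)
    finally have dA: "det_L A = - mat 1" by (simp add: \<mu>1)
    have "block (- mat 1) 0 0 (- mat 1) = - (mat 1 :: 'k mat4)" by (simp add: block_simps)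
    then have "A \<in> quaternions t d M" using A AM dA by (simp add: quaternions_def)
    moreover have "A \<noteq> 0"
    proof
      assume "A = 0"
      then have "det_L A = 0" by (simp add: block_zero det_L_block)
      then show False using dA by simp
    qed
    ultimately show "- mat 1 \<in> norm_group t d M" unfolding norm_group_def using dA by (metis Diff_iff image_eqI singletonD)
  qed
qed

text \<open>The large orbit is the union of the GL_2(L)-orbits of the coset of M and of its image
  under Xi, which belongs to minus the conjugate of M. It splits if and only if these two orbits
  differ, and \<open>norm_group_minus_one_iff\<close> decides this.\<close>

lemma orbit_splits_iff:
  assumes sep: "separable_ext t d" and M: "M \<in> Herm t d" "anisotropic t d M"
    and \<Omega>: "\<Omega> \<in> orbits (GLsub (times_Xi t (GL2L t d))) (quot Lam (PL t d)) coset_act" "herm_to_quot t d M \<in> \<Omega>"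
  shows "(\<exists>\<Omega>\<^sub>1 \<in> orbits (GLsub (GL2L t d)) (quot Lam (PL t d)) coset_act.
            \<exists>\<Omega>\<^sub>2 \<in> orbits (GLsub (GL2L t d)) (quot Lam (PL t d)) coset_act.
              \<Omega>\<^sub>1 \<noteq> \<Omega>\<^sub>2 \<and> \<Omega> = \<Omega>\<^sub>1 \<union> \<Omega>\<^sub>2) \<longleftrightarrow> - mat 1 \<notin> norm_group t d M"
    (is "?split \<longleftrightarrow> _")
proof -
  let ?Q = "quot Lam (PL t d)"
  define Orb where "Orb q = orbit (GLsub (GL2L t d)) coset_act q" for q :: "'k mat4 set"
  let ?q = "herm_to_quot t d M" and ?q' = "herm_to_quot t d (- herm_bar M)"
  have Q: "herm_to_quot t d N \<in> ?Q" if "N \<in> Herm t d" for N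
    using bij_betwE[OF herm_to_quot_bij[OF sep]] that by blast
  have q: "?q \<in> ?Q" "?q' \<in> ?Q" using Q M(1) Xi_herm_to_quot(2)[OF M(1)] by auto
  have mem: "y \<in> Orb x \<longleftrightarrow> y \<in> ?Q \<and> Orb x = Orb y" if "x \<in> ?Q" for x y
    unfolding Orb_def using acts_on_mem_orbit[OF acts_on_quot_PL that] .
  have "\<Omega> = orbit (GLsub (times_Xi t (GL2L t d))) coset_act ?q"
    using \<Omega> acts_on_mem_orbit[OF acts_on_quot_PL_full] by (auto simp: orbits_def)
  also have "\<dots> = Orb ?q \<union> Orb ?q'"
  proof -
    have "coset_act (N ** Xi t) ?q = coset_act N ?q'" for N
      by (simp add: Xi_herm_to_quot(1)[OF M(1), symmetric] coset_act_def image_image act_mult)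
    then show ?thesis unfolding Orb_def orbit_def GLsub_simps times_Xi_iff by fastforce
  qed
  finally have \<Omega>_eq: "\<Omega> = Orb ?q \<union> Orb ?q'" .
  have orb: "\<Omega>' \<in> orbits (GLsub (GL2L t d)) ?Q coset_act \<longleftrightarrow> (\<exists>x\<in>?Q. \<Omega>' = Orb x)" for \<Omega>'
    unfolding orbits_def Orb_def by blast
  have "Orb ?q = Orb ?q' \<longleftrightarrow> (\<exists>g\<in>GL2L t d. coset_act g ?q = ?q')"
    unfolding Orb_def using acts_on_orbit_eq_iff[OF acts_on_quot_PL q] by simp
  also have "\<dots> \<longleftrightarrow> (\<exists>g\<in>GL2L t d. herm_act t g M = - herm_bar M)"
  proof -
    have "coset_act g ?q = ?q' \<longleftrightarrow> herm_act t g M = - herm_bar M" if g: "g \<in> GL2L t d" for g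
      unfolding coset_act_herm_to_quot[OF g]
      using herm_to_quot_inj[OF sep herm_act_Herm[OF sep GL2L_mats[OF g] M(1)] Xi_herm_to_quot(2)[OF M(1)]] by auto
    then show ?thesis by blast
  qed
  finally have eq_iff: "Orb ?q = Orb ?q' \<longleftrightarrow> - mat 1 \<in> norm_group t d M"
    using norm_group_minus_one_iff[OF M] by simp
  show ?thesis
  proof
    assume ?split
    then obtain A B where AB: "A \<in> orbits (GLsub (GL2L t d)) ?Q coset_act" "B \<in> orbits (GLsub (GL2L t d)) ?Q coset_act"
      "A \<noteq> B" "\<Omega> = A \<union> B" by (elim bexE conjE)
    obtain x y where "x \<in> ?Q" "A = Orb x" "y \<in> ?Q" "B = Orb y" using AB(1,2) unfolding orb by blast
    then have xy: "x \<in> ?Q" "y \<in> ?Q" "Orb x \<noteq> Orb y" "\<Omega> = Orb x \<union> Orb y" using AB(3,4) by simp_all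
    have "x \<in> Orb x" "y \<in> Orb y" using mem xy by blast+
    then have "x \<in> Orb ?q \<union> Orb ?q'" "y \<in> Orb ?q \<union> Orb ?q'" using xy(4) \<Omega>_eq by blast+
    then have "Orb ?q \<noteq> Orb ?q'" using xy(3) mem[OF q(1)] mem[OF q(2)] by blast
    then show "- mat 1 \<notin> norm_group t d M" using eq_iff by blast
  next
    assume "- mat 1 \<notin> norm_group t d M"
    then have "Orb ?q \<noteq> Orb ?q'" using eq_iff by simp
    moreover have "Orb ?q \<in> orbits (GLsub (GL2L t d)) ?Q coset_act" "Orb ?q' \<in> orbits (GLsub (GL2L t d)) ?Q coset_act"
      unfolding orb using q by blast+
    ultimately show ?split using \<Omega>_eq by (intro bexI[of _ "Orb ?q"] bexI[of _ "Orb ?q'"] conjI)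
  qed
qed

end

lemma invertible_mat2_iff: "invertible N \<longleftrightarrow> det2 N \<noteq> 0" for N :: "'k::field mat2"
proof
  assume "invertible N"
  then obtain M where "N ** M = mat 1" by (auto simp: invertible_def)
  then have "det2 N * det2 M = 1" by (metis det2_mult det2_simps(1) mult_1)
  then show "det2 N \<noteq> 0" by auto
next
  assume n: "det2 N \<noteq> 0"
  obtain a b c e where N: "N = mat22 a b c e" by (rule mat22_cases)
  have "N ** mat22 e (- b) (- c) a = mat (det2 N)"
    by (simp add: N mat22_mult mat22_mat mat22_eq_iff algebra_simps)
  then have "N ** mscale (1 / det2 N) (mat22 e (- b) (- c) a) = mat 1"
    using n by (simp add: matrix_mscale_mult) (simp add: mat22_mat mat22_mscale)
  then show "invertible N" by (auto simp: invertible_def matrix_left_right_inverse)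
qed

lemma diff_mult_vec: "(A - B) *v x = A *v x - B *v x" for A B :: "'k::field^'n^'m"
  by (simp add: vec_eq_iff matrix_vector_mult_def sum_subtractf algebra_simps)

context quadratic
begin

lemma LL_mult_vec_eq_0:
  assumes "A \<in> L" "A *v u = 0" "u \<noteq> 0"
  shows "A = 0"
proof (rule ccontr)
  assume "A \<noteq> 0"
  then obtain B where "B ** A = mat 1" using LL_inverse[OF assms(1)] by metis
  then show False using inverse_mult_vec_eq_0[OF _ assms(2)] assms(3) by blast
qed

lemma fQ_transpose: "fQ (transpose Y) = fQ Y"
  by (simp add: fQ_def transpose_def add.commute)

lemma fQ_LL_imat_transpose: "A \<in> L \<Longrightarrow> B \<in> L \<Longrightarrow> fQ (A ** imat ** transpose B) = 0"
  unfolding fQ_eq_0_iff using imat_transpose[of B] by (auto simp: matrix_mul_assoc[symmetric] intro!: bexI[of _ "A ** lconj t B"])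

lemma fQ_imat: "fQ imat = 0"
  by (simp add: fQ_def imat_def vec_eq_iff forall_2)

text \<open>The terms containing i lie in L i, transposing Y does not change \<open>fQ Y\<close>,
  and factors from L on either side act on the vector in the same way. So GL_2(L) acts on the
  quotient by P_perp through its L-determinant.\<close>

lemma fQ_act:
  assumes "A \<in> L" "B \<in> L" "C \<in> L" "D \<in> L"
  shows "fQ (mscale x (A ** imat ** transpose C) + A ** Y ** transpose D
         - B ** transpose Y ** transpose C + mscale z (B ** imat ** transpose D)) = (A ** D - B ** C) *v fQ Y"
proof -
  have "A ** D *v fQ Y = D *v (A *v fQ Y)" "B ** C *v fQ Y = C *v (B *v fQ Y)"
    using assms by (simp_all add: matrix_vector_mul_assoc LL_commute)
  then show ?thesis
    using assms by (simp add: fQ_linear fQ_imat fQ_LL_mult_transpose fQ_LL_mult fQ_transpose diff_mult_vec)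
qed

end

section \<open>The inseparable case\<close>

locale inseparable = quadratic t d for t d :: "'k::field" +
  assumes insep: "\<not> separable_ext t d"
begin

lemma t0: "t = 0" and two0: "(2 :: 'k) = 0"
  using insep by (auto simp: separable_ext_iff)

lemmas two_simps = two_eq_0_simps[OF two0]

lemma two_mult [simp]: "2 * x = (0 :: 'k)" "x * 2 = (0 :: 'k)"
  by (simp_all add: two0)

lemma t_mult [simp]: "t * x = 0" "x * t = 0"
  by (simp_all add: t0)

lemma lconj_LL: "X \<in> L \<Longrightarrow> lconj t X = X"
  by (auto simp: LL_iff el_lconj el_eq_iff two_simps)

lemma LL_square: "A \<in> L \<Longrightarrow> A ** A = mat (det2 A)"
  using lconj_mult_self[of A] by (simp add: lconj_LL)

lemma square_eq: "A \<in> L \<Longrightarrow> square A = det2 A"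
  by (simp add: square_def LL_square)

text \<open>With trivial conjugation the norm is squaring, and squaring is additive in
  characteristic 2.\<close>

lemma det2_LL_add: "A \<in> L \<Longrightarrow> B \<in> L \<Longrightarrow> det2 (A + B) = det2 A + det2 B"
  by (auto simp: LL_iff) (simp add: el_simps algebra_simps)

lemma Lsq_eq: "Lsq t d = det2 ` L"
  unfolding Lsq_def by (auto simp: LL_square mat22_mat mat22_eq_iff)

lemma Lsq_closed:
  "0 \<in> Lsq t d" "1 \<in> Lsq t d" "a \<in> Lsq t d \<Longrightarrow> b \<in> Lsq t d \<Longrightarrow> a + b \<in> Lsq t d"
  "a \<in> Lsq t d \<Longrightarrow> b \<in> Lsq t d \<Longrightarrow> a * b \<in> Lsq t d" "a \<in> Lsq t d \<Longrightarrow> - a \<in> Lsq t d"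
  "a \<in> Lsq t d \<Longrightarrow> a \<noteq> 0 \<Longrightarrow> 1 / a \<in> Lsq t d"
proof -
  have "det2 0 \<in> det2 ` L" by (intro imageI) simp
  then show "0 \<in> Lsq t d" by (simp add: Lsq_eq)
  have "det2 (mat 1) \<in> det2 ` L" by (intro imageI) simp
  then show "1 \<in> Lsq t d" by (simp add: Lsq_eq)
  show "a \<in> Lsq t d \<Longrightarrow> - a \<in> Lsq t d" by (simp add: two_simps)
  show "a \<in> Lsq t d \<Longrightarrow> b \<in> Lsq t d \<Longrightarrow> a + b \<in> Lsq t d"
    unfolding Lsq_eq by (auto simp: det2_LL_add[symmetric])
  show "a \<in> Lsq t d \<Longrightarrow> b \<in> Lsq t d \<Longrightarrow> a * b \<in> Lsq t d"
    unfolding Lsq_eq by (auto simp: det2_mult[symmetric])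
  assume "a \<in> Lsq t d" "a \<noteq> 0"
  then obtain A where A: "A \<in> L" "a = det2 A" by (auto simp: Lsq_eq)
  then have "A \<noteq> 0" using \<open>a \<noteq> 0\<close> by auto
  then obtain B where B: "B \<in> L" "A ** B = mat 1" using LL_inverse A(1) by metis
  then have "a * det2 B = 1" by (simp add: A(2) det2_mult[symmetric])
  then have "1 / a = det2 B" using \<open>a \<noteq> 0\<close> by (simp add: field_simps)
  then show "1 / a \<in> Lsq t d" using B(1) by (auto simp: Lsq_eq)
qed

lemma squares_mat_block:
  "block A B C D \<in> mats_over_L t d \<Longrightarrow> squares_mat (block A B C D) = mat22 (det2 A) (det2 B) (det2 C) (det2 D)"
  by (simp add: squares_mat_def block_mats_over_L square_eq)

lemma squares_mat_mult:
  assumes "g \<in> mats_over_L t d" "h \<in> mats_over_L t d"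
  shows "squares_mat (g ** h) = squares_mat g ** squares_mat h"
proof -
  obtain A B C D where g: "g = block A B C D" by (rule block_cases)
  obtain A' B' C' D' where h: "h = block A' B' C' D'" by (rule block_cases)
  show ?thesis
    using assms mats_over_L_mult[OF assms]
    by (simp add: g h block_mult squares_mat_block block_mats_over_L mat22_mult det2_LL_add det2_mult)
qed

lemma squares_mat_one: "squares_mat (mat 1) = (mat 1 :: 'k mat2)"
proof -
  have "squares_mat (block (mat 1) 0 0 (mat 1)) = mat22 1 0 0 (1 :: 'k)"
    by (subst squares_mat_block) (simp_all add: block_mats_over_L)
  then show ?thesis by (simp add: block_mat mat22_mat)
qed

lemma det2_squares_mat:
  assumes "g \<in> mats_over_L t d"
  shows "det2 (squares_mat g) = det2 (det_L g)"
proof -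
  obtain A B C D where g: "g = block A B C D" by (rule block_cases)
  have L: "A \<in> L" "B \<in> L" "C \<in> L" "D \<in> L" using assms by (simp_all add: g block_mats_over_L)
  have "det2 (A ** D - B ** C) = det2 (A ** D + (- (B ** C)))" by simp
  also have "\<dots> = det2 (A ** D) + det2 (- (B ** C))" using L by (intro det2_LL_add) auto
  finally show ?thesis
    using assms by (simp add: g squares_mat_block det_L_block det2_mult two_simps)
qed

text \<open>Each entry of N is a square, so a block matrix of square roots exists. The determinant
  of the matrix of squares is the square of the L-determinant, so invertibility passes in both
  directions.\<close>

lemma squares_mat_image: "squares_mat ` GL2L t d = GL2Lsq t d"
proof (rule subset_antisym; rule subsetI)
  fix N assume "N \<in> squares_mat ` GL2L t d"
  then obtain g where g: "g \<in> GL2L t d" "N = squares_mat g" by blast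
  obtain A B C D where gb: "g = block A B C D" by (rule block_cases)
  have m: "block A B C D \<in> mats_over_L t d" using g(1) by (simp add: GL2L_iff gb)
  have "det2 N \<noteq> 0"
    using g det2_squares_mat[of g] det2_eq_0_iff[of "det_L g"] by (simp add: GL2L_iff det_L_in_LL)
  moreover have "N $ p $ q \<in> Lsq t d" for p q
    using m exhaust_2[of p] exhaust_2[of q] unfolding g(2) gb squares_mat_block[OF m]
    by (auto simp: block_mats_over_L Lsq_eq)
  ultimately show "N \<in> GL2Lsq t d" by (simp add: GL2Lsq_def invertible_mat2_iff)
next
  fix N assume N: "N \<in> GL2Lsq t d"
  then have F: "N $ p $ q \<in> det2 ` L" for p q by (simp add: GL2Lsq_def Lsq_eq)
  obtain A where A: "A \<in> L" "N $ 1 $ 1 = det2 A" using F by blast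
  obtain B where B: "B \<in> L" "N $ 1 $ 2 = det2 B" using F by blast
  obtain C where C: "C \<in> L" "N $ 2 $ 1 = det2 C" using F by blast
  obtain D where D: "D \<in> L" "N $ 2 $ 2 = det2 D" using F by blast
  let ?g = "block A B C D"
  have g: "?g \<in> mats_over_L t d" using A B C D by (simp add: block_mats_over_L)
  have Ng: "N = squares_mat ?g"
    unfolding squares_mat_block[OF g] by (simp add: vec_eq_iff forall_2 A B C D)
  have "det2 (det_L ?g) \<noteq> 0"
    using N unfolding det2_squares_mat[OF g, symmetric] Ng[symmetric] by (simp add: GL2Lsq_def invertible_mat2_iff)
  then have "?g \<in> GL2L t d" using g by (auto simp: GL2L_iff)
  then show "N \<in> squares_mat ` GL2L t d" using Ng by blast
qed

lemma GL2Lsq_subgroup: "subgroup (GL2Lsq t d) GL"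
  unfolding squares_mat_image[symmetric]
proof (rule subgroup_GLI)
  fix M assume "M \<in> squares_mat ` GL2L t d"
  then obtain g where g: "g \<in> GL2L t d" "M = squares_mat g" by blast
  obtain h where h: "h \<in> GL2L t d" "g ** h = mat 1" using GL2L_inverse[OF g(1)] by blast
  have "M ** squares_mat h = mat 1"
    using squares_mat_mult[of g h] g h by (simp add: GL2L_mats squares_mat_one)
  then show "\<exists>N\<in>squares_mat ` GL2L t d. M ** N = mat 1" using h(1) by blast
next
  have "mat 1 \<in> GL2L t d" using subgroup.one_closed[OF GL2L_subgroup] by simp
  then show "mat 1 \<in> squares_mat ` GL2L t d" using squares_mat_one by (metis image_eqI)
next
  fix M N assume "M \<in> squares_mat ` GL2L t d" "N \<in> squares_mat ` GL2L t d"
  then obtain g h where gh: "g \<in> GL2L t d" "M = squares_mat g" "h \<in> GL2L t d" "N = squares_mat h" by blast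
  then have "M ** N = squares_mat (g ** h)" by (simp add: squares_mat_mult GL2L_mats)
  moreover have "g ** h \<in> GL2L t d" using subgroup.m_closed[OF GL2L_subgroup gh(1,3)] by simp
  ultimately show "M ** N \<in> squares_mat ` GL2L t d" by blast
qed

text \<open>Signs and t disappear, whence L delta = L i. So P lies in P_perp, and the quotient by P
  has P_perp/P as an invariant subspace.\<close>

lemma fP_eq_fQ: "fP Y = fQ Y"
  using two_simps(2) by (simp add: fP_def fQ_def vec_eq_iff forall_2 add.commute flip: add_uminus_conv_diff)

lemma PL_subset_perp: "PL t d \<subseteq> perp (PL t d)"
  using PL_subset_Lam by (auto simp: Lam_iff PL_iff perp_PL_iff fP_eq_fQ dest!: subsetD)

lemma GL2L_stab_perp: "GL2L t d \<subseteq> GL4_stab (perp (PL t d))"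
  using GL2L_stab_PL stab_PL_subset_stab_perp by blast

subsection \<open>The action on \<open>P\<^sup>\<bottom>/P\<close>\<close>

lemma acts_on_quot_perp_PL: "acts_on (GLsub (GL2L t d)) (quot (perp (PL t d)) (PL t d)) coset_act"
  by (rule acts_on_quot[OF GL2L_subgroup GL2L_stab_PL]) (use GL2L_stab_perp stab_act in blast)

lemma acts_on_squares: "acts_on (GLsub (GL2L t d)) (UNIV :: ('k^2) set) (\<lambda>g v. squares_mat g *v v)"
  unfolding acts_on_def using group_GLsub[OF GL2L_subgroup]
  by (simp add: squares_mat_one squares_mat_mult GL2L_mats matrix_vector_mul_assoc)

text \<open>Coordinates on P_perp/P: the upper right block of an element of P_perp is absorbed by P,
  so the two diagonal coefficients remain.\<close>

definition vec_coset :: "'k^2 \<Rightarrow> 'k mat4 set" where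
  "vec_coset v = alt_mat (v$1) 0 (v$2) +o PL t d"

lemma vec_coset_act:
  assumes g: "g \<in> GL2L t d"
  shows "vec_coset (squares_mat g *v v) = coset_act g (vec_coset v)"
proof -
  obtain A B C D where gb: "g = block A B C D" by (rule block_cases)
  have m: "block A B C D \<in> mats_over_L t d" using g by (simp add: GL2L_iff gb)
  then have L: "A \<in> L" "B \<in> L" "C \<in> L" "D \<in> L" by (simp_all add: block_mats_over_L)
  have "squares_mat g *v v = vector [det2 A * v$1 + det2 B * v$2, det2 C * v$1 + det2 D * v$2]"
    unfolding gb squares_mat_block[OF m] by (rule mat22_mult_vec)
  moreover have "coset_act g (vec_coset v) = act g (alt_mat (v$1) 0 (v$2)) +o PL t d"
    unfolding vec_coset_def using g GL2L_stab_PL by (intro coset_act_coset) blast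
  ultimately show ?thesis
    using L by (simp add: vec_coset_def coset_eq_iff[OF ksubspace_PL] gb act_alt_mat alt_mat_linear PL_iff
        fP_eq_fQ fQ_linear fQ_LL_imat_transpose)
qed

lemma vec_coset_bij: "bij_betw vec_coset UNIV (quot (perp (PL t d)) (PL t d))"
  unfolding bij_betw_def
proof
  show "inj vec_coset"
    by (rule injI) (simp add: vec_coset_def coset_eq_iff[OF ksubspace_PL] alt_mat_linear PL_iff vec_eq_iff forall_2)
  show "range vec_coset = quot (perp (PL t d)) (PL t d)"
  proof (rule subset_antisym; rule subsetI)
    fix C assume "C \<in> range vec_coset"
    then show "C \<in> quot (perp (PL t d)) (PL t d)"
      by (auto simp: vec_coset_def perp_PL_iff fQ_linear intro!: coset_in_quot)
  next
    fix C assume "C \<in> quot (perp (PL t d)) (PL t d)"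
    then obtain X where X: "X \<in> perp (PL t d)" "C = X +o PL t d" by (rule quot_cases)
    then obtain x Y z where Xb: "X = alt_mat x Y z" by (auto simp: perp_def Lam_iff)
    then have "fQ Y = 0" using X(1) by (simp add: perp_PL_iff)
    then have "C = vec_coset (vector [x, z])"
      by (simp add: X(2) Xb vec_coset_def coset_eq_iff[OF ksubspace_PL] alt_mat_linear PL_iff fP_eq_fQ)
    then show "C \<in> range vec_coset" by blast
  qed
qed

lemma perp_quot_equivalent_actions:
  "equivalent_actions (GLsub (GL2L t d)) (quot_space (perp (PL t d)) (PL t d)) coset_act
     vec_space (\<lambda>g v. squares_mat g *v v)"
proof -
  have "action_equivalence (GLsub (GL2L t d)) vec_space (\<lambda>g v. squares_mat g *v v)
      (quot_space (perp (PL t d)) (PL t d)) coset_act vec_coset"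
    unfolding action_equivalence_def vec_space_def quot_space_def kspace_def
    using acts_on_group_action[OF acts_on_squares] acts_on_group_action[OF acts_on_quot_perp_PL]
      vec_coset_bij vec_coset_act
    by (simp add: coset_add[OF ksubspace_PL] coset_smult[OF ksubspace_PL] vec_coset_def alt_mat_linear)
  then have "action_equivalence (GLsub (GL2L t d)) (quot_space (perp (PL t d)) (PL t d)) coset_act
      vec_space (\<lambda>g v. squares_mat g *v v) (the_inv_into (carrier (vec_space :: ('k, 'k^2) module)) vec_coset)"
    by (rule action_equivalence_inverse) (simp_all add: vec_space_def kspace_def)
  then show ?thesis unfolding equivalent_actions_def by blast
qed

lemma GL2Lsq_iff: "mat22 a b c e \<in> GL2Lsq t d \<longleftrightarrow> a \<in> Lsq t d \<and> b \<in> Lsq t d \<and> c \<in> Lsq t d \<and> e \<in> Lsq t d \<and> a * e - b * c \<noteq> 0"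
  by (auto simp: GL2Lsq_def invertible_mat2_iff forall_2)

definition spanF :: "'k^2 \<Rightarrow> 'k set" where
  "spanF v = {a * v$1 + b * v$2 | a b. a \<in> Lsq t d \<and> b \<in> Lsq t d}"

definition indepF :: "'k^2 \<Rightarrow> bool" where
  "indepF v \<longleftrightarrow> (\<forall>a\<in>Lsq t d. \<forall>b\<in>Lsq t d. a * v$1 + b * v$2 = 0 \<longrightarrow> a = 0 \<and> b = 0)"

lemma ordered_bases2_iff: "v \<in> ordered_bases2 (Lsq t d) U \<longleftrightarrow> U = spanF v \<and> indepF v"
  by (simp add: ordered_bases2_def ordered_basis2_def spanF_def indepF_def)

lemma two_dim_subspaces_iff: "U \<in> two_dim_subspaces (Lsq t d) \<longleftrightarrow> (\<exists>v. U = spanF v \<and> indepF v)"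
proof
  assume "U \<in> two_dim_subspaces (Lsq t d)"
  then obtain x z where "ordered_basis2 (Lsq t d) U x z" by (auto simp: two_dim_subspaces_def)
  then have "vector [x, z] \<in> ordered_bases2 (Lsq t d) U" by (simp add: ordered_bases2_def)
  then show "\<exists>v. U = spanF v \<and> indepF v" unfolding ordered_bases2_iff by blast
next
  assume "\<exists>v. U = spanF v \<and> indepF v"
  then show "U \<in> two_dim_subspaces (Lsq t d)"
    unfolding ordered_bases2_iff[symmetric] by (auto simp: two_dim_subspaces_def ordered_bases2_def)
qed

lemma spanF_mult_subset:
  assumes "N \<in> GL2Lsq t d"
  shows "spanF (N *v v) \<subseteq> spanF v"
proof
  obtain a b c e where N: "N = mat22 a b c e" by (rule mat22_cases)
  have F: "a \<in> Lsq t d" "b \<in> Lsq t d" "c \<in> Lsq t d" "e \<in> Lsq t d" using assms by (simp_all add: N GL2Lsq_iff)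
  fix x assume "x \<in> spanF (N *v v)"
  then obtain p q where pq: "p \<in> Lsq t d" "q \<in> Lsq t d" "x = p * (a * v$1 + b * v$2) + q * (c * v$1 + e * v$2)"
    by (auto simp: spanF_def N mat22_mult_vec)
  then have "x = (p * a + q * c) * v$1 + (p * b + q * e) * v$2" by (simp add: algebra_simps)
  moreover have "p * a + q * c \<in> Lsq t d" "p * b + q * e \<in> Lsq t d" using pq F Lsq_closed by simp_all
  ultimately show "x \<in> spanF v" unfolding spanF_def by blast
qed

lemma spanF_mult:
  assumes "N \<in> GL2Lsq t d"
  shows "spanF (N *v v) = spanF v"
proof -
  obtain M where M: "M \<in> GL2Lsq t d" "M ** N = mat 1" by (rule subgroup_GL_inverse[OF GL2Lsq_subgroup assms])
  have "spanF (M *v (N *v v)) \<subseteq> spanF (N *v v)" by (rule spanF_mult_subset[OF M(1)])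
  then show ?thesis using spanF_mult_subset[OF assms] by (simp add: matrix_vector_mul_assoc M(2) subset_antisym)
qed

text \<open>The image of (r, 0)' is (a r, c r)', which satisfies the relation with coefficients c
  and -a. They are not both zero, as they form a column of an invertible matrix.\<close>

lemma not_indepF_mult:
  assumes N: "N \<in> GL2Lsq t d"
  shows "\<not> indepF (N *v vector [r, 0])"
proof
  assume ind: "indepF (N *v vector [r, 0])"
  obtain a b c e where Nb: "N = mat22 a b c e" by (rule mat22_cases)
  have F: "a \<in> Lsq t d" "c \<in> Lsq t d" "a * e - b * c \<noteq> 0" using N by (simp_all add: Nb GL2Lsq_iff)
  have "c * (N *v vector [r, 0])$1 + (- a) * (N *v vector [r, 0])$2 = 0" by (simp add: Nb mat22_mult_vec)
  then have "c = 0 \<and> - a = 0" using ind F Lsq_closed(5) unfolding indepF_def by blast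
  then show False using F(3) by simp
qed

lemma basis_change:
  assumes v: "indepF v" and w: "indepF w" "spanF w = spanF v"
  obtains N where "N \<in> GL2Lsq t d" "N *v v = w"
proof -
  have "w$1 \<in> spanF w"
    unfolding spanF_def mem_Collect_eq by (rule exI[of _ 1], rule exI[of _ 0]) (simp add: Lsq_closed)
  moreover have "w$2 \<in> spanF w"
    unfolding spanF_def mem_Collect_eq by (rule exI[of _ 0], rule exI[of _ 1]) (simp add: Lsq_closed)
  ultimately have "w$1 \<in> spanF w" "w$2 \<in> spanF w" .
  then obtain a b c e where F: "a \<in> Lsq t d" "b \<in> Lsq t d" "c \<in> Lsq t d" "e \<in> Lsq t d"
    and w1: "w$1 = a * v$1 + b * v$2" and w2: "w$2 = c * v$1 + e * v$2"
    unfolding w(2) by (auto simp: spanF_def)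
  have "a * e - b * c \<noteq> 0"
  proof
    assume z: "a * e - b * c = 0"
    \<comment> \<open>Multiplication by the adjugate: a vanishing determinant would give linear
      relations between the coordinates of w.\<close>
    have "e * w$1 + (- b) * w$2 = (a * e - b * c) * v$1" "(- c) * w$1 + a * w$2 = (a * e - b * c) * v$2"
      by (simp_all add: w1 w2 algebra_simps)
    then have "e * w$1 + (- b) * w$2 = 0" "(- c) * w$1 + a * w$2 = 0" by (simp_all add: z)
    then have "e = 0 \<and> - b = 0" "- c = 0 \<and> a = 0" using w(1) F Lsq_closed(5) unfolding indepF_def by blast+
    then have "w$1 = 0" by (simp add: w1)
    then have "1 * w$1 + 0 * w$2 = 0" by simp
    then show False using w(1) Lsq_closed(1,2) unfolding indepF_def by (metis one_neq_zero)
  qed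
  then have "mat22 a b c e \<in> GL2Lsq t d" using F by (simp add: GL2Lsq_iff)
  moreover have "mat22 a b c e *v v = w" unfolding mat22_mult_vec w1[symmetric] w2[symmetric] by (rule vec2_eta)
  ultimately show thesis by (rule that)
qed

lemma acts_on_Lsq: "acts_on (units_of_field\<lparr>carrier := Lsq t d - {0}\<rparr>) (UNIV :: 'k set) (*)"
proof -
  have "group (units_of_field\<lparr>carrier := Lsq t d - {0}\<rparr>)"
  proof (rule groupI)
    fix x assume "x \<in> carrier (units_of_field\<lparr>carrier := Lsq t d - {0}\<rparr>)"
    then have "x \<in> Lsq t d" "x \<noteq> 0" by simp_all
    then have "1 / x \<in> Lsq t d - {0}" "1 / x * x = 1" using Lsq_closed(6) by simp_all
    then show "\<exists>y\<in>carrier (units_of_field\<lparr>carrier := Lsq t d - {0}\<rparr>).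
        y \<otimes>\<^bsub>units_of_field\<lparr>carrier := Lsq t d - {0}\<rparr>\<^esub> x = \<one>\<^bsub>units_of_field\<lparr>carrier := Lsq t d - {0}\<rparr>\<^esub>"
      by (intro bexI[of _ "1 / x"]) (simp_all add: units_of_field_def)
  qed (auto simp: units_of_field_def intro: Lsq_closed)
  then show ?thesis by (simp add: acts_on_def units_of_field_def mult.assoc)
qed

text \<open>If the coordinates of a vector are independent over the subfield, their span is a
  complete invariant. Otherwise the vector can be moved to the form (x, 0)', and x matters only up
  to nonzero factors from the subfield.\<close>

lemma orbits_GL2Lsq:
  assumes R: "system_of_reps R (orbits (units_of_field\<lparr>carrier := Lsq t d - {0}\<rparr>) UNIV (*))"
    and R2: "R2 \<subseteq> (\<Union>U\<in>two_dim_subspaces (Lsq t d). ordered_bases2 (Lsq t d) U)"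
    and R2u: "\<forall>U\<in>two_dim_subspaces (Lsq t d). \<exists>!v. v \<in> R2 \<inter> ordered_bases2 (Lsq t d) U"
  shows "system_of_reps ({vector [r, 0] | r. r \<in> R} \<union> R2) (orbits (GL\<lparr>carrier := GL2Lsq t d\<rparr>) UNIV (*v))"
proof (rule system_of_reps_orbitsI[OF acts_on_vec[OF GL2Lsq_subgroup]])
  let ?T = "{vector [r, 0] | r. r \<in> R} \<union> R2"
  have Rex: "\<exists>!r. r \<in> R \<and> (\<exists>f\<in>Lsq t d - {0}. f * x = r)" for x
    using R unfolding system_of_reps_orbits_iff[OF acts_on_Lsq] by simp
  have ind: "indepF v" if "v \<in> R2" for v
    using R2 that by (auto simp: ordered_bases2_iff)
  have uni: "\<exists>!w. w \<in> R2 \<and> spanF v = spanF w \<and> indepF w" if "indepF v" for v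
  proof -
    have "spanF v \<in> two_dim_subspaces (Lsq t d)" using that unfolding two_dim_subspaces_iff by blast
    then show ?thesis using R2u by (simp add: ordered_bases2_iff)
  qed
  {
    fix v :: "'k^2"
    have "\<exists>N\<in>GL2Lsq t d. N *v v \<in> ?T"
    proof (cases "indepF v")
      case True
      then obtain w where w: "w \<in> R2" "spanF v = spanF w" "indepF w" using uni by blast
      obtain N where "N \<in> GL2Lsq t d" "N *v v = w" using basis_change[OF True w(3)] w(2) by metis
      then show ?thesis using w(1) by auto
    next
      case False
      then obtain a b where ab: "a \<in> Lsq t d" "b \<in> Lsq t d" "a * v$1 + b * v$2 = 0" "a \<noteq> 0 \<or> b \<noteq> 0"
        unfolding indepF_def by blast
      \<comment> \<open>The linear relation becomes the second row of N; the first row is a unit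
        vector chosen to keep N invertible.\<close>
      obtain N x where N: "N \<in> GL2Lsq t d" "N *v v = vector [x, 0]"
      proof (cases "a = 0")
        case True
        then have "mat22 1 0 0 b \<in> GL2Lsq t d" using ab Lsq_closed by (simp add: GL2Lsq_iff)
        moreover have "mat22 1 0 0 b *v v = vector [v$1, 0]" using ab True by (simp add: mat22_mult_vec)
        ultimately show thesis by (rule that)
      next
        case False
        then have "mat22 0 1 a b \<in> GL2Lsq t d" using ab Lsq_closed by (simp add: GL2Lsq_iff)
        moreover have "mat22 0 1 a b *v v = vector [v$2, 0]" using ab by (simp add: mat22_mult_vec)
        ultimately show thesis by (rule that)
      qed
      obtain f where f: "f \<in> Lsq t d - {0}" "f * x \<in> R" using Rex[of x] by blast
      have M: "mat22 f 0 0 1 \<in> GL2Lsq t d" using f Lsq_closed by (simp add: GL2Lsq_iff)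
      have "(mat22 f 0 0 1 ** N) *v v = vector [f * x, 0]"
        by (simp add: matrix_vector_mul_assoc[symmetric] N(2)) (simp add: mat22_mult_vec)
      moreover have "mat22 f 0 0 1 ** N \<in> GL2Lsq t d" using subgroup.m_closed[OF GL2Lsq_subgroup M N(1)] by simp
      ultimately show ?thesis using f(2) by (intro bexI[of _ "mat22 f 0 0 1 ** N"]) auto
    qed
    then show "\<exists>g\<in>carrier (GL\<lparr>carrier := GL2Lsq t d\<rparr>). g *v v \<in> ?T" by simp
  }
  fix v w N assume v: "v \<in> ?T" and w: "w \<in> ?T" and "N \<in> carrier (GL\<lparr>carrier := GL2Lsq t d\<rparr>)" and Nv: "N *v v = w"
  then have N: "N \<in> GL2Lsq t d" by simp
  obtain M where M: "M \<in> GL2Lsq t d" "M ** N = mat 1" by (rule subgroup_GL_inverse[OF GL2Lsq_subgroup N])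
  have Mw: "M *v w = v" by (simp add: Nv[symmetric] matrix_vector_mul_assoc M(2))
  from v show "v = w"
  proof
    assume "v \<in> {vector [r, 0] | r. r \<in> R}"
    then obtain r where r: "r \<in> R" "v = vector [r, 0]" by blast
    have "w \<notin> R2" using not_indepF_mult[OF N] ind Nv r(2) by auto
    then obtain s where s: "s \<in> R" "w = vector [s, 0]" using w by blast
    obtain a b c e where Nb: "N = mat22 a b c e" by (rule mat22_cases)
    have F: "a \<in> Lsq t d" "a * e - b * c \<noteq> 0" using N by (simp_all add: Nb GL2Lsq_iff)
    have eq: "a * r = s" "c * r = 0" using Nv by (simp_all add: r(2) s(2) Nb mat22_mult_vec vec2_eq_iff)
    have one: "1 \<in> Lsq t d - {0}" using Lsq_closed(2) by simp
    have "r = s"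
    proof (cases "r = 0")
      case False
      then have "a \<noteq> 0" using eq(2) F(2) by auto
      then have "\<exists>f\<in>Lsq t d - {0}. f * r = s" using F(1) eq(1) by blast
      moreover have "\<exists>f\<in>Lsq t d - {0}. f * r = r" using one by force
      ultimately show ?thesis using Rex[of r] r(1) s(1) by blast
    qed (use eq(1) in simp)
    then show ?thesis by (simp add: r s)
  next
    assume vR: "v \<in> R2"
    have "w \<in> R2"
    proof (rule ccontr)
      assume "w \<notin> R2"
      then obtain s where "w = vector [s, 0]" using w by blast
      then show False using not_indepF_mult[OF M(1)] ind[OF vR] Mw by auto
    qed
    then show ?thesis using uni[OF ind[OF vR]] vR ind spanF_mult[OF N, of v] Nv by metis
  qed
qed simp

subsection \<open>The affine action on \<open>\<bbbK>\<^sup>2\<close>\<close>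

text \<open>Since t = 0, the element 1 + d is the norm of 1 + omega and hence nonzero. So E_2 always
  serves as a representing block in the inseparable case.\<close>

lemma fQ_one_nonzero: "fQ (mat 1) \<noteq> 0"
proof -
  have "1 + d \<noteq> 0" using norm_form_eq_0[of 1 1] by (simp add: t0)
  moreover have "1 - d = 1 + d" using two_simps(2)[of d] by (metis add_uminus_conv_diff)
  ultimately have "1 - d \<noteq> 0" by metis
  then show ?thesis by (simp add: fQ_def mat22_mat vec_eq_iff forall_2)
qed

text \<open>For Z = AB = p + q omega the matrix Z + Z' has zero diagonal and off-diagonal entries q
  (1 + d), so multiplication by i makes it scalar. The same number arises as the contribution of the
  block E_2 to a diagonal block.\<close>

lemma hash_coeff:
  assumes "A \<in> L" "B \<in> L"
  shows "scalar_of ((A ** B + transpose (A ** B)) ** imat) = skew_coeff (A ** transpose B)"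
proof -
  obtain x y u v where AB: "A = el x y" "B = el u v" using assms by (auto simp: LL_iff)
  have "(A ** B + transpose (A ** B)) ** imat = mat ((1 + d) * (x * v + y * u))"
    unfolding AB el_mult
    by (simp add: el_def mat22_simps two_simps algebra_simps flip: add_uminus_conv_diff)
  moreover have "skew_coeff (A ** transpose B) = (1 + d) * (x * v + y * u)"
    unfolding AB by (simp add: el_def mat22_mult mat22_transpose skew_coeff_def two_simps algebra_simps flip: add_uminus_conv_diff)
  ultimately show ?thesis by simp
qed

lemma hash_act_block:
  assumes "A \<in> L" "B \<in> L" "C \<in> L" "D \<in> L"
  shows "hash_act (block A B C D) x = vector [det2 A * x$1 + det2 B * x$2 + skew_coeff (A ** transpose B),
     det2 C * x$1 + det2 D * x$2 + skew_coeff (C ** transpose D)]"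
  using assms by (simp add: hash_act_def hash_coeff square_eq)

lemma rho_eq: "rho (z :: 'k^2) = alt_mat (z$1) (mat 1) (z$2)"
proof -
  have "- mat 1 = (mat 1 :: 'k mat2)" by (simp add: mat22_simps two_simps)
  then show ?thesis by (simp add: rho_def alt_mat_def block_eq_iff matrix_mult_mat)
qed

text \<open>Determinant 1 fixes the vector \<open>fQ (mat 1)\<close>, so the image is again a coset
  of some \<open>rho\<close>; its diagonal coefficients are given by the formula defining the #
  action.\<close>

lemma act_rho:
  assumes "g \<in> SL2L t d"
  shows "coset_act g (rho z +o PL t d) = rho (hash_act g z) +o PL t d"
proof -
  obtain A B C D where gb: "g = block A B C D" by (rule block_cases)
  have L: "A \<in> L" "B \<in> L" "C \<in> L" "D \<in> L" and det: "A ** D - B ** C = mat 1"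
    using assms by (simp_all add: SL2L_iff gb block_mats_over_L det_L_block)
  have "coset_act g (rho z +o PL t d) = act g (rho z) +o PL t d"
    using assms SL2L_subset GL2L_stab_PL by (intro coset_act_coset) blast
  also have "\<dots> = rho (hash_act g z) +o PL t d"
    using fQ_act[OF L, of "z$1" "mat 1" "z$2"]
    by (simp add: coset_eq_iff[OF ksubspace_PL] rho_eq gb act_alt_mat hash_act_block L alt_mat_linear PL_iff fP_eq_fQ
        fQ_linear(2) det)
  finally show ?thesis .
qed

lemma rho_inj: "rho z +o PL t d = rho w +o PL t d \<longleftrightarrow> z = w"
  by (simp add: coset_eq_iff[OF ksubspace_PL] rho_eq alt_mat_linear PL_iff fP_linear vec_eq_iff forall_2)

text \<open>The laws of an action are inherited from the action on cosets along the injective map z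
  to \<open>rho z\<close> + P, so no computation with the affine parts is required.\<close>

lemma acts_on_hash: "acts_on (GLsub (SL2L t d)) (UNIV :: ('k^2) set) hash_act"
  unfolding acts_on_def
proof (intro conjI ballI)
  show "group (GLsub (SL2L t d))" by (rule group_GLsub[OF SL2L_subgroup])
  fix z :: "'k^2"
  have "mat 1 \<in> SL2L t d" by (simp add: SL2L_iff)
  then have "rho (hash_act (mat 1) z) +o PL t d = rho z +o PL t d"
    using act_rho[of "mat 1" z] by (simp add: coset_act_def)
  then show "hash_act \<one>\<^bsub>GLsub (SL2L t d)\<^esub> z = z" by (simp add: rho_inj)
  fix g h assume "g \<in> carrier (GLsub (SL2L t d))" "h \<in> carrier (GLsub (SL2L t d))"
  then have gh: "g \<in> SL2L t d" "h \<in> SL2L t d" "g ** h \<in> SL2L t d"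
    using subgroup.m_closed[OF SL2L_subgroup, of g h] by simp_all
  have "rho (hash_act (g ** h) z) +o PL t d = rho (hash_act g (hash_act h z)) +o PL t d"
    by (simp add: act_rho[symmetric] gh coset_act_def image_image act_mult)
  then show "hash_act (g \<otimes>\<^bsub>GLsub (SL2L t d)\<^esub> h) z = hash_act g (hash_act h z)" by (simp add: rho_inj)
qed simp

lemma group_action_hash: "group_action (GLsub (SL2L t d)) (UNIV :: ('k^2) set) hash_act"
  using acts_on_group_action[OF acts_on_hash] by (simp add: restrict_UNIV)

lemma hash_affine:
  assumes "g \<in> SL2L t d"
  shows "affine_over (Lsq t d) (hash_act g)"
proof -
  obtain A B C D where gb: "g = block A B C D" by (rule block_cases)
  have L: "A \<in> L" "B \<in> L" "C \<in> L" "D \<in> L" using assms by (simp_all add: SL2L_iff gb block_mats_over_L)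
  show ?thesis
    unfolding affine_over_def
  proof (intro exI conjI allI ballI)
    fix x y :: "'k^2" and a
    show "mat22 (det2 A) (det2 B) (det2 C) (det2 D) *v (x + y)
      = mat22 (det2 A) (det2 B) (det2 C) (det2 D) *v x + mat22 (det2 A) (det2 B) (det2 C) (det2 D) *v y"
      by (rule matrix_vector_right_distrib)
    show "mat22 (det2 A) (det2 B) (det2 C) (det2 D) *v (a *s x) = a *s (mat22 (det2 A) (det2 B) (det2 C) (det2 D) *v x)"
      by (simp add: mat22_mult_vec vec_eq_iff forall_2 algebra_simps)
    show "hash_act g x = mat22 (det2 A) (det2 B) (det2 C) (det2 D) *v x
        + vector [skew_coeff (A ** transpose B), skew_coeff (C ** transpose D)]"
      by (simp add: gb hash_act_block L mat22_mult_vec vec_eq_iff forall_2)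
  qed
qed

text \<open>The upper unitriangular matrix with entry B adds N(B) x_2 + \<open>skew_coeff\<close> of
  B' to x_1. If x_2 is nonzero, then B = 1 moves x; if x_2 = 0, then B = omega adds the nonzero
  number 1 + d.\<close>

lemma hash_no_fixed_point: "\<exists>g\<in>SL2L t d. hash_act g x \<noteq> x"
proof (cases "x$2 = 0")
  case False
  have "block (mat 1) (mat 1) 0 (mat 1) \<in> SL2L t d" by (simp add: SL2L_iff block_mats_over_L det_L_block)
  moreover have "hash_act (block (mat 1) (mat 1) 0 (mat 1)) x $ 1 \<noteq> x $ 1"
    using False by (simp add: hash_act_block) (simp add: skew_coeff_def mat22_mat)
  ultimately show ?thesis by metis
next
  case True
  have "1 + d \<noteq> 0" using norm_form_eq_0[of 1 1] by (simp add: t0)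
  then have "skew_coeff (transpose (el 0 1)) \<noteq> 0" by (simp add: el_def mat22_transpose skew_coeff_def)
  then have "hash_act (block (mat 1) (el 0 1) 0 (mat 1)) x $ 1 \<noteq> x $ 1"
    using True by (simp add: hash_act_block)
  moreover have "block (mat 1) (el 0 1) 0 (mat 1) \<in> SL2L t d" by (simp add: SL2L_iff block_mats_over_L det_L_block)
  ultimately show ?thesis by metis
qed

lemma coset_in_complement_iff:
  "X +o PL t d \<in> quot Lam (PL t d) - quot (perp (PL t d)) (PL t d) \<longleftrightarrow> X \<in> Lam \<and> X \<notin> perp (PL t d)"
  using coset_in_quot_iff[OF ksubspace_PL ksubspace_Lam PL_subset_Lam]
    coset_in_quot_iff[OF ksubspace_PL ksubspace_perp_PL PL_subset_perp] by simp

lemma acts_on_complement: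
  "acts_on (GLsub (GL2L t d)) (quot Lam (PL t d) - quot (perp (PL t d)) (PL t d)) coset_act"
proof -
  have "coset_act g C \<in> quot Lam (PL t d) - quot (perp (PL t d)) (PL t d)"
    if g: "g \<in> GL2L t d" and C: "C \<in> quot Lam (PL t d) - quot (perp (PL t d)) (PL t d)" for g C
  proof
    show "coset_act g C \<in> quot Lam (PL t d)" using acts_on_closed[OF acts_on_quot_PL, of g C] g C by simp
    show "coset_act g C \<notin> quot (perp (PL t d)) (PL t d)"
    proof
      assume *: "coset_act g C \<in> quot (perp (PL t d)) (PL t d)"
      obtain h where h: "h \<in> GL2L t d" "h ** g = mat 1" by (rule subgroup_GL_inverse[OF GL2L_subgroup g])
      have "coset_act h (coset_act g C) = C" by (simp add: coset_act_def image_image act_mult[symmetric] h(2))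
      then show False using acts_on_closed[OF acts_on_quot_perp_PL _ *, of h] h(1) C by simp
    qed
  qed
  then show ?thesis using acts_on_quot_PL unfolding acts_on_def by (simp del: Diff_iff) blast
qed

text \<open>A diagonal matrix moves the nonzero vector \<open>fQ Y\<close> to
  \<open>fQ (mat 1)\<close>. Any element of GL_2(L) joining two cosets with this vector has
  determinant 1, so what remains is the # action of SL_2(L).\<close>

lemma orbits_complement:
  assumes R: "system_of_reps R (orbits (GLsub (SL2L t d)) UNIV hash_act)"
  shows "system_of_reps {rho z +o PL t d | z. z \<in> R}
    (orbits (GLsub (GL2L t d)) (quot Lam (PL t d) - quot (perp (PL t d)) (PL t d)) coset_act)"
proof (rule system_of_reps_orbitsI[OF acts_on_complement])
  have Rex: "\<exists>!r. r \<in> R \<and> (\<exists>g\<in>SL2L t d. hash_act g x = r)" for x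
    using R unfolding system_of_reps_orbits_iff[OF acts_on_hash] by simp
  show "{rho z +o PL t d | z. z \<in> R} \<subseteq> quot Lam (PL t d) - quot (perp (PL t d)) (PL t d)"
  proof
    fix C assume "C \<in> {rho z +o PL t d | z. z \<in> R}"
    then obtain z where z: "C = rho z +o PL t d" by blast
    show "C \<in> quot Lam (PL t d) - quot (perp (PL t d)) (PL t d)"
      unfolding z coset_in_complement_iff using fQ_one_nonzero by (simp add: rho_eq perp_PL_iff)
  qed
  fix C assume C: "C \<in> quot Lam (PL t d) - quot (perp (PL t d)) (PL t d)"
  then obtain X where X: "X \<in> Lam" "C = X +o PL t d" by (auto elim: quot_cases)
  then obtain x Y z where Xb: "X = alt_mat x Y z" by (auto simp: Lam_iff)
  have "X \<notin> perp (PL t d)" using C unfolding X(2) coset_in_complement_iff by blast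
  then have Y: "fQ Y \<noteq> 0" by (simp add: Xb perp_PL_iff)
  obtain A where A: "A \<in> L" "A \<noteq> 0" "A *v fQ Y = fQ (mat 1)" using LL_transitive[OF Y fQ_one_nonzero] by blast
  let ?g = "block A 0 0 (mat 1)"
  have g: "?g \<in> GL2L t d" using A by (simp add: GL2L_iff block_mats_over_L det_L_block)
  let ?w = "vector [det2 A * x, z] :: 'k^2"
  have "coset_act ?g C = act ?g X +o PL t d"
    unfolding X(2) using g GL2L_stab_PL by (intro coset_act_coset) blast
  also have "\<dots> = rho ?w +o PL t d"
    by (simp add: coset_eq_iff[OF ksubspace_PL] Xb rho_eq act_alt_mat alt_mat_linear PL_iff fP_eq_fQ fQ_linear(2) fQ_LL_mult A)
  finally have gC: "coset_act ?g C = rho ?w +o PL t d" .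
  obtain h where h: "h \<in> SL2L t d" "hash_act h ?w \<in> R" using Rex by blast
  have "coset_act (h ** ?g) C = coset_act h (coset_act ?g C)" by (simp add: coset_act_def image_image act_mult)
  also have "\<dots> = rho (hash_act h ?w) +o PL t d" by (simp add: gC act_rho[OF h(1)])
  finally have "coset_act (h ** ?g) C \<in> {rho z +o PL t d | z. z \<in> R}" using h(2) by blast
  moreover have "h ** ?g \<in> GL2L t d"
    using subgroup.m_closed[OF GL2L_subgroup _ g, of h] h(1) SL2L_subset by auto
  ultimately show "\<exists>g\<in>carrier (GLsub (GL2L t d)). coset_act g C \<in> {rho z +o PL t d | z. z \<in> R}" by auto
next
  fix r s g
  assume "r \<in> {rho z +o PL t d | z. z \<in> R}" "s \<in> {rho z +o PL t d | z. z \<in> R}"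
    and "g \<in> carrier (GLsub (GL2L t d))" and grs: "coset_act g r = s"
  then obtain z w where z: "z \<in> R" "r = rho z +o PL t d" and w: "w \<in> R" "s = rho w +o PL t d" and g: "g \<in> GL2L t d"
    by auto
  obtain A B C D where gb: "g = block A B C D" by (rule block_cases)
  have L: "A \<in> L" "B \<in> L" "C \<in> L" "D \<in> L" using g by (simp_all add: GL2L_iff gb block_mats_over_L)
  have "coset_act g r = act g (rho z) +o PL t d"
    unfolding z(2) using g GL2L_stab_PL by (intro coset_act_coset) blast
  then have "act g (rho z) +o PL t d = rho w +o PL t d" using grs w(2) by simp
  then have "act g (rho z) - rho w \<in> PL t d" unfolding coset_eq_iff[OF ksubspace_PL] .
  then have "(A ** D - B ** C) *v fQ (mat 1) - fQ (mat 1) = 0"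
    using fQ_act[OF L, of "z$1" "mat 1" "z$2"]
    by (simp add: rho_eq gb act_alt_mat alt_mat_linear PL_iff fP_eq_fQ fQ_linear(2))
  then have "(A ** D - B ** C - mat 1) *v fQ (mat 1) = 0" by (simp only: diff_mult_vec matrix_vector_mul_lid)
  \<comment> \<open>A nonzero element of L is an invertible matrix and cannot annihilate a nonzero
    vector.\<close>
  then have "A ** D - B ** C - mat 1 = 0" using L fQ_one_nonzero by (intro LL_mult_vec_eq_0) auto
  then have "g \<in> SL2L t d" using g by (simp add: SL2L_iff GL2L_iff gb det_L_block)
  moreover from this have "hash_act g z = w" using grs by (simp add: z(2) w(2) act_rho rho_inj)
  moreover have "\<exists>h\<in>SL2L t d. hash_act h z = z"
    using acts_on_one[OF acts_on_hash, of z] by (intro bexI[of _ "mat 1"]) (simp_all add: SL2L_iff)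
  moreover have "\<exists>!r. r \<in> R \<and> (\<exists>g\<in>SL2L t d. hash_act g z = r)"
    using R unfolding system_of_reps_orbits_iff[OF acts_on_hash] by simp
  ultimately have "z = w" using z(1) w(1) by blast
  then show "r = s" by (simp add: z w)
qed

end

theorem theorem5p6:
  fixes t d :: "'k::field"
  assumes two_t: "2 * t = 0"
    and irred: "irreducible [:d, t, 1:]"
  shows
    "(generate (BijGroup (LL t d)) {restrict (lconj t) (LL t d)} = Gal t d) \<and>
     (GL4_stab (PL t d) = times_Xi t (GL2L t d)) \<and>
     (GL4_stab (perp (PL t d)) = times_Xi t (GL2L t d)) \<and>
     (GL4_stab (PL0 t d) = times_Xi t (upper_triangular_group t d)) \<and>
     (card (orbits (GLsub (GL4_stab (PL t d))) UNIV (*v)) = 2 \<and>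
     system_of_reps {0, bvec 0} (orbits (GLsub (GL4_stab (PL t d))) (UNIV :: ('k^4) set) (*v))) \<and>
     (card (orbits (GLsub (GL4_stab (PL t d))) (quot Lam (perp (PL t d))) coset_act) = 2 \<and>
     (\<forall>C \<in> quot Lam (perp (PL t d)). C \<noteq> perp (PL t d) \<longrightarrow>
        system_of_reps {perp (PL t d), C}
          (orbits (GLsub (GL4_stab (PL t d))) (quot Lam (perp (PL t d))) coset_act))) \<and>
     (CHAR('k) \<noteq> 2 \<longrightarrow> separable_ext t d) \<and>
     (separable_ext t d \<longrightarrow>
       equivalent_actions (GLsub (GL2L t d))
         (quot_space Lam (PL t d)) coset_act (herm_space t d) (herm_act t) \<and>
       action_equivalence (GLsub (GL2L t d))
         (herm_space t d) (herm_act t) (quot_space Lam (PL t d)) coset_act (herm_to_quot t d) \<and>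
       (\<forall>M\<in>diag_Herm. transported_act t d (Xi t) M = - M) \<and>
       (\<forall>M\<in>Herm t d. anisotropic t d M \<longrightarrow>
         (\<forall>\<Omega> \<in> orbits (GLsub (times_Xi t (GL2L t d))) (quot Lam (PL t d)) coset_act.
            herm_to_quot t d M \<in> \<Omega> \<longrightarrow>
            ((\<exists>\<Omega>\<^sub>1 \<in> orbits (GLsub (GL2L t d)) (quot Lam (PL t d)) coset_act.
              \<exists>\<Omega>\<^sub>2 \<in> orbits (GLsub (GL2L t d)) (quot Lam (PL t d)) coset_act.
                \<Omega>\<^sub>1 \<noteq> \<Omega>\<^sub>2 \<and> \<Omega> = \<Omega>\<^sub>1 \<union> \<Omega>\<^sub>2)
             \<longleftrightarrow> - mat 1 \<notin> norm_group t d M)))) \<and>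
     (\<not> separable_ext t d \<longrightarrow>
       squares_mat ` GL2L t d = GL2Lsq t d \<and>
       subgroup (GL2Lsq t d) GL \<and>
       equivalent_actions (GLsub (GL2L t d))
         (quot_space (perp (PL t d)) (PL t d)) coset_act vec_space (\<lambda>g v. squares_mat g *v v) \<and>
       (\<forall>R R2.
          system_of_reps R
            (orbits (units_of_field\<lparr>carrier := Lsq t d - {0}\<rparr>) UNIV (*)) \<and>
          R2 \<subseteq> (\<Union>U\<in>two_dim_subspaces (Lsq t d). ordered_bases2 (Lsq t d) U) \<and>
          (\<forall>U\<in>two_dim_subspaces (Lsq t d). \<exists>!v. v \<in> R2 \<inter> ordered_bases2 (Lsq t d) U)
          \<longrightarrow> system_of_reps ({vector [r, 0] | r. r \<in> R} \<union> R2)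
                (orbits (GL\<lparr>carrier := GL2Lsq t d\<rparr>) UNIV (*v))) \<and>
       group_action (GLsub (SL2L t d)) UNIV hash_act \<and>
       (\<forall>g\<in>SL2L t d. affine_over (Lsq t d) (hash_act g)) \<and>
       (\<forall>R\<^sub>h. system_of_reps R\<^sub>h (orbits (GLsub (SL2L t d)) UNIV hash_act) \<longrightarrow>
          system_of_reps {rho z +o PL t d | z. z \<in> R\<^sub>h}
            (orbits (GLsub (GL2L t d))
              (quot Lam (PL t d) - quot (perp (PL t d)) (PL t d)) coset_act)) \<and>
       (\<forall>x. \<exists>g\<in>SL2L t d. hash_act g x \<noteq> x)) \<and>
     (system_of_reps {0, bvec 0, bvec 2}
       (orbits (GLsub (GL4_stab (PL0 t d))) (UNIV :: ('k^4) set) (*v))) \<and>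
     (\<forall>R\<^sub>N. system_of_reps R\<^sub>N
         (rcosets\<^bsub>units_of_field\<^esub>
            (norm_values t d <#>\<^bsub>units_of_field\<^esub> generate units_of_field {- 1})) \<longrightarrow>
       (d \<noteq> - 1 \<longrightarrow>
         system_of_reps
           ({PL0 t d, (sbas 0 2 + sbas 1 3) +o PL0 t d} \<union> {mscale c (sbas 2 3) +o PL0 t d | c. c \<in> R\<^sub>N})
           (orbits (GLsub (GL4_stab (PL0 t d))) (quot Lam (PL0 t d)) coset_act)) \<and>
       (d = - 1 \<longrightarrow>
         system_of_reps
           ({PL0 t d, sbas 0 2 +o PL0 t d} \<union> {mscale c (sbas 2 3) +o PL0 t d | c. c \<in> R\<^sub>N})
           (orbits (GLsub (GL4_stab (PL0 t d))) (quot Lam (PL0 t d)) coset_act)))"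
proof -
  interpret quadratic t d by unfold_locales (rule two_t, rule irred)
  have insep: "inseparable t d" if "\<not> separable_ext t d"
    by unfold_locales (rule that)
  have "fP (mat 1) \<noteq> 0" if "d \<noteq> - 1"
    using that by (simp add: fP_def mat22_mat vec_eq_iff forall_2 add_eq_0_iff)
  note quot_PL0_generic = orbits_quot_PL0[OF _ this, folded sbas_alt_mat(4)]
  \<comment> \<open>Here \<open>fP E11\<close> is (1, 0) whatever d is, so the block of s02 is
    available in the exceptional case d = -1.\<close>
  have "fP E11 \<noteq> 0"
    by (simp add: fP_def E11_def vec_eq_iff forall_2)
  note quot_PL0_special = orbits_quot_PL0[OF _ this, folded sbas_alt_mat(3)]
  note general = generate_lconj stab_PL stab_perp_PL stab_PL0 card_orbits_vec orbits_vec_PL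
    card_orbits_quot_perp orbits_quot_perp char_not_2_separable orbits_vec_PL0 quot_PL0_generic quot_PL0_special
  note separable = herm_equivalent_actions herm_action_equivalence transported_Xi_diag orbit_splits_iff
  note inseparable =
    inseparable.squares_mat_image[OF insep] inseparable.GL2Lsq_subgroup[OF insep]
    inseparable.perp_quot_equivalent_actions[OF insep] inseparable.orbits_GL2Lsq[OF insep]
    inseparable.group_action_hash[OF insep] inseparable.hash_affine[OF insep]
    inseparable.orbits_complement[OF insep] inseparable.hash_no_fixed_point[OF insep]
  show ?thesis
    by (intro conjI impI allI ballI; (elim conjE)?; rule general separable inseparable; assumption)
qed

end
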